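(* Consider the problem $d_1^C$-Computation: given a number $k\in\mathbb N$ and two time series $S$ and $T$ of equal length over $\mathbb R^k$, compute (a suitable representation of) the number $d_1^C(S,T)$. If $\mathrm{P}\neq\mathrm{NP}$, then this problem cannot be solved in polynomial time.
   Context: A time series over $\mathbb R^k$ is a finite sequence $T=(t_0,\dots,t_{n-1})$ of vectors $t_i\in\mathbb R^k$; $n=\#T$ is its length. For time series $S=(s_0,\dots,s_{n-1})$, $T=(t_0,\dots,t_{n-1})$ of equal length, $d_1(S,T)=\sum_{i=0}^{n-1}\|s_i-t_i\|_2$ (sum of Euclidean distances). $\mathcal{MO}(k)$ denotes the set of real orthogonal $k\times k$ matrices. For $M\in\mathcal{MO}(k)$ and $v\in\mathbb R^k$, $M\cdot T+v$ denotes the time series $(Mt_0+v,\dots,Mt_{n-1}+v)$. The congruence distance is $d_1^C(S,T)=\min_{M\in\mathcal{MO}(k),\,v\in\mathbb R^k} d_1(S,M\cdot T+v)$ (the minimum is attained). *)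

theory Defs
  imports Complex_Main "HOL-Computational_Algebra.Polynomial" "Jordan_Normal_Form.Matrix"
begin

section \<open>The congruence distance\<close>

definition time_series :: "nat \<Rightarrow> 'a vec list \<Rightarrow> bool" where
  "time_series k T \<longleftrightarrow> set T \<subseteq> carrier_vec k"

definition euclidean_norm :: "real vec \<Rightarrow> real" where
  "euclidean_norm v = sqrt (v \<bullet> v)"

definition d1 :: "real vec list \<Rightarrow> real vec list \<Rightarrow> real" where
  "d1 S T = (\<Sum>i<length S. euclidean_norm (S ! i - T ! i))"

text \<open>The library predicate \<open>orthogonal_mat\<close> only asks for pairwise orthogonal nonzero columns,
  not for orthonormal ones, hence it is not the notion needed here.\<close>

definition MO :: "nat \<Rightarrow> real mat set" where
  "MO k = {M \<in> carrier_mat k k. transpose_mat M * M = 1\<^sub>m k \<and> M * transpose_mat M = 1\<^sub>m k}"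

definition transform :: "real mat \<Rightarrow> real vec \<Rightarrow> real vec list \<Rightarrow> real vec list" where
  "transform M v T = map (\<lambda>t. M *\<^sub>v t + v) T"

text \<open>The infimum is a minimum: \<open>MO k\<close> is compact, and translations may be restricted to a
  bounded set.\<close>

definition congruence_distance :: "nat \<Rightarrow> real vec list \<Rightarrow> real vec list \<Rightarrow> real" where
  "congruence_distance k S T = (INF (M, v) \<in> MO k \<times> carrier_vec k. d1 S (transform M v T))"


section \<open>Deterministic multi-tape Turing machines\<close>

text \<open>
  The tape alphabet is \<open>{0..<num_syms M}\<close>, where \<open>0\<close> is the blank and \<open>1\<close>, \<open>2\<close> are the bits.
  The working states are \<open>{0..<num_states M}\<close> with start state \<open>0\<close>, and the state
  \<open>num_states M\<close> is the only halting state. Tapes are infinite in both directions;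
  a tape is a pair of its contents and the position of its head.
\<close>

datatype move = Move_Left | Stay | Move_Right

record tm =
  num_tapes :: nat
  num_syms :: nat
  num_states :: nat
  trans_fun :: "nat \<Rightarrow> nat list \<Rightarrow> nat \<times> (nat \<times> move) list"

type_synonym tape = "(int \<Rightarrow> nat) \<times> int"
type_synonym config = "nat \<times> tape list"

definition wf_tm :: "tm \<Rightarrow> bool" where
  "wf_tm M \<longleftrightarrow> num_tapes M \<ge> 1 \<and> num_syms M \<ge> 3 \<and>
     (\<forall>q < num_states M. \<forall>ss. length ss = num_tapes M \<and> set ss \<subseteq> {..<num_syms M} \<longrightarrow>
        (case trans_fun M q ss of (q', as) \<Rightarrow>
           q' \<le> num_states M \<and> length as = num_tapes M \<and> fst ` set as \<subseteq> {..<num_syms M}))"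

fun offset :: "move \<Rightarrow> int" where
  "offset Move_Left = -1"
| "offset Stay = 0"
| "offset Move_Right = 1"

fun act :: "nat \<times> move \<Rightarrow> tape \<Rightarrow> tape" where
  "act (s, d) (c, h) = (c(h := s), h + offset d)"

fun step :: "tm \<Rightarrow> config \<Rightarrow> config" where
  "step M (q, tps) =
     (if q < num_states M
      then (case trans_fun M q (map (\<lambda>(c, h). c h) tps) of (q', as) \<Rightarrow> (q', map2 act as tps))
      else (q, tps))"

definition bit_sym :: "bool \<Rightarrow> nat" where
  "bit_sym b = (if b then 2 else 1)"

definition word_contents :: "bool list \<Rightarrow> int \<Rightarrow> nat" where
  "word_contents x i = (if 0 \<le> i \<and> i < int (length x) then bit_sym (x ! nat i) else 0)"

definition init_config :: "tm \<Rightarrow> bool list \<Rightarrow> config" where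
  "init_config M x = (0, (word_contents x, 0) # replicate (num_tapes M - 1) (\<lambda>_. 0, 0))"

text \<open>The output is the word written on the first tape from cell \<open>0\<close> up to the first blank.\<close>

definition output_word :: "config \<Rightarrow> bool list \<Rightarrow> bool" where
  "output_word cfg y \<longleftrightarrow>
     (\<forall>i < length y. fst (hd (snd cfg)) (int i) = bit_sym (y ! i)) \<and>
     fst (hd (snd cfg)) (int (length y)) = 0"

definition outputs_within :: "tm \<Rightarrow> bool list \<Rightarrow> nat \<Rightarrow> bool list \<Rightarrow> bool" where
  "outputs_within M x n y \<longleftrightarrow>
     (\<exists>t \<le> n. fst ((step M ^^ t) (init_config M x)) = num_states M \<and>
              output_word ((step M ^^ t) (init_config M x)) y)"

text \<open>Some machine maps, in time polynomial in the length of the encoding \<open>enc a\<close>, every instance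
  \<open>a \<in> A\<close> to some word \<open>y\<close> that is a correct answer, i.e. satisfies \<open>R a y\<close>. Nothing is asked of
  the machine on words that do not encode an instance.\<close>

definition polytime_solves ::
  "('a \<Rightarrow> bool list) \<Rightarrow> 'a set \<Rightarrow> ('a \<Rightarrow> bool list \<Rightarrow> bool) \<Rightarrow> bool" where
  "polytime_solves enc A R \<longleftrightarrow>
     (\<exists>M (p :: nat poly). wf_tm M \<and>
        (\<forall>a \<in> A. \<exists>y. outputs_within M (enc a) (poly p (length (enc a))) y \<and> R a y))"


section \<open>Encodings\<close>

text \<open>All encodings are prefix-free, so that they can be concatenated.\<close>

definition prefix_free :: "('a \<Rightarrow> bool list) \<Rightarrow> bool" where
  "prefix_free e \<longleftrightarrow> (\<forall>a b u v. e a @ u = e b @ v \<longrightarrow> a = b \<and> u = v)"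

fun enc_list :: "('a \<Rightarrow> bool list) \<Rightarrow> 'a list \<Rightarrow> bool list" where
  "enc_list e [] = [False]"
| "enc_list e (a # as) = True # e a @ enc_list e as"

definition enc_prod :: "('a \<Rightarrow> bool list) \<Rightarrow> ('b \<Rightarrow> bool list) \<Rightarrow> 'a \<times> 'b \<Rightarrow> bool list" where
  "enc_prod e f = (\<lambda>(a, b). e a @ f b)"

definition enc_word :: "bool list \<Rightarrow> bool list" where
  "enc_word = enc_list (\<lambda>b. [b])"

definition enc_unary :: "nat \<Rightarrow> bool list" where
  "enc_unary n = replicate n True @ [False]"

fun bits :: "nat \<Rightarrow> bool list" where
  "bits n = (if n = 0 then [] else odd n # bits (n div 2))"

declare bits.simps [simp del]

definition enc_nat :: "nat \<Rightarrow> bool list" where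
  "enc_nat n = enc_word (bits n)"

definition enc_int :: "int \<Rightarrow> bool list" where
  "enc_int i = (i < 0) # enc_nat (nat \<bar>i\<bar>)"

definition enc_rat :: "rat \<Rightarrow> bool list" where
  "enc_rat r = enc_prod enc_int enc_int (quotient_of r)"

definition enc_series :: "rat vec list \<Rightarrow> bool list" where
  "enc_series = enc_list (\<lambda>v. enc_list enc_rat (list_of_vec v))"

lemma prefix_freeD: "prefix_free e \<Longrightarrow> e a @ u = e b @ v \<Longrightarrow> a = b \<and> u = v"
  unfolding prefix_free_def by blast

lemma prefix_free_inj: "prefix_free e \<Longrightarrow> inj e"
  using prefix_freeD[of e _ "[]" _ "[]"] by (auto intro: injI)

lemma prefix_free_comp: "prefix_free e \<Longrightarrow> inj g \<Longrightarrow> prefix_free (\<lambda>a. e (g a))"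
  unfolding prefix_free_def[of "\<lambda>a. e (g a)"] by (auto dest!: prefix_freeD[of e] dest: injD)

lemma prefix_free_list:
  assumes "prefix_free e"
  shows "prefix_free (enc_list e)"
proof -
  have "enc_list e as @ u = enc_list e bs @ v \<Longrightarrow> as = bs \<and> u = v" for as bs u v
  proof (induction as arbitrary: bs)
    case Nil
    then show ?case by (cases bs) auto
  next
    case (Cons a as)
    then obtain b bs' where bs: "bs = b # bs'" by (cases bs) auto
    with Cons.prems have "e a @ (enc_list e as @ u) = e b @ (enc_list e bs' @ v)" by simp
    from prefix_freeD[OF assms this] Cons.IH[of bs'] bs show ?case by simp
  qed
  then show ?thesis unfolding prefix_free_def by blast
qed

lemma prefix_free_prod: "prefix_free e \<Longrightarrow> prefix_free f \<Longrightarrow> prefix_free (enc_prod e f)"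
  unfolding prefix_free_def[of "enc_prod e f"] unfolding enc_prod_def
  by (auto dest!: prefix_freeD[of e] prefix_freeD[of f])

lemma prefix_free_word: "prefix_free enc_word"
  unfolding enc_word_def by (rule prefix_free_list) (simp add: prefix_free_def)

lemma prefix_free_unary: "prefix_free enc_unary"
proof -
  have "enc_unary m @ u = enc_unary n @ v \<Longrightarrow> m = n \<and> u = v" for m n u v
  proof (induction m arbitrary: n)
    case 0
    then show ?case by (cases n) (auto simp: enc_unary_def)
  next
    case (Suc m)
    then show ?case by (cases n) (auto simp: enc_unary_def)
  qed
  then show ?thesis unfolding prefix_free_def by blast
qed

lemma inj_bits: "inj bits"
proof -
  have "bits m = bits n \<Longrightarrow> m = n" for m n
  proof (induction m arbitrary: n rule: less_induct)
    case (less m)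
    show ?case
    proof (cases "m = 0 \<or> n = 0")
      case True
      with less.prems show ?thesis
        using bits.simps[of m] bits.simps[of n] by (cases "m = 0"; cases "n = 0") simp_all
    next
      case False
      with less.prems have "odd m = odd n" "bits (m div 2) = bits (n div 2)"
        by (auto simp: bits.simps[of m] bits.simps[of n])
      with less.IH[of "m div 2" "n div 2"] False have "m div 2 = n div 2" by simp
      with \<open>odd m = odd n\<close> show ?thesis by presburger
    qed
  qed
  then show ?thesis by (rule injI)
qed

lemma prefix_free_nat: "prefix_free enc_nat"
  unfolding enc_nat_def[abs_def] by (rule prefix_free_comp[OF prefix_free_word inj_bits])

lemma prefix_free_int: "prefix_free enc_int"
  unfolding prefix_free_def enc_int_def
  by (auto dest!: prefix_freeD[OF prefix_free_nat])

lemma prefix_free_rat: "prefix_free enc_rat"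
  unfolding enc_rat_def[abs_def]
  by (rule prefix_free_comp[of "enc_prod enc_int enc_int"])
    (auto intro: prefix_free_prod prefix_free_int injI quotient_of_inject)

lemma prefix_free_series: "prefix_free enc_series"
proof -
  have "inj (list_of_vec :: rat vec \<Rightarrow> rat list)"
    by (rule injI) (metis vec_list)
  then show ?thesis
    unfolding enc_series_def
    by (rule prefix_free_list[OF prefix_free_comp[OF prefix_free_list[OF prefix_free_rat]]])
qed


section \<open>The classes P and NP\<close>

definition class_P :: "bool list set set" where
  "class_P = {L. polytime_solves (\<lambda>x. x) UNIV (\<lambda>x y. y = [x \<in> L])}"

definition class_NP :: "bool list set set" where
  "class_NP = {L. \<exists>V \<in> class_P. \<exists>p :: nat poly. \<forall>x.
     x \<in> L \<longleftrightarrow> (\<exists>y. length y \<le> poly p (length x) \<and> enc_prod enc_word enc_word (x, y) \<in> V)}"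


section \<open>The computation problem\<close>

text \<open>
  A representation of real numbers is a partial map from words (names) to reals. It is suitable if
  it supports comparison with rational numbers: given a name of \<open>x\<close>, a rational \<open>q\<close> and a
  precision \<open>m\<close> in unary, one can distinguish \<open>x \<le> q\<close> from \<open>x \<ge> q + 2\<^sup>-\<^sup>m\<close> in polynomial time
  (with an arbitrary behaviour in between). Exact comparison with rationals in polynomial time
  suffices for that, and so does the computation in polynomial time of rational approximations
  with error at most \<open>2\<^sup>-\<^sup>m\<close>. Without a requirement of this kind a pair of time series would be a
  name of its own congruence distance.
\<close>

definition enc_query :: "bool list \<times> rat \<times> nat \<Rightarrow> bool list" where
  "enc_query = enc_prod enc_word (enc_prod enc_rat enc_unary)"

definition suitable_representation :: "(bool list \<rightharpoonup> real) \<Rightarrow> bool" where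
  "suitable_representation \<rho> \<longleftrightarrow>
     polytime_solves enc_query {(w, q, m). w \<in> dom \<rho>}
       (\<lambda>(w, q, m) y.
          (the (\<rho> w) \<le> real_of_rat q \<longrightarrow> y = [True]) \<and>
          (the (\<rho> w) \<ge> real_of_rat q + 1 / 2 ^ m \<longrightarrow> y = [False]))"

text \<open>As inputs have to be words, the entries of the given time series are rational numbers,
  written as reduced fractions in binary.\<close>

type_synonym series_pair = "nat \<times> rat vec list \<times> rat vec list"

definition series_pairs :: "series_pair set" where
  "series_pairs = {(k, S, T). time_series k S \<and> time_series k T \<and> length S = length T}"

definition enc_series_pair :: "series_pair \<Rightarrow> bool list" where
  "enc_series_pair = enc_prod enc_nat (enc_prod enc_series enc_series)"

definition real_series :: "rat vec list \<Rightarrow> real vec list" where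
  "real_series = map (map_vec real_of_rat)"

definition d1C_computable_in_polytime :: "(bool list \<rightharpoonup> real) \<Rightarrow> bool" where
  "d1C_computable_in_polytime \<rho> \<longleftrightarrow>
     polytime_solves enc_series_pair series_pairs
       (\<lambda>(k, S, T) y. \<rho> y = Some (congruence_distance k (real_series S) (real_series T)))"

lemma inj_enc_query: "inj enc_query"
  unfolding enc_query_def
  by (intro prefix_free_inj prefix_free_prod prefix_free_word prefix_free_rat prefix_free_unary)

lemma inj_enc_series_pair: "inj enc_series_pair"
  unfolding enc_series_pair_def
  by (intro prefix_free_inj prefix_free_prod prefix_free_nat prefix_free_series)

end

theory Submission
  imports Defs "HOL-Analysis.L2_Norm"
begin

text \<open>
  Let \<open>L\<close> be a language in NP. The runs of its verifier on \<open>x\<close> and all certificates are the tilings of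
  a space-time diagram, so \<open>x \<in> L\<close> iff one can choose a tile for each location such that finitely many
  kinds of local constraints hold. A choice of tiles is a vector of signs, one for each pair of a
  location and a tile. Pairs of short vectors supported on at most two coordinates are arranged such
  that an optimal orthogonal matrix is diagonal with entries \<open>\<plusminus>1\<close> (each vector occurs with its
  negative, so translations do not help), and such that the distance is at most \<open>188 k\<^sup>2\<close> if the signs
  of a correct tiling exist and at least \<open>188 k\<^sup>2 + 16\<close> otherwise. Comparing the computed distance with
  \<open>188 k\<^sup>2\<close> then decides \<open>L\<close>.

  Polynomial time is established by compiling a small loop language, in which no register that
  controls a loop may grow, to Turing machines.
\<close>

section \<open>Structured programs over tapes\<close>

text \<open>The minimum ranges over a continuum, so matrices that are not signed diagonal must be
  excluded quantitatively. Unsquared distances make this possible: the sum of the distances of a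
  unit vector to a basis vector and to its negative has a kink at its minima, so leaving a minimum
  costs linearly, while every other gadget is Lipschitz in the columns of the matrix. Hence constant
  lengths suffice in every dimension and rounding to signs loses nothing. For fixed signs, a gadget
  on one coordinate only yields a linear term. The coupling of two signs comes from the strict
  triangle inequality, and the sides 6, 8, 10 keep all costs rational. The resulting energy counts
  vertices and edges of a graph: vertices are pairs of a location and a tile, edges are conflicts,
  and a correct tiling is an independent set with one good vertex per location. The constraint
  between two tiles depends only on the labels of their locations and on the difference of the
  location numbers. Therefore nested loops with moving heads can write the time series without
  arithmetic on indices.\<close>

type_synonym tapes = "nat \<Rightarrow> tape"

datatype com =
  Act "(nat \<Rightarrow> nat) \<Rightarrow> nat \<Rightarrow> nat \<times> move"
| Seq com com
| Cond "(nat \<Rightarrow> nat) \<Rightarrow> bool" com com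
| While "(nat \<Rightarrow> nat) \<Rightarrow> bool" com

definition reads :: "tapes \<Rightarrow> nat \<Rightarrow> nat" where
  "reads T i = fst (T i) (snd (T i))"

inductive exec :: "com \<Rightarrow> tapes \<Rightarrow> nat \<Rightarrow> tapes \<Rightarrow> bool" where
  Act: "exec (Act f) T 1 (\<lambda>i. act (f (reads T) i) (T i))"
| Seq: "exec a T t T1 \<Longrightarrow> exec b T1 u T2 \<Longrightarrow> exec (Seq a b) T (Suc (t + u)) T2"
| CondT: "P (reads T) \<Longrightarrow> exec a T t T1 \<Longrightarrow> exec (Cond P a b) T (Suc t) T1"
| CondF: "\<not> P (reads T) \<Longrightarrow> exec b T t T1 \<Longrightarrow> exec (Cond P a b) T (Suc t) T1"
| WhileF: "\<not> P (reads T) \<Longrightarrow> exec (While P a) T 1 T"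
| WhileT: "P (reads T) \<Longrightarrow> exec a T t T1 \<Longrightarrow> exec (While P a) T1 u T2 \<Longrightarrow>
    exec (While P a) T (Suc (t + u)) T2"

text \<open>The second alternative admits symbols copied from another tape. As all tapes start with
  symbols below \<open>G\<close>, they stay below \<open>G\<close>. Tests may look at every tape;
  only the tapes below \<open>K\<close> may be changed or moved.\<close>

primrec wf_com :: "nat \<Rightarrow> nat \<Rightarrow> com \<Rightarrow> bool" where
  "wf_com K G (Act f) \<longleftrightarrow> (\<forall>rd i. (K \<le> i \<longrightarrow> f rd i = (rd i, Stay)) \<and>
     (fst (f rd i) < G \<or> fst (f rd i) \<in> range rd))"
| "wf_com K G (Seq a b) \<longleftrightarrow> wf_com K G a \<and> wf_com K G b"
| "wf_com K G (Cond P a b) \<longleftrightarrow> wf_com K G a \<and> wf_com K G b"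
| "wf_com K G (While P a) \<longleftrightarrow> wf_com K G a"

lemma wf_com_mono: "wf_com K G c \<Longrightarrow> K \<le> K' \<Longrightarrow> G \<le> G' \<Longrightarrow> wf_com K' G' c"
  by (induction c) (auto, meson dual_order.strict_trans1)

text \<open>The states of the compiled machine are the continuations, i.e. the lists of commands that
  remain to be executed; only finitely many of them are reachable.\<close>

fun cstep :: "com list \<Rightarrow> (nat \<Rightarrow> nat) \<Rightarrow> com list \<times> (nat \<Rightarrow> nat \<times> move)" where
  "cstep [] rd = ([], \<lambda>i. (rd i, Stay))"
| "cstep (Act f # k) rd = (k, f rd)"
| "cstep (Seq a b # k) rd = (a # b # k, \<lambda>i. (rd i, Stay))"
| "cstep (Cond P a b # k) rd = ((if P rd then a else b) # k, \<lambda>i. (rd i, Stay))"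
| "cstep (While P a # k) rd = (if P rd then a # While P a # k else k, \<lambda>i. (rd i, Stay))"

definition crun :: "com list \<times> tapes \<Rightarrow> com list \<times> tapes" where
  "crun = (\<lambda>(k, T). (fst (cstep k (reads T)), \<lambda>i. act (snd (cstep k (reads T)) i) (T i)))"

lemma act_keep [simp]: "act (reads T i, Stay) (T i) = T i"
  by (cases "T i") (simp add: reads_def)

text \<open>The step counts of \<open>exec\<close> are made to match: unfolding a sequence, a branch
  or a loop is a step of its own that leaves all tapes unchanged.\<close>

lemma exec_crun: "exec c T t T' \<Longrightarrow> (crun ^^ t) (c # k, T) = (k, T')"
proof (induction arbitrary: k rule: exec.induct)
  case (Seq a T t T1 b u T2)
  have "(crun ^^ (t + u)) (a # b # k, T) = (k, T2)"
    unfolding add.commute[of t u] funpow_add using Seq.IH by simp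
  then show ?case by (simp add: funpow_Suc_right crun_def del: funpow.simps)
next
  case (WhileT P T a t T1 u T2)
  have "(crun ^^ (t + u)) (a # While P a # k, T) = (k, T2)"
    unfolding add.commute[of t u] funpow_add using WhileT.IH by simp
  with WhileT.hyps(1) show ?case by (simp add: funpow_Suc_right crun_def del: funpow.simps)
next
  case (Act f T)
  then show ?case by (simp add: crun_def)
next
  case (WhileF P T a)
  then show ?case by (simp add: crun_def)
qed (simp_all add: funpow_Suc_right crun_def del: funpow.simps)

primrec conts :: "com \<Rightarrow> com list \<Rightarrow> com list set" where
  "conts (Act f) k = {Act f # k}"
| "conts (Seq a b) k = {Seq a b # k} \<union> conts a (b # k) \<union> conts b k"
| "conts (Cond P a b) k = {Cond P a b # k} \<union> conts a k \<union> conts b k"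
| "conts (While P a) k = {While P a # k} \<union> conts a (While P a # k)"

lemma conts_self: "c # k \<in> conts c k"
  by (cases c) auto

lemma finite_conts: "finite (conts c k)"
  by (induction c arbitrary: k) auto

lemma conts_step: "q \<in> conts c k \<Longrightarrow> fst (cstep q rd) \<in> insert k (conts c k)"
proof (induction c arbitrary: k)
  case (Seq a b)
  then show ?case using conts_self[of a "b # k"] conts_self[of b k] by fastforce
next
  case (Cond P a b)
  from Cond.prems Cond.IH[of k] show ?case using conts_self[of a k] conts_self[of b k] by auto
next
  case (While P a)
  then show ?case using conts_self[of a "While P a # k"] by fastforce
qed auto

lemma conts_wf:
  "q \<in> conts c k \<Longrightarrow> wf_com K G c \<Longrightarrow>
    (K \<le> i \<longrightarrow> snd (cstep q rd) i = (rd i, Stay)) \<and>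
    (fst (snd (cstep q rd) i) < G \<or> fst (snd (cstep q rd) i) \<in> range rd)"
  by (induction c arbitrary: k) auto

definition init_tapes :: "bool list \<Rightarrow> tapes" where
  "init_tapes x i = (if i = 0 then (word_contents x, 0) else (\<lambda>_. 0, 0))"

definition tape_word :: "tape \<Rightarrow> bool list \<Rightarrow> bool" where
  "tape_word tp y \<longleftrightarrow>
     (\<forall>i < length y. fst tp (int i) = bit_sym (y ! i)) \<and> fst tp (int (length y)) = 0"

text \<open>The machine sees \<open>K\<close> tapes, whereas tests are functions of all of them.
  \<open>pad\<close> supplies blanks for the rest, which is right because those tapes are blank
  initially and never change (the invariant \<open>good\<close>). The initial continuation is listed
  first to get index 0; the empty one gets the index behind the list, which is the halting
  state.\<close>

lemma compile_com:
  assumes wf: "wf_com K G c" and K: "1 \<le> K" and G: "3 \<le> G"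
  obtains M where "wf_tm M"
    "\<And>x t T' y. exec c (init_tapes x) t T' \<Longrightarrow> tape_word (T' 0) y \<Longrightarrow> outputs_within M x t y"
proof -
  let ?Q = "conts c []"
  obtain xs where xs: "set xs = ?Q - {[c]}" "distinct xs"
    using finite_distinct_list[of "?Q - {[c]}"] finite_conts by blast
  define qs where "qs = [c] # xs"
  have qs: "set qs = ?Q" "distinct qs" using xs conts_self[of c "[]"] by (auto simp: qs_def)
  have nemp: "[] \<notin> conts d k" for d k by (induction d arbitrary: k) auto
  define ix where "ix k = (if k = [] then length qs else (THE i. i < length qs \<and> qs ! i = k))" for k
  have ix_nth: "ix (qs ! i) = i" if "i < length qs" for i
  proof -
    have "qs ! i \<noteq> []" using that qs(1) nemp nth_mem by metis
    moreover have "(THE j. j < length qs \<and> qs ! j = qs ! i) = i"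
      using that qs(2) by (intro the_equality) (auto simp: nth_eq_iff_index_eq)
    ultimately show ?thesis by (simp add: ix_def)
  qed
  have ixQ: "ix k < length qs \<and> qs ! ix k = k" if "k \<in> ?Q" for k
    using that qs(1) ix_nth by (metis in_set_conv_nth)
  have ix0: "ix [c] = 0" using ix_nth[of 0] by (simp add: qs_def)
  have ixN: "ix [] = length qs" by (simp add: ix_def)
  define pad where "pad ss = (\<lambda>i. if i < K then ss ! i else 0::nat)" for ss
  define M where "M = \<lparr>num_tapes = K, num_syms = G, num_states = length qs,
     trans_fun = (\<lambda>q ss. (ix (fst (cstep (qs ! q) (pad ss))),
        map (snd (cstep (qs ! q) (pad ss))) [0..<K]))\<rparr>"
  have "wf_tm M"
    unfolding wf_tm_def
  proof (intro conjI allI impI)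
    fix q ss assume q: "q < num_states M" and ss: "length ss = num_tapes M \<and> set ss \<subseteq> {..<num_syms M}"
    have "qs ! q \<in> set qs" using q by (simp add: M_def)
    then have qQ: "qs ! q \<in> ?Q" by (simp only: qs(1))
    have ra: "pad ss j < G" for j
      using ss G by (auto simp: pad_def M_def dest!: subsetD[of "set ss", OF _ nth_mem])
    have "ix (fst (cstep (qs ! q) (pad ss))) \<le> length qs"
    proof (cases "fst (cstep (qs ! q) (pad ss)) = []")
      case False
      then show ?thesis using conts_step[OF qQ, of "pad ss"] ixQ less_imp_le by blast
    qed (simp add: ixN)
    moreover have "fst (snd (cstep (qs ! q) (pad ss)) i) < G" for i
      using conts_wf[OF qQ wf, of i "pad ss"] ra by auto
    ultimately show "case trans_fun M q ss of (q', as) \<Rightarrow> q' \<le> num_states M \<and>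
        length as = num_tapes M \<and> fst ` set as \<subseteq> {..<num_syms M}"
      by (auto simp: M_def)
  qed (use K G in \<open>simp_all add: M_def\<close>)
  define cf where "cf = (\<lambda>(k, T::tapes). (ix k, map T [0..<K]))"
  define good where "good = (\<lambda>(k, T::tapes). k \<in> insert [] ?Q \<and> (\<forall>i\<ge>K. reads T i = 0))"
  have step1: "step M (cf s) = cf (crun s) \<and> good (crun s)" if "good s" for s
  proof -
    obtain k T where s: "s = (k, T)" by fastforce
    show ?thesis
    proof (cases "k = []")
      case True
      with that s show ?thesis by (auto simp: cf_def good_def crun_def ixN M_def)
    next
      case False
      with that s have k: "k \<in> ?Q" and bl: "\<forall>i\<ge>K. reads T i = 0" by (auto simp: good_def)
      have "pad (map (\<lambda>(c, h). c h) (map T [0..<K])) = reads T"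
        using bl by (auto simp: pad_def reads_def split: prod.splits)
      then have tf: "trans_fun M (ix k) (map (\<lambda>(c, h). c h) (map T [0..<K])) =
          (ix (fst (cstep k (reads T))), map (snd (cstep k (reads T))) [0..<K])"
        using ixQ[OF k] by (simp add: M_def)
      have m2: "map2 act (map g [0..<K]) (map T [0..<K]) = map (\<lambda>i. act (g i) (T i)) [0..<K]" for g
        by (rule nth_equalityI) auto
      have "step M (cf s) = cf (crun s)"
        using ixQ[OF k] tf by (simp add: s cf_def crun_def m2 M_def)
      moreover have "good (crun s)"
      proof -
        have "act (snd (cstep k (reads T)) i) (T i) = T i" if "K \<le> i" for i
          using conts_wf[OF k wf, of i "reads T"] that by simp
        then have "reads (\<lambda>i. act (snd (cstep k (reads T)) i) (T i)) i = 0" if "K \<le> i" for i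
          using bl that by (simp add: reads_def)
        then show ?thesis using conts_step[OF k] by (auto simp: s good_def crun_def)
      qed
      ultimately show ?thesis ..
    qed
  qed
  have steps: "(step M ^^ t) (cf s) = cf ((crun ^^ t) s) \<and> good ((crun ^^ t) s)" if "good s" for s t
    using that by (induction t) (use step1 in auto)
  have "outputs_within M x t y" if ex: "exec c (init_tapes x) t T'" and tw: "tape_word (T' 0) y" for x t T' y
  proof -
    have ic: "init_config M x = cf ([c], init_tapes x)"
    proof -
      obtain K' where "K = Suc K'" using K by (cases K) auto
      then show ?thesis
        by (auto simp: init_config_def cf_def M_def ix0 init_tapes_def nth_Cons' simp del: upt_Suc
            intro!: nth_equalityI)
    qed
    have "good ([c], init_tapes x)"
      using K conts_self by (auto simp: good_def init_tapes_def reads_def)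
    from steps[OF this, of t] exec_crun[OF ex, of "[]"] ic
    have fin: "(step M ^^ t) (init_config M x) = cf ([], T')" by simp
    have "hd (map T' [0..<K]) = T' 0" using K by (simp add: hd_map)
    with tw fin show ?thesis
      unfolding outputs_within_def
      by (intro exI[of _ t]) (auto simp: cf_def ixN M_def output_word_def tape_word_def)
  qed
  with \<open>wf_tm M\<close> that show ?thesis by blast
qed

section \<open>A loop language on word registers\<close>

declare fun_upd_apply [simp del] fun_upd_same [simp] fun_upd_other [simp]

lemma poly_nat_mono: "m \<le> n \<Longrightarrow> poly p m \<le> poly p (n :: nat)"
  by (induction p) (auto intro!: add_mono mult_mono)

definition contents :: "nat list \<Rightarrow> int \<Rightarrow> nat" where
  "contents w p = (if 0 \<le> p \<and> p < int (length w) then w ! nat p else 0)"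

definition wtape :: "nat list \<times> nat \<Rightarrow> tape" where
  "wtape wi = (contents (fst wi), int (snd wi))"

definition rdw :: "nat list \<times> nat \<Rightarrow> nat" where
  "rdw wi = (if snd wi < length (fst wi) then fst wi ! snd wi else 0)"

definition put :: "nat \<Rightarrow> nat list \<times> nat \<Rightarrow> nat list \<times> nat" where
  "put v wi = (take (snd wi) (fst wi) @ v # drop (Suc (snd wi)) (fst wi), Suc (snd wi))"

definition adv :: "nat list \<times> nat \<Rightarrow> nat list \<times> nat" where
  "adv wi = (fst wi, min (Suc (snd wi)) (length (fst wi)))"

lemma wtape_read: "fst (wtape wi) (snd (wtape wi)) = rdw wi"
  by (simp add: wtape_def rdw_def contents_def)

lemma wtape_put: "snd wi \<le> length (fst wi) \<Longrightarrow> act (v, Move_Right) (wtape wi) = wtape (put v wi)"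
  by (auto simp: fun_upd_apply wtape_def put_def contents_def nth_append nth_Cons' nth_tl nat_less_iff
      not_less min_def fun_eq_iff add.commute)

lemma contents_Nil: "contents [] = (\<lambda>_. 0)"
  by (auto simp: contents_def)

lemma contents_erase: "i < length w \<Longrightarrow> (contents (take (Suc i) w))(int i := 0) = contents (take i w)"
  by (auto simp: contents_def fun_eq_iff fun_upd_apply)

definition on :: "nat \<Rightarrow> (nat \<Rightarrow> nat \<times> move) \<Rightarrow> com" where
  "on r f = Act (\<lambda>rd i. if i = r then f (rd r) else (rd i, Stay))"

definition nonblank :: "nat \<Rightarrow> (nat \<Rightarrow> nat) \<Rightarrow> bool" where
  "nonblank r rd \<longleftrightarrow> rd r \<noteq> 0"

definition to_end :: "nat \<Rightarrow> com" where
  "to_end r = While (nonblank r) (on r (\<lambda>v. (v, Move_Right)))"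

text \<open>The first move to the left is unconditional: the head may stand on the blank behind the
  word, where the loop would stop at once. The loop ends on the blank in cell -1.\<close>

definition to_start :: "nat \<Rightarrow> com" where
  "to_start r = Seq (on r (\<lambda>v. (v, Move_Left)))
     (Seq (While (nonblank r) (on r (\<lambda>v. (v, Move_Left)))) (on r (\<lambda>v. (v, Move_Right))))"

definition erase :: "nat \<Rightarrow> com" where
  "erase r = Seq (to_end r) (Seq (on r (\<lambda>v. (v, Move_Left)))
     (Seq (While (nonblank r) (on r (\<lambda>v. (0, Move_Left)))) (on r (\<lambda>v. (v, Move_Right)))))"

lemma exec_on:
  assumes "T' = T(r := act (f (reads T r)) (T r))"
  shows "exec (on r f) T 1 T'"
proof -
  have T': "T' = (\<lambda>i. act ((\<lambda>rd i. if i = r then f (rd r) else (rd i, Stay)) (reads T) i) (T i))"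
    using assms by (simp add: fun_eq_iff fun_upd_apply)
  show ?thesis unfolding on_def T' by (rule exec.Act)
qed

lemma exec_to_end:
  assumes "0 \<notin> set w" "i \<le> length w"
  shows "exec (to_end r) (T(r := wtape (w, i))) (2 * (length w - i) + 1) (T(r := wtape (w, length w)))"
  using assms(2)
proof (induction "length w - i" arbitrary: i)
  case 0
  then have "i = length w" by simp
  then show ?case unfolding to_end_def
    by (simp, intro exec.WhileF[simplified]) (simp add: reads_def nonblank_def wtape_read rdw_def)
next
  case (Suc n)
  then have i: "i < length w" by simp
  then have "w ! i \<noteq> 0" using assms(1) by (metis nth_mem)
  then have "nonblank r (reads (T(r := wtape (w, i))))"
    using i by (simp add: reads_def nonblank_def wtape_read rdw_def)
  moreover have "exec (on r (\<lambda>v. (v, Move_Right))) (T(r := wtape (w, i))) 1 (T(r := wtape (w, Suc i)))"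
    by (rule exec_on) (simp add: wtape_def reads_def add.commute)
  moreover have "exec (to_end r) (T(r := wtape (w, Suc i))) (2 * (length w - Suc i) + 1)
      (T(r := wtape (w, length w)))"
    using Suc by simp
  ultimately have "exec (to_end r) (T(r := wtape (w, i))) (Suc (1 + (2 * (length w - Suc i) + 1)))
      (T(r := wtape (w, length w)))"
    unfolding to_end_def by (rule exec.WhileT)
  moreover have "Suc (1 + (2 * (length w - Suc i) + 1)) = 2 * (length w - i) + 1" using i by simp
  ultimately show ?case by (simp only:)
qed

lemma exec_back:
  assumes "0 \<notin> set w" "i \<le> length w"
  shows "exec (While (nonblank r) (on r (\<lambda>v. (v, Move_Left)))) (T(r := (contents w, int i - 1)))
     (2 * i + 1) (T(r := (contents w, - 1)))"
  using assms(2)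
proof (induction i)
  case 0
  then show ?case
    by (simp, intro exec.WhileF[simplified]) (simp add: reads_def nonblank_def contents_def)
next
  case (Suc i)
  then have "w ! i \<noteq> 0" using assms(1) by (metis nth_mem Suc_le_lessD)
  then have "nonblank r (reads (T(r := (contents w, int (Suc i) - 1))))"
    using Suc.prems by (simp add: reads_def nonblank_def contents_def)
  moreover have "exec (on r (\<lambda>v. (v, Move_Left))) (T(r := (contents w, int (Suc i) - 1))) 1
      (T(r := (contents w, int i - 1)))"
    by (rule exec_on) (simp add: reads_def)
  moreover note Suc.IH[OF Suc_leD[OF Suc.prems]]
  ultimately have "exec (While (nonblank r) (on r (\<lambda>v. (v, Move_Left))))
      (T(r := (contents w, int (Suc i) - 1))) (Suc (1 + (2 * i + 1))) (T(r := (contents w, - 1)))"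
    by (rule exec.WhileT)
  then show ?case by simp
qed

lemma exec_erase_back:
  assumes "0 \<notin> set w" "i \<le> length w"
  shows "exec (While (nonblank r) (on r (\<lambda>v. (0, Move_Left))))
     (T(r := (contents (take i w), int i - 1))) (2 * i + 1) (T(r := (contents [], - 1)))"
  using assms(2)
proof (induction i)
  case 0
  then show ?case
    by (simp, intro exec.WhileF[simplified]) (simp add: reads_def nonblank_def contents_def)
next
  case (Suc i)
  then have "w ! i \<noteq> 0" using assms(1) by (metis nth_mem Suc_le_lessD)
  then have "nonblank r (reads (T(r := (contents (take (Suc i) w), int (Suc i) - 1))))"
    using Suc.prems by (simp add: reads_def nonblank_def contents_def)
  moreover have "exec (on r (\<lambda>v. (0, Move_Left))) (T(r := (contents (take (Suc i) w), int (Suc i) - 1))) 1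
      (T(r := (contents (take i w), int i - 1)))"
    using contents_erase[of i w] Suc.prems by (intro exec_on) (simp add: reads_def)
  moreover note Suc.IH[OF Suc_leD[OF Suc.prems]]
  ultimately have "exec (While (nonblank r) (on r (\<lambda>v. (0, Move_Left))))
      (T(r := (contents (take (Suc i) w), int (Suc i) - 1))) (Suc (1 + (2 * i + 1)))
      (T(r := (contents [], - 1)))"
    by (rule exec.WhileT)
  then show ?case by simp
qed

lemma exec_to_start:
  assumes "0 \<notin> set w" "i \<le> length w"
  shows "\<exists>t \<le> 2 * length w + 6. exec (to_start r) (T(r := wtape (w, i))) t (T(r := wtape (w, 0)))"
proof -
  have 1: "exec (on r (\<lambda>v. (v, Move_Left))) (T(r := wtape (w, i))) 1 (T(r := (contents w, int i - 1)))"
    by (rule exec_on) (simp add: wtape_def reads_def)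
  have 2: "exec (on r (\<lambda>v. (v, Move_Right))) (T(r := (contents w, - 1))) 1 (T(r := wtape (w, 0)))"
    by (rule exec_on) (simp add: wtape_def reads_def)
  have "exec (to_start r) (T(r := wtape (w, i))) (Suc (1 + Suc ((2 * i + 1) + 1))) (T(r := wtape (w, 0)))"
    unfolding to_start_def by (rule exec.Seq[OF 1 exec.Seq[OF exec_back[OF assms] 2]])
  then show ?thesis using assms(2) by (intro exI[of _ "Suc (1 + Suc ((2 * i + 1) + 1))"] conjI) auto
qed

lemma exec_erase:
  assumes "0 \<notin> set w" "i \<le> length w"
  shows "\<exists>t \<le> 4 * length w + 12. exec (erase r) (T(r := wtape (w, i))) t (T(r := wtape ([], 0)))"
proof -
  let ?n = "length w"
  have 1: "exec (on r (\<lambda>v. (v, Move_Left))) (T(r := wtape (w, ?n))) 1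
      (T(r := (contents (take ?n w), int ?n - 1)))"
    by (rule exec_on) (simp add: wtape_def reads_def)
  have 2: "exec (on r (\<lambda>v. (v, Move_Right))) (T(r := (contents [], - 1))) 1 (T(r := wtape ([], 0)))"
    by (rule exec_on) (simp add: wtape_def reads_def)
  have "exec (erase r) (T(r := wtape (w, i)))
      (Suc ((2 * (?n - i) + 1) + Suc (1 + Suc ((2 * ?n + 1) + 1)))) (T(r := wtape ([], 0)))"
    unfolding erase_def
    by (rule exec.Seq[OF exec_to_end[OF assms] exec.Seq[OF 1 exec.Seq[OF exec_erase_back[OF assms(1)
        order_refl] 2]]])
  then show ?thesis by (intro exI[of _ "Suc ((2 * (?n - i) + 1) + Suc (1 + Suc ((2 * ?n + 1) + 1)))"]
      conjI) auto
qed

type_synonym regs = "nat \<Rightarrow> nat list \<times> nat"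

datatype prog =
  Skip
| Put nat nat
| Adv nat
| Rewind nat
| End nat
| Clear nat
| Then prog prog (infixr \<open>;;\<close> 60)
| IfR "(nat \<Rightarrow> nat) \<Rightarrow> bool" prog prog
| For nat prog

definition rd :: "regs \<Rightarrow> nat \<Rightarrow> nat" where
  "rd s r = rdw (s r)"

text \<open>A register is a word of nonzero symbols with a head position; \<open>For r p\<close> runs \<open>p\<close> once for
  each symbol of \<open>r\<close> from the head on, with the head of \<open>r\<close> standing on that symbol.\<close>

primrec den :: "prog \<Rightarrow> regs \<Rightarrow> regs" where
  "den Skip s = s"
| "den (Put r v) s = s(r := put v (s r))"
| "den (Adv r) s = s(r := adv (s r))"
| "den (Rewind r) s = s(r := (fst (s r), 0))"
| "den (End r) s = s(r := (fst (s r), length (fst (s r))))"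
| "den (Clear r) s = s(r := ([], 0))"
| "den (p ;; q) s = den q (den p s)"
| "den (IfR P p q) s = (if P (rd s) then den p s else den q s)"
| "den (For r p) s = ((\<lambda>s. (den p s)(r := adv (den p s r))) ^^ (length (fst (s r)) - snd (s r))) s"

primrec cost :: "prog \<Rightarrow> regs \<Rightarrow> nat" where
  "cost Skip s = 1"
| "cost (Put r v) s = 1"
| "cost (Adv r) s = 1"
| "cost (Rewind r) s = 2 * length (fst (s r)) + 6"
| "cost (End r) s = 2 * length (fst (s r)) + 1"
| "cost (Clear r) s = 4 * length (fst (s r)) + 12"
| "cost (p ;; q) s = Suc (cost p s + cost q (den p s))"
| "cost (IfR P p q) s = Suc (if P (rd s) then cost p s else cost q s)"
| "cost (For r p) s = 1 + (\<Sum>i < length (fst (s r)) - snd (s r).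
     3 + cost p (((\<lambda>s. (den p s)(r := adv (den p s r))) ^^ i) s))"

primrec compile :: "prog \<Rightarrow> com" where
  "compile Skip = Act (\<lambda>rd i. (rd i, Stay))"
| "compile (Put r v) = on r (\<lambda>_. (v, Move_Right))"
| "compile (Adv r) = on r (\<lambda>v. if v = 0 then (v, Stay) else (v, Move_Right))"
| "compile (Rewind r) = to_start r"
| "compile (End r) = to_end r"
| "compile (Clear r) = erase r"
| "compile (p ;; q) = Seq (compile p) (compile q)"
| "compile (IfR P p q) = Cond P (compile p) (compile q)"
| "compile (For r p) = While (nonblank r)
     (Seq (compile p) (on r (\<lambda>v. if v = 0 then (v, Stay) else (v, Move_Right))))"

primrec touch :: "prog \<Rightarrow> nat set" where
  "touch Skip = {}"
| "touch (Put r v) = {r}"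
| "touch (Adv r) = {r}"
| "touch (Rewind r) = {r}"
| "touch (End r) = {r}"
| "touch (Clear r) = {r}"
| "touch (p ;; q) = touch p \<union> touch q"
| "touch (IfR P p q) = touch p \<union> touch q"
| "touch (For r p) = insert r (touch p)"

primrec okp :: "prog \<Rightarrow> bool" where
  "okp Skip = True"
| "okp (Put r v) = (v \<noteq> 0)"
| "okp (Adv r) = True"
| "okp (Rewind r) = True"
| "okp (End r) = True"
| "okp (Clear r) = True"
| "okp (p ;; q) = (okp p \<and> okp q)"
| "okp (IfR P p q) = (okp p \<and> okp q)"
| "okp (For r p) = (okp p \<and> r \<notin> touch p)"

definition oks :: "regs \<Rightarrow> bool" where
  "oks s \<longleftrightarrow> (\<forall>r. snd (s r) \<le> length (fst (s r)) \<and> 0 \<notin> set (fst (s r)))"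

definition tapes_of :: "regs \<Rightarrow> tapes" where
  "tapes_of s r = wtape (s r)"

lemma reads_tapes_of: "reads (tapes_of s) = rd s"
  by (simp add: fun_eq_iff reads_def tapes_of_def wtape_read rd_def)

lemma tapes_of_upd: "tapes_of (s(r := x)) = (tapes_of s)(r := wtape x)"
  by (simp add: fun_eq_iff tapes_of_def fun_upd_apply)

lemma tapes_of_upd_self [simp]: "(tapes_of s)(r := wtape (s r)) = tapes_of s"
  by (simp add: fun_eq_iff tapes_of_def fun_upd_apply)

lemma den_untouched: "r \<notin> touch p \<Longrightarrow> den p s r = s r"
proof (induction p arbitrary: s)
  case (For q p)
  have "((\<lambda>s. (den p s)(q := adv (den p s q))) ^^ n) s r = s r" for n
    by (induction n) (use For in auto)
  then show ?case by simp
qed auto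

lemma oks_upd: "oks s \<Longrightarrow> snd x \<le> length (fst x) \<Longrightarrow> 0 \<notin> set (fst x) \<Longrightarrow> oks (s(r := x))"
  by (simp add: oks_def fun_upd_apply)

lemma oks_put: "oks s \<Longrightarrow> v \<noteq> 0 \<Longrightarrow> oks (s(r := put v (s r)))"
  by (rule oks_upd) (auto simp: oks_def put_def dest: in_set_takeD in_set_dropD)

lemma exec_adv:
  assumes "oks s"
  shows "exec (on r (\<lambda>v. if v = 0 then (v, Stay) else (v, Move_Right))) (tapes_of s) 1
      (tapes_of (s(r := adv (s r)))) \<and> oks (s(r := adv (s r)))"
proof -
  have "snd (s r) \<le> length (fst (s r))" "0 \<notin> set (fst (s r))" using assms by (auto simp: oks_def)
  moreover from this have "rdw (s r) = 0 \<longleftrightarrow> snd (s r) = length (fst (s r))"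
    using nth_mem[of "snd (s r)" "fst (s r)"]
    by (cases "snd (s r) < length (fst (s r))") (auto simp: rdw_def simp del: nth_mem, metis gr0I)
  ultimately have "act (if rdw (s r) = 0 then (rdw (s r), Stay) else (rdw (s r), Move_Right)) (wtape (s r)) =
      wtape (adv (s r))"
    by (auto simp: adv_def wtape_def rdw_def contents_def fun_eq_iff fun_upd_apply)
  then have "exec (on r (\<lambda>v. if v = 0 then (v, Stay) else (v, Move_Right))) (tapes_of s) 1
      (tapes_of (s(r := adv (s r))))"
    by (intro exec_on) (simp only: reads_tapes_of rd_def tapes_of_upd, simp only: tapes_of_def)
  moreover have "oks (s(r := adv (s r)))"
    using assms by (intro oks_upd) (auto simp: adv_def oks_def)
  ultimately show ?thesis by blast
qed

text \<open>\<open>cost\<close> is only an upper bound, as the time of rewinding depends on where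
  the head is. For a loop, \<open>okp\<close> keeps the body away from the controlling register, so
  the compiled \<open>While\<close>, which tests for a blank, makes exactly the number of rounds
  that \<open>den\<close> fixes in advance.\<close>

lemma exec_compile:
  "okp p \<Longrightarrow> oks s \<Longrightarrow>
    (\<exists>t \<le> cost p s. exec (compile p) (tapes_of s) t (tapes_of (den p s))) \<and> oks (den p s)"
proof (induction p arbitrary: s)
  case Skip
  have "exec (Act (\<lambda>rd i. (rd i, Stay))) (tapes_of s) 1 (tapes_of s)"
    using exec.Act[of "\<lambda>rd i. (rd i, Stay)" "tapes_of s"] by simp
  with Skip show ?case by auto
next
  case (Put r v)
  then have "exec (on r (\<lambda>_. (v, Move_Right))) (tapes_of s) 1 (tapes_of (s(r := put v (s r))))"
    by (intro exec_on) (simp only: tapes_of_upd, simp add: tapes_of_def oks_def wtape_put)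
  with Put oks_put show ?case by auto
next
  case (Adv r)
  with exec_adv show ?case by auto
next
  case (Rewind r)
  then have "0 \<notin> set (fst (s r))" "snd (s r) \<le> length (fst (s r))" by (auto simp: oks_def)
  from exec_to_start[OF this, of r "tapes_of s"] Rewind show ?case
    by (auto simp: tapes_of_upd intro!: oks_upd) (simp add: oks_def)
next
  case (End r)
  then have "0 \<notin> set (fst (s r))" "snd (s r) \<le> length (fst (s r))" by (auto simp: oks_def)
  from exec_to_end[OF this, of r "tapes_of s"] End show ?case
    by (auto simp: tapes_of_upd intro!: oks_upd exI[of _ "2 * (length (fst (s r)) - snd (s r)) + 1"])
      (simp add: oks_def)
next
  case (Clear r)
  then have "0 \<notin> set (fst (s r))" "snd (s r) \<le> length (fst (s r))" by (auto simp: oks_def)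
  from exec_erase[OF this, of r "tapes_of s"] Clear show ?case
    by (auto simp: tapes_of_upd intro!: oks_upd)
next
  case (Then p q)
  then obtain t u where "t \<le> cost p s" "exec (compile p) (tapes_of s) t (tapes_of (den p s))"
      "u \<le> cost q (den p s)" "exec (compile q) (tapes_of (den p s)) u (tapes_of (den q (den p s)))"
      "oks (den q (den p s))"
    by (metis okp.simps(7))
  then show ?case by (auto intro!: exI[of _ "Suc (t + u)"] exec.Seq)
next
  case (IfR P p q)
  show ?case
  proof (cases "P (rd s)")
    case True
    with IfR obtain t where "t \<le> cost p s" "exec (compile p) (tapes_of s) t (tapes_of (den p s))"
      "oks (den p s)" by (metis okp.simps(8))
    with True show ?thesis by (auto intro!: exI[of _ "Suc t"] exec.CondT simp: reads_tapes_of)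
  next
    case False
    with IfR obtain t where "t \<le> cost q s" "exec (compile q) (tapes_of s) t (tapes_of (den q s))"
      "oks (den q s)" by (metis okp.simps(8))
    with False show ?thesis by (auto intro!: exI[of _ "Suc t"] exec.CondF simp: reads_tapes_of)
  qed
next
  case (For r p)
  let ?A = "on r (\<lambda>v. if v = 0 then (v, Stay) else (v, Move_Right))"
  let ?F = "\<lambda>s. (den p s)(r := adv (den p s r))"
  have rp: "r \<notin> touch p" using For.prems by simp
  have "n = length (fst (s r)) - snd (s r) \<Longrightarrow> oks s \<Longrightarrow>
     (\<exists>t \<le> 1 + (\<Sum>i<n. 3 + cost p ((?F ^^ i) s)).
        exec (While (nonblank r) (Seq (compile p) ?A)) (tapes_of s) t (tapes_of ((?F ^^ n) s))) \<and>
      oks ((?F ^^ n) s)" for n s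
  proof (induction n arbitrary: s)
    case 0
    then have "\<not> nonblank r (reads (tapes_of s))"
      by (simp add: reads_tapes_of nonblank_def rd_def rdw_def)
    from exec.WhileF[of "nonblank r", OF this] 0 show ?case by auto
  next
    case (Suc n)
    then have "snd (s r) < length (fst (s r))" "0 \<notin> set (fst (s r))" by (auto simp: oks_def)
    then have nb: "nonblank r (reads (tapes_of s))"
      by (metis (no_types, lifting) nonblank_def nth_mem rd_def rdw_def reads_tapes_of)
    from For Suc.prems obtain t where t: "t \<le> cost p s"
      "exec (compile p) (tapes_of s) t (tapes_of (den p s))" "oks (den p s)" by (metis okp.simps(9))
    from exec_adv[OF t(3), of r]
    have a: "exec ?A (tapes_of (den p s)) 1 (tapes_of (?F s))" "oks (?F s)" by auto
    have "n = length (fst (?F s r)) - snd (?F s r)"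
      using Suc.prems(1) den_untouched[OF rp, of s] by (simp add: adv_def)
    from Suc.IH[OF this a(2)] obtain u where u: "u \<le> 1 + (\<Sum>i<n. 3 + cost p ((?F ^^ i) (?F s)))"
      "exec (While (nonblank r) (Seq (compile p) ?A)) (tapes_of (?F s)) u (tapes_of ((?F ^^ n) (?F s)))"
      "oks ((?F ^^ n) (?F s))" by blast
    have e: "exec (While (nonblank r) (Seq (compile p) ?A)) (tapes_of s) (Suc (Suc (t + 1) + u))
        (tapes_of ((?F ^^ n) (?F s)))"
      by (rule exec.WhileT[of "nonblank r", OF nb exec.Seq[OF t(2) a(1)] u(2)])
    have "(\<Sum>i<Suc n. 3 + cost p ((?F ^^ i) s)) = 3 + cost p s + (\<Sum>i<n. 3 + cost p ((?F ^^ i) (?F s)))"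
      by (simp add: sum.lessThan_Suc_shift funpow_Suc_right del: sum.lessThan_Suc funpow.simps)
    then have "Suc (Suc (t + 1) + u) \<le> 1 + (\<Sum>i<Suc n. 3 + cost p ((?F ^^ i) s))"
      using t(1) u(1) by simp
    moreover have "(?F ^^ Suc n) s = (?F ^^ n) (?F s)" by (simp only: funpow_Suc_right comp_apply)
    ultimately show ?case using e u(3) by (simp only:) blast
  qed
  from this[OF refl For.prems(2)] show ?case by simp
qed

lemma wf_on: "(\<And>v. fst (f v) < G \<or> fst (f v) = v) \<Longrightarrow> wf_com (Suc r) G (on r f)"
  by (auto simp: on_def)

lemma wf_compile: "\<exists>K G. wf_com K G (compile p)"
proof (induction p)
  case Skip
  then show ?case by (auto intro: exI[of _ 0])
next
  case (Put r v)
  show ?case using wf_on[of "\<lambda>_. (v, Move_Right)" "Suc v" r] by auto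
next
  case (Adv r)
  have "wf_com (Suc r) 1 (compile (Adv r))" unfolding compile.simps by (rule wf_on) auto
  then show ?case by blast
next
  case (Rewind r)
  show ?case using wf_on[of "\<lambda>v. (v, Move_Left)" 1 r] wf_on[of "\<lambda>v. (v, Move_Right)" 1 r]
    by (auto simp: to_start_def)
next
  case (End r)
  show ?case using wf_on[of "\<lambda>v. (v, Move_Right)" 1 r] by (auto simp: to_end_def)
next
  case (Clear r)
  show ?case using wf_on[of "\<lambda>v. (v, Move_Left)" 1 r] wf_on[of "\<lambda>v. (v, Move_Right)" 1 r]
      wf_on[of "\<lambda>v. (0, Move_Left)" 1 r]
    by (auto simp: erase_def to_end_def)
next
  case (Then p q)
  then obtain K1 G1 K2 G2 where "wf_com K1 G1 (compile p)" "wf_com K2 G2 (compile q)" by blast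
  then show ?case
    using wf_com_mono[of _ _ _ "max K1 K2" "max G1 G2"] by (metis compile.simps(7) max.cobounded1
        max.cobounded2 wf_com.simps(2))
next
  case (IfR P p q)
  then obtain K1 G1 K2 G2 where "wf_com K1 G1 (compile p)" "wf_com K2 G2 (compile q)" by blast
  then show ?case
    using wf_com_mono[of _ _ _ "max K1 K2" "max G1 G2"] by (metis compile.simps(8) max.cobounded1
        max.cobounded2 wf_com.simps(3))
next
  case (For r p)
  then obtain K G where 1: "wf_com K G (compile p)" by blast
  have 2: "wf_com (Suc r) 1 (on r (\<lambda>v. if v = 0 then (v, Stay) else (v, Move_Right)))"
    by (rule wf_on) auto
  from wf_com_mono[OF 1, of "max K (Suc r)" "max G 1"] wf_com_mono[OF 2, of "max K (Suc r)" "max G 1"]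
  have "wf_com (max K (Suc r)) (max G 1) (compile (For r p))" by simp
  then show ?case by blast
qed

section \<open>Polynomial bounds on the running time of loop programs\<close>

primrec grown :: "prog \<Rightarrow> nat set" where
  "grown Skip = {}"
| "grown (Put r v) = {r}"
| "grown (Adv r) = {}"
| "grown (Rewind r) = {}"
| "grown (End r) = {}"
| "grown (Clear r) = {}"
| "grown (p ;; q) = grown p \<union> grown q"
| "grown (IfR P p q) = grown p \<union> grown q"
| "grown (For r p) = grown p"

primrec loops :: "prog \<Rightarrow> nat set" where
  "loops Skip = {}"
| "loops (Put r v) = {}"
| "loops (Adv r) = {}"
| "loops (Rewind r) = {}"
| "loops (End r) = {}"
| "loops (Clear r) = {}"
| "loops (p ;; q) = loops p \<union> loops q"
| "loops (IfR P p q) = loops p \<union> loops q"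
| "loops (For r p) = insert r (loops p)"

definition len :: "regs \<Rightarrow> nat \<Rightarrow> nat" where
  "len s r = length (fst (s r))"

lemma len_not_grown: "r \<notin> grown p \<Longrightarrow> len (den p s) r \<le> len s r"
proof (induction p arbitrary: s)
  case (For q p)
  have "len (((\<lambda>s. (den p s)(q := adv (den p s q))) ^^ n) s) r \<le> len s r" for n
  proof (induction n)
    case (Suc n)
    have "len (den p x) r \<le> len x r" for x using For by simp
    then have "len ((den p x)(q := adv (den p x q))) r \<le> len x r" for x
      by (auto simp: len_def adv_def fun_upd_apply)
    then show ?case using Suc by (auto intro: order_trans)
  qed simp
  then show ?case by simp
next
  case (Then p q)
  then show ?case by simp (meson order_trans)
qed (auto simp: len_def adv_def fun_upd_apply)

text \<open>If no register that controls a loop grows, the number of iterations of all loops is bounded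
  by a polynomial in the lengths \<open>L\<close> of these registers. The other registers, of length at most
  \<open>B\<close>, contribute to the time only by rewinding.\<close>

definition static_bound :: "prog \<Rightarrow> nat poly \<Rightarrow> bool" where
  "static_bound p P \<longleftrightarrow> (\<forall>s L B. (\<forall>r \<in> loops p. len s r \<le> L) \<longrightarrow> (\<forall>r. len s r \<le> B) \<longrightarrow>
     cost p s \<le> poly P L * (B + poly P L + 1) \<and> (\<forall>r. len (den p s) r \<le> len s r + poly P L))"

lemma static_boundD:
  assumes "static_bound p P" "\<And>r. r \<in> loops p \<Longrightarrow> len s r \<le> L" "\<And>r. len s r \<le> B"
  shows "cost p s \<le> poly P L * (B + poly P L + 1)" "len (den p s) r \<le> len s r + poly P L"
  using assms unfolding static_bound_def by blast+

text \<open>The constant 12 covers the most expensive primitive, \<open>Clear\<close>, of cost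
  \<open>4 * length + 12\<close>.\<close>

lemma static_bound_basic:
  assumes "\<And>s. cost p s \<le> 4 * (\<Sum>r \<in> touch p. len s r) + 12" "touch p \<subseteq> {q}"
    "\<And>s r. len (den p s) r \<le> len s r + 12"
  shows "static_bound p [:12:]"
  unfolding static_bound_def
proof (intro allI impI conjI)
  fix s L B r assume B: "\<forall>r. len s r \<le> B"
  have "(\<Sum>r \<in> touch p. len s r) \<le> (\<Sum>r \<in> {q}. len s r)" by (rule sum_mono2) (use assms in auto)
  then show "cost p s \<le> poly [:12:] L * (B + poly [:12:] L + 1)"
    using assms(1)[of s] B[rule_format, of q] by simp
  show "len (den p s) r \<le> len s r + poly [:12:] L" using assms(3) by simp
qed

text \<open>Disjointness lets the bound \<open>L\<close> survive \<open>p\<close>: the registers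
  that control \<open>q\<close> have not grown. The others gain at most \<open>poly P L\<close>,
  which enters only the factor for rewinding.\<close>

lemma static_bound_Then:
  assumes p: "static_bound p P" and q: "static_bound q Q" and d: "loops q \<inter> grown p = {}"
  shows "static_bound (p ;; q) (P + Q + 1)"
  unfolding static_bound_def
proof (intro allI impI)
  fix s L B assume L: "\<forall>r \<in> loops (p ;; q). len s r \<le> L" and B: "\<forall>r. len s r \<le> B"
  let ?P = "poly P L" and ?Q = "poly Q L"
  have L1: "r \<in> loops p \<Longrightarrow> len s r \<le> L" and B1: "len s r \<le> B" for r using L B by auto
  note 1 = static_boundD[OF p L1 B1]
  have B': "len (den p s) r \<le> B + ?P" for r
    using 1(2)[of r] B1[of r] by linarith
  have L': "r \<in> loops q \<Longrightarrow> len (den p s) r \<le> L" for r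
    using len_not_grown[of r p s] d L by (metis UnCI disjoint_iff loops.simps(7) order_trans)
  note 2 = static_boundD[OF q L' B']
  let ?X = "B + (?P + ?Q + 1) + 1"
  have "cost (p ;; q) s \<le> 1 + ?P * (B + ?P + 1) + ?Q * (B + ?P + ?Q + 1)"
    unfolding cost.simps using 1(1) 2(1) by linarith
  also have "\<dots> \<le> ?X + ?P * ?X + ?Q * ?X"
    by (rule add_mono[OF add_mono[OF _ mult_le_mono2] mult_le_mono2]) simp_all
  finally have "cost (p ;; q) s \<le> poly (P + Q + 1) L * (B + poly (P + Q + 1) L + 1)"
    by (simp add: algebra_simps)
  moreover have "len (den (p ;; q) s) r \<le> len s r + poly (P + Q + 1) L" for r
    using 1(2)[of r] 2(2)[of r] L B by simp
  ultimately show "cost (p ;; q) s \<le> poly (P + Q + 1) L * (B + poly (P + Q + 1) L + 1) \<and>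
    (\<forall>r. len (den (p ;; q) s) r \<le> len s r + poly (P + Q + 1) L)" by blast
qed

lemma static_bound_IfR:
  assumes p: "static_bound p P" and q: "static_bound q Q"
  shows "static_bound (IfR C p q) (P + Q + 1)"
  unfolding static_bound_def
proof (intro allI impI)
  fix s L B assume L: "\<forall>r \<in> loops (IfR C p q). len s r \<le> L" and B: "\<forall>r. len s r \<le> B"
  let ?P = "poly P L" and ?Q = "poly Q L"
  note 1 = static_boundD[OF p, of s L B]
  note 2 = static_boundD[OF q, of s L B]
  let ?X = "B + (?P + ?Q + 1) + 1"
  have "cost (IfR C p q) s \<le> 1 + ?P * (B + ?P + 1) + ?Q * (B + ?Q + 1)"
    using 1(1) 2(1) L B by simp
  also have "\<dots> \<le> ?X + ?P * ?X + ?Q * ?X"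
    by (rule add_mono[OF add_mono[OF _ mult_le_mono2] mult_le_mono2]) simp_all
  finally have "cost (IfR C p q) s \<le> poly (P + Q + 1) L * (B + poly (P + Q + 1) L + 1)"
    by (simp add: algebra_simps)
  moreover have "len (den (IfR C p q) s) r \<le> len s r + poly (P + Q + 1) L" for r
    using 1(2)[of r] 2(2)[of r] L B by (auto intro: le_SucI trans_le_add1 trans_le_add2)
  ultimately show "cost (IfR C p q) s \<le> poly (P + Q + 1) L * (B + poly (P + Q + 1) L + 1) \<and>
    (\<forall>r. len (den (IfR C p q) s) r \<le> len s r + poly (P + Q + 1) L)" by blast
qed

text \<open>Growth is additive. A round adds at most \<open>poly P L\<close> symbols to a register,
  and this amount is the same in every round because the controlling registers do not grow. After at
  most \<open>L\<close> rounds all lengths are at most \<open>B + L * poly P L\<close>, so no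
  iterated composition of polynomials arises.\<close>

lemma static_bound_For:
  assumes p: "static_bound p P" and d: "loops (For q p) \<inter> grown p = {}"
  shows "static_bound (For q p) ([:1, 1:] * (P + 3))"
  unfolding static_bound_def
proof (intro allI impI)
  fix s L B assume L: "\<forall>r \<in> loops (For q p). len s r \<le> L" and B: "\<forall>r. len s r \<le> B"
  let ?P = "poly P L"
  let ?F = "\<lambda>s. (den p s)(q := adv (den p s q))"
  have Fl: "len (?F x) r = len (den p x) r" for x r by (simp add: len_def adv_def fun_upd_apply)
  have it: "(\<forall>r \<in> loops (For q p). len ((?F ^^ i) s) r \<le> L) \<and> (\<forall>r. len ((?F ^^ i) s) r \<le> len s r + i *
      ?P)" for i
  proof (induction i)
    case (Suc i)
    let ?x = "(?F ^^ i) s"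
    have "len (?F ?x) r \<le> len s r + Suc i * ?P" for r
    proof -
      have "len (den p ?x) r \<le> len ?x r + ?P"
      proof (rule static_boundD(2)[OF p])
        show "len ?x r \<le> L" if "r \<in> loops p" for r using Suc that by simp
        show "len ?x r \<le> B + i * ?P" for r
          using B[rule_format, of r] conjunct2[OF Suc, rule_format, of r] by linarith
      qed
      moreover have "len ?x r \<le> len s r + i * ?P" using Suc by blast
      ultimately show ?thesis unfolding Fl by simp
    qed
    moreover have "len (?F ?x) r \<le> L" if "r \<in> loops (For q p)" for r
      unfolding Fl using len_not_grown[of r p ?x] d that Suc by (meson disjoint_iff order_trans)
    ultimately show ?case by simp
  qed (use L in simp)
  let ?n = "length (fst (s q)) - snd (s q)"
  have n: "?n \<le> L" using L by (auto simp: len_def)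
  let ?X = "B + poly ([:1, 1:] * (P + 3)) L + 1"
  have X: "?X = B + (1 + L) * (?P + 3) + 1" by simp
  have c: "cost p ((?F ^^ i) s) \<le> ?P * ?X" if "i < ?n" for i
  proof -
    have "cost p ((?F ^^ i) s) \<le> ?P * ((B + i * ?P) + ?P + 1)"
    proof (rule static_boundD(1)[OF p])
      show "len ((?F ^^ i) s) r \<le> L" if "r \<in> loops p" for r using it[of i] that by simp
      show "len ((?F ^^ i) s) r \<le> B + i * ?P" for r
        using conjunct2[OF it[of i], rule_format, of r] B[rule_format, of r] by linarith
    qed
    also have "?P * ((B + i * ?P) + ?P + 1) \<le> ?P * ?X"
    proof -
      have "i * ?P \<le> L * ?P" using that n by (intro mult_le_mono1) simp
      moreover have "(1 + L) * (?P + 3) = ?P + 3 + (L * ?P + 3 * L)" by (simp add: algebra_simps)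
      ultimately show ?thesis unfolding X by (intro mult_le_mono2) linarith
    qed
    finally show ?thesis .
  qed
  have "cost (For q p) s \<le> 1 + (\<Sum>i<?n. 3 + ?P * ?X)"
    unfolding cost.simps by (intro add_left_mono sum_mono) (use c in auto)
  also have "\<dots> \<le> 1 + L * (3 + ?P * ?X)" using n by simp
  also have "\<dots> \<le> 1 * ?X + L * (3 * ?X + ?P * ?X)" unfolding X by (intro add_mono mult_le_mono) auto
  also have "\<dots> \<le> (1 + L) * (?P + 3) * ?X" by (simp add: algebra_simps)
  finally have "cost (For q p) s \<le> poly ([:1, 1:] * (P + 3)) L * (B + poly ([:1, 1:] * (P + 3)) L + 1)"
    by simp
  moreover have "len (den (For q p) s) r \<le> len s r + poly ([:1, 1:] * (P + 3)) L" for r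
  proof -
    have "len (den (For q p) s) r \<le> len s r + ?n * ?P" using it[of ?n] by simp
    also have "?n * ?P \<le> (1 + L) * (?P + 3)" using n by (intro mult_le_mono) auto
    finally show ?thesis by simp
  qed
  ultimately show "cost (For q p) s \<le> poly ([:1, 1:] * (P + 3)) L * (B + poly ([:1, 1:] * (P + 3)) L + 1) \<and>
    (\<forall>r. len (den (For q p) s) r \<le> len s r + poly ([:1, 1:] * (P + 3)) L)" by blast
qed

lemma ex_static_bound: "loops p \<inter> grown p = {} \<Longrightarrow> \<exists>P. static_bound p P"
proof (induction p)
  case Skip
  have "static_bound Skip [:12:]" by (rule static_bound_basic[of _ 0]) auto
  then show ?case by blast
next
  case (Put r v)
  have "static_bound (Put r v) [:12:]"
    by (rule static_bound_basic[of _ r]) (auto simp: len_def fun_upd_apply put_def)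
  then show ?case by blast
next
  case (Adv r)
  have "static_bound (Adv r) [:12:]"
    by (rule static_bound_basic[of _ r]) (auto simp: len_def fun_upd_apply adv_def)
  then show ?case by blast
next
  case (Rewind r)
  have "static_bound (Rewind r) [:12:]"
    by (rule static_bound_basic[of _ r]) (auto simp: len_def fun_upd_apply)
  then show ?case by blast
next
  case (End r)
  have "static_bound (End r) [:12:]"
    by (rule static_bound_basic[of _ r]) (auto simp: len_def fun_upd_apply)
  then show ?case by blast
next
  case (Clear r)
  have "static_bound (Clear r) [:12:]"
    by (rule static_bound_basic[of _ r]) (auto simp: len_def fun_upd_apply)
  then show ?case by blast
next
  case (Then p q)
  then obtain P Q where "static_bound p P" "static_bound q Q" by auto
  with Then.prems have "static_bound (p ;; q) (P + Q + 1)" by (intro static_bound_Then) auto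
  then show ?case by blast
next
  case (IfR C p q)
  then obtain P Q where "static_bound p P" "static_bound q Q" by auto
  then show ?case using static_bound_IfR by blast
next
  case (For q p)
  then obtain P where "static_bound p P" by auto
  with For.prems have "static_bound (For q p) ([:1, 1:] * (P + 3))" by (intro static_bound_For) auto
  then show ?case by blast
qed

text \<open>A register grown by a static program cannot control one of its own loops. Programs that
  need this are split into phases: the bound here composes polynomials, so what one phase writes may
  control the loops of the next.\<close>

definition polyprog :: "prog \<Rightarrow> bool" where
  "polyprog p \<longleftrightarrow> (\<exists>P :: nat poly. \<forall>s B. (\<forall>r. len s r \<le> B) \<longrightarrow>
     cost p s \<le> poly P B \<and> (\<forall>r. len (den p s) r \<le> poly P B))"

lemma polyprog_static:
  assumes "loops p \<inter> grown p = {}"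
  shows "polyprog p"
proof -
  obtain P where P: "static_bound p P" using ex_static_bound[OF assms] by blast
  show ?thesis unfolding polyprog_def
  proof (intro exI[of _ "P * ([:0, 1:] + P + 1) + ([:0, 1:] + P)"] allI impI)
    fix s B assume B: "\<forall>r. len s r \<le> B"
    then have B1: "len s r \<le> B" for r by blast
    note 1 = static_boundD[OF P B1 B1]
    have "cost p s \<le> poly P B * (B + poly P B + 1)" by (rule 1(1))
    moreover have "len (den p s) r \<le> B + poly P B" for r
      using 1(2)[of r] B1[of r] by linarith
    ultimately show "cost p s \<le> poly (P * ([:0, 1:] + P + 1) + ([:0, 1:] + P)) B \<and>
      (\<forall>r. len (den p s) r \<le> poly (P * ([:0, 1:] + P + 1) + ([:0, 1:] + P)) B)"
      by (simp add: trans_le_add1 trans_le_add2)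
  qed
qed

lemma polyprog_Then:
  assumes "polyprog p" "polyprog q"
  shows "polyprog (p ;; q)"
proof -
  obtain P Q :: "nat poly" where P: "\<And>s B. (\<forall>r. len s r \<le> B) \<Longrightarrow>
     cost p s \<le> poly P B \<and> (\<forall>r. len (den p s) r \<le> poly P B)"
    and Q: "\<And>s B. (\<forall>r. len s r \<le> B) \<Longrightarrow>
     cost q s \<le> poly Q B \<and> (\<forall>r. len (den q s) r \<le> poly Q B)"
    using assms unfolding polyprog_def by metis
  show ?thesis unfolding polyprog_def
  proof (intro exI[of _ "1 + P + pcompose Q P"] allI impI)
    fix s B assume "\<forall>r. len s r \<le> B"
    with P[of s B] Q[of "den p s" "poly P B"]
    show "cost (p ;; q) s \<le> poly (1 + P + pcompose Q P) B \<and>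
      (\<forall>r. len (den (p ;; q) s) r \<le> poly (1 + P + pcompose Q P) B)"
      by (auto simp: poly_pcompose intro!: le_SucI trans_le_add2)
  qed
qed

text \<open>The domain \<open>X\<close> is essential: a machine that solves a problem is trusted on
  codes of instances only, and this restriction has to travel through compositions.\<close>

definition fp_on :: "bool list set \<Rightarrow> (bool list \<Rightarrow> bool list) \<Rightarrow> bool" where
  "fp_on X f \<longleftrightarrow> polytime_solves (\<lambda>x. x) X (\<lambda>x y. y = f x)"

lemma fp_onI:
  assumes "wf_com K G c"
    "\<And>x. x \<in> X \<Longrightarrow> \<exists>t T'. exec c (init_tapes x) t T' \<and> t \<le> poly p (length x) \<and> tape_word (T' 0) (f x)"
  shows "fp_on X f"
proof -
  have "wf_com (max K 1) (max G 3) c" by (rule wf_com_mono[OF assms(1)]) auto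
  then obtain M where M: "wf_tm M"
    "\<And>x t T' y. exec c (init_tapes x) t T' \<Longrightarrow> tape_word (T' 0) y \<Longrightarrow> outputs_within M x t y"
    by (rule compile_com) auto
  have "outputs_within M x (poly p (length x)) (f x)" if "x \<in> X" for x
  proof -
    from assms(2)[OF that] obtain t T' where t: "exec c (init_tapes x) t T'" "t \<le> poly p (length x)"
      "tape_word (T' 0) (f x)" by blast
    from M(2)[OF t(1,3)] t(2) show ?thesis unfolding outputs_within_def by (meson order_trans)
  qed
  with M(1) show ?thesis unfolding fp_on_def polytime_solves_def by blast
qed

lemma word_contents_eq: "word_contents x = contents (map bit_sym x)"
  by (auto simp: word_contents_def contents_def nat_less_iff)

lemma bit_sym_nonzero [simp]: "bit_sym b \<noteq> 0" "0 \<noteq> bit_sym b"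
  by (auto simp: bit_sym_def)

definition init_regs :: "bool list \<Rightarrow> regs" where
  "init_regs x = (\<lambda>_. ([], 0))(0 := (map bit_sym x, 0))"

lemma fp_on_prog:
  assumes "okp p" "polyprog p" "\<And>x. x \<in> X \<Longrightarrow> fst (den p (init_regs x) 0) = map bit_sym (f x)"
  shows "fp_on X f"
proof -
  obtain K G where wf: "wf_com K G (compile p)" using wf_compile by blast
  obtain P :: "nat poly" where P: "\<And>s B. (\<forall>r. len s r \<le> B) \<Longrightarrow> cost p s \<le> poly P B"
    using assms(2) unfolding polyprog_def by metis
  show ?thesis
  proof (rule fp_onI[OF wf, of X P])
    fix x assume x: "x \<in> X"
    have "oks (init_regs x)" by (auto simp: oks_def init_regs_def fun_upd_apply)
    from exec_compile[OF assms(1) this] obtain t where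
      t: "t \<le> cost p (init_regs x)"
        "exec (compile p) (tapes_of (init_regs x)) t (tapes_of (den p (init_regs x)))" by blast
    have i: "tapes_of (init_regs x) = init_tapes x"
      by (auto simp: fun_eq_iff fun_upd_apply tapes_of_def init_regs_def init_tapes_def wtape_def
          word_contents_eq contents_Nil)
    have "cost p (init_regs x) \<le> poly P (length x)" by (rule P) (simp add: len_def init_regs_def
        fun_upd_apply)
    moreover have "tape_word (tapes_of (den p (init_regs x)) 0) (f x)"
      by (auto simp: tapes_of_def tape_word_def wtape_def assms(3)[OF x] contents_def)
    ultimately show "\<exists>t T'. exec (compile p) (init_tapes x) t T' \<and> t \<le> poly P (length x) \<and>
        tape_word (T' 0) (f x)"
      using t i by (metis order_trans)
  qed
qed

section \<open>Calling Turing machines\<close>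

text \<open>A machine \<open>M\<close> is run on the tapes \<open>b + 2, b + 3, \<dots>\<close>. Its state is stored as a symbol on
  tape \<open>b\<close>. Tape \<open>b + 1\<close> records the moves of the first head of \<open>M\<close>; undoing them brings this
  head back to the beginning of the output.\<close>

lemma act_read [simp]: "act (fst tp (snd tp), Stay) tp = tp"
  by (cases tp) simp

fun mcode :: "move \<Rightarrow> nat" where
  "mcode Move_Left = 1"
| "mcode Stay = 2"
| "mcode Move_Right = 3"

definition opp :: "nat \<Rightarrow> move" where
  "opp v = (if v = 1 then Move_Right else if v = 3 then Move_Left else Stay)"

lemma offset_opp: "offset (opp (mcode d)) = - offset d"
  by (cases d) (auto simp: opp_def)

lemma mcode_bounds: "mcode d < 4" "mcode d \<noteq> 0"
  by (cases d; simp)+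

definition log_offset :: "nat list \<Rightarrow> int" where
  "log_offset w = (\<Sum>v\<leftarrow>w. - offset (opp v))"

definition sim_act :: "nat \<Rightarrow> tm \<Rightarrow> (nat \<Rightarrow> nat) \<Rightarrow> nat \<Rightarrow> nat \<times> move" where
  "sim_act b M rs i = (let ss = map (\<lambda>j. rs (b + 2 + j)) [0..<num_tapes M]; r = trans_fun M (rs b) ss in
     if rs b < num_states M \<and> set ss \<subseteq> {..<num_syms M} \<and> b \<le> i \<and> i < b + 2 + num_tapes M then
       if i = b then (fst r, Stay)
       else if i = b + 1 then (mcode (snd (snd r ! 0)), Move_Right)
       else snd r ! (i - b - 2)
     else (rs i, Stay))"

definition undo_act :: "nat \<Rightarrow> (nat \<Rightarrow> nat) \<Rightarrow> nat \<Rightarrow> nat \<times> move" where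
  "undo_act b rs i = (if i = b + 1 then (rs i, Move_Left)
     else if i = b + 2 then (rs i, opp (rs (b + 1))) else (rs i, Stay))"

definition sim_loop :: "nat \<Rightarrow> tm \<Rightarrow> com" where
  "sim_loop b M = While (\<lambda>rs. rs b \<noteq> num_states M) (Act (sim_act b M))"

definition undo_loop :: "nat \<Rightarrow> com" where
  "undo_loop b = While (nonblank (b + 1)) (Act (undo_act b))"

definition call :: "nat \<Rightarrow> tm \<Rightarrow> com" where
  "call b M = Seq (sim_loop b M) (Seq (on (b + 1) (\<lambda>v. (v, Move_Left))) (undo_loop b))"

definition vcfg :: "tm \<Rightarrow> config \<Rightarrow> bool" where
  "vcfg M cfg \<longleftrightarrow> fst cfg \<le> num_states M \<and> length (snd cfg) = num_tapes M \<and>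
     (\<forall>tp \<in> set (snd cfg). \<forall>p. fst tp p < num_syms M)"

lemma wf_tmD:
  assumes "wf_tm M" "q < num_states M" "length ss = num_tapes M" "set ss \<subseteq> {..<num_syms M}"
  shows "fst (trans_fun M q ss) \<le> num_states M" "length (snd (trans_fun M q ss)) = num_tapes M"
    "j < num_tapes M \<Longrightarrow> fst (snd (trans_fun M q ss) ! j) < num_syms M"
proof -
  have *: "fst (trans_fun M q ss) \<le> num_states M \<and> length (snd (trans_fun M q ss)) = num_tapes M \<and>
      fst ` set (snd (trans_fun M q ss)) \<subseteq> {..<num_syms M}"
    using assms unfolding wf_tm_def by (fastforce split: prod.splits)
  then show "fst (trans_fun M q ss) \<le> num_states M" "length (snd (trans_fun M q ss)) = num_tapes M" by auto
  show "fst (snd (trans_fun M q ss) ! j) < num_syms M" if "j < num_tapes M"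
    using * that by (metis imageI lessThan_iff nth_mem subsetD)
qed

text \<open>Bounded symbols are demanded for all readings, whereas \<open>wf_tm\<close> controls the
  transition function on legal states and symbols only. On any other reading the guard in
  \<open>sim_act\<close> leaves the tapes as they are.\<close>

lemma wf_call:
  assumes "wf_tm M"
  shows "\<exists>G. wf_com (b + 2 + num_tapes M) G (call b M)"
proof -
  let ?G = "Suc (num_syms M + num_states M + 4)"
  have K: "num_tapes M \<ge> 1" using assms by (simp add: wf_tm_def)
  have "fst (sim_act b M rs i) < ?G \<or> fst (sim_act b M rs i) = rs i" for rs i
  proof -
    let ?ss = "map (\<lambda>j. rs (b + 2 + j)) [0..<num_tapes M]"
    show ?thesis
    proof (cases "rs b < num_states M \<and> set ?ss \<subseteq> {..<num_syms M} \<and> b \<le> i \<and> i < b + 2 + num_tapes M")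
      case True
      then have "fst (trans_fun M (rs b) ?ss) \<le> num_states M"
        "\<And>j. j < num_tapes M \<Longrightarrow> fst (snd (trans_fun M (rs b) ?ss) ! j) < num_syms M"
        using wf_tmD[OF assms, of "rs b" ?ss] by auto
      note r = this
      show ?thesis
      proof (cases "i = b \<or> i = b + 1")
        case False
        with True have "i - b - 2 < num_tapes M" by arith
        with r(2) have "fst (snd (trans_fun M (rs b) ?ss) ! (i - b - 2)) < ?G"
          by (meson less_SucI trans_less_add1)
        with False True show ?thesis unfolding sim_act_def Let_def by simp
      qed (use r(1) True mcode_bounds(1)[of "snd (snd (trans_fun M (rs b) ?ss) ! 0)"] in
          \<open>auto simp: sim_act_def Let_def\<close>)
    qed (auto simp: sim_act_def Let_def)
  qed
  moreover have "sim_act b M rs i = (rs i, Stay)" if "b + 2 + num_tapes M \<le> i" for rs i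
    using that by (auto simp: sim_act_def Let_def)
  ultimately have 1: "wf_com (b + 2 + num_tapes M) ?G (Act (sim_act b M))"
    by (auto simp del: One_nat_def) (metis rangeI)
  have 2: "wf_com (b + 2 + num_tapes M) ?G (Act (undo_act b))"
    using K by (auto simp: undo_act_def)
  have "wf_com (Suc (b + 1)) ?G (on (b + 1) (\<lambda>v. (v, Move_Left)))" by (rule wf_on) auto
  then have 3: "wf_com (b + 2 + num_tapes M) ?G (on (b + 1) (\<lambda>v. (v, Move_Left)))"
    by (rule wf_com_mono) auto
  show ?thesis using 1 2 3 unfolding call_def sim_loop_def undo_loop_def
    by (intro exI[of _ ?G]) (simp only: wf_com.simps(2,4) simp_thms)
qed

lemma step_running:
  assumes "q < num_states M" "r = trans_fun M q (map (\<lambda>tp. fst tp (snd tp)) tps)"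
  shows "step M (q, tps) = (fst r, map2 act (snd r) tps)"
  using assms by (simp add: case_prod_unfold)

lemma vcfg_reads:
  assumes "vcfg M (q, tps)"
  shows "length (map (\<lambda>tp. fst tp (snd tp)) tps) = num_tapes M"
    "set (map (\<lambda>tp. fst tp (snd tp)) tps) \<subseteq> {..<num_syms M}"
  using assms by (auto simp: vcfg_def)

lemma vcfg_step:
  assumes "wf_tm M" "vcfg M cfg"
  shows "vcfg M (step M cfg)"
proof -
  obtain q tps where c: "cfg = (q, tps)" by fastforce
  show ?thesis
  proof (cases "q < num_states M")
    case True
    let ?r = "trans_fun M q (map (\<lambda>tp. fst tp (snd tp)) tps)"
    note v = vcfg_reads[OF assms(2)[unfolded c]]
    note w = wf_tmD[OF assms(1) True v]
    have l: "length tps = num_tapes M" using assms(2) by (simp add: c vcfg_def)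
    have "fst tp p < num_syms M" if tp: "tp \<in> set (map2 act (snd ?r) tps)" for tp p
    proof -
      from tp obtain j where j: "j < num_tapes M" "tp = act (snd ?r ! j) (tps ! j)"
        using w(2) l by (auto simp: set_zip)
      have "tps ! j \<in> set tps" using j l by simp
      then have "fst (tps ! j) p < num_syms M" using assms(2) by (simp add: c vcfg_def)
      with w(3)[OF j(1)] j(2) show ?thesis
        by (cases "snd ?r ! j"; cases "tps ! j") (auto simp: fun_upd_apply)
    qed
    then show ?thesis unfolding c step_running[OF True refl] vcfg_def using w l by simp
  next
    case False
    then show ?thesis using assms(2) by (simp add: c)
  qed
qed

lemma vcfg_init:
  assumes "wf_tm M"
  shows "vcfg M (init_config M x)"
proof -
  have "num_syms M \<ge> 3" "num_tapes M \<ge> 1" using assms by (auto simp: wf_tm_def)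
  moreover have "bit_sym a < 3" for a by (simp add: bit_sym_def)
  ultimately show ?thesis
    by (auto simp: vcfg_def init_config_def word_contents_def set_replicate_conv_if
        intro: less_le_trans)
qed

text \<open>After \<open>t\<close> steps the first head is at most at cell \<open>t\<close>, so the
  cells from \<open>length x + t\<close> on are still blank. The bound is what makes the time of a
  second machine, run on the output of a first one, polynomial in the original input.\<close>

lemma output_length:
  assumes "wf_tm M" "outputs_within M x n y"
  shows "length y \<le> length x + n"
proof -
  have inv: "vcfg M ((step M ^^ t) (init_config M x)) \<and>
     snd (snd ((step M ^^ t) (init_config M x)) ! 0) \<le> int t \<and>
     (\<forall>p \<ge> int (length x) + int t. fst (snd ((step M ^^ t) (init_config M x)) ! 0) p = 0)" for t
  proof (induction t)
    case 0
    show ?case using vcfg_init[OF assms(1), of x] by (auto simp: init_config_def word_contents_def)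
  next
    case (Suc t)
    obtain q tps where c: "(step M ^^ t) (init_config M x) = (q, tps)" by fastforce
    have v: "vcfg M (q, tps)" using Suc c by simp
    have l: "length tps = num_tapes M" "num_tapes M \<ge> 1"
      using v assms(1) by (auto simp: vcfg_def wf_tm_def)
    show ?case
    proof (cases "q < num_states M")
      case True
      let ?r = "trans_fun M q (map (\<lambda>tp. fst tp (snd tp)) tps)"
      note w = wf_tmD[OF assms(1) True vcfg_reads[OF v]]
      have e: "map2 act (snd ?r) tps ! 0 = act (snd ?r ! 0) (tps ! 0)"
        using w(2) l by simp
      obtain a d where r0: "snd ?r ! 0 = (a, d)" by fastforce
      have "offset d \<le> 1" by (cases d) auto
      then have "snd (act (snd ?r ! 0) (tps ! 0)) \<le> int (Suc t) \<and>
        (\<forall>p \<ge> int (length x) + int (Suc t). fst (act (snd ?r ! 0) (tps ! 0)) p = 0)"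
        using Suc c r0 by (cases "tps ! 0") (auto simp: fun_upd_apply)
      with e show ?thesis
        using vcfg_step[OF assms(1) v] step_running[OF True refl, of tps] c by simp
    next
      case False
      then show ?thesis using Suc c by auto
    qed
  qed
  from assms(2) obtain t where t: "t \<le> n"
    "output_word ((step M ^^ t) (init_config M x)) y" unfolding outputs_within_def by blast
  have "length (snd ((step M ^^ t) (init_config M x))) \<ge> 1"
    using inv[of t] assms(1) by (simp add: vcfg_def wf_tm_def)
  then have hd: "hd (snd ((step M ^^ t) (init_config M x))) = snd ((step M ^^ t) (init_config M x)) ! 0"
    by (intro hd_conv_nth) auto
  have "length y \<le> length x + t"
  proof (rule ccontr)
    assume "\<not> ?thesis"
    then have "length x + t < length y" by simp
    moreover have "\<forall>i < length y. fst (snd ((step M ^^ t) (init_config M x)) ! 0) (int i) = bit_sym (y ! i)"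
      using t(2) hd by (simp add: output_word_def)
    ultimately have "fst (snd ((step M ^^ t) (init_config M x)) ! 0) (int (length x + t)) =
        bit_sym (y ! (length x + t))" by blast
    moreover have "fst (snd ((step M ^^ t) (init_config M x)) ! 0) (int (length x + t)) = 0"
      using inv[of t] by simp
    ultimately show False by (metis bit_sym_nonzero(1))
  qed
  with t(1) show ?thesis by simp
qed

text \<open>A blank tape \<open>b\<close> already encodes the start state 0 and a blank tape
  \<open>b + 1\<close> the empty log, so a call needs no preparation beyond the input on tape
  \<open>b + 2\<close>.\<close>

definition embed :: "nat \<Rightarrow> tm \<Rightarrow> tapes \<Rightarrow> config \<Rightarrow> nat list \<Rightarrow> tapes" where
  "embed b M T cfg w i = (if i = b then ((\<lambda>_. 0)(0 := fst cfg), 0)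
     else if i = b + 1 then wtape (w, length w)
     else if b + 2 \<le> i \<and> i < b + 2 + num_tapes M then snd cfg ! (i - b - 2) else T i)"

lemma exec_sim_step:
  assumes M: "wf_tm M" and v: "vcfg M (q, tps)" and q: "q < num_states M"
  obtains d where
    "exec (Act (sim_act b M)) (embed b M T (q, tps) w) 1 (embed b M T (step M (q, tps)) (w @ [mcode d]))"
    "snd (snd (step M (q, tps)) ! 0) = snd (tps ! 0) + offset d"
proof -
  let ?E = "embed b M T (q, tps) w"
  let ?ss = "map (\<lambda>tp. fst tp (snd tp)) tps"
  let ?r = "trans_fun M q ?ss"
  note w = wf_tmD[OF M q vcfg_reads[OF v]]
  have l: "length tps = num_tapes M" "num_tapes M \<ge> 1"
    using v M by (auto simp: vcfg_def wf_tm_def)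
  have r: "reads ?E (b + 2 + j) = ?ss ! j" if "j < num_tapes M" for j
    using that l by (simp add: reads_def embed_def)
  then have ss: "map (\<lambda>j. reads ?E (b + 2 + j)) [0..<num_tapes M] = ?ss"
    using l by (intro nth_equalityI) auto
  have rb: "reads ?E b = q" by (simp add: reads_def embed_def)
  have sa: "sim_act b M (reads ?E) i = (if b \<le> i \<and> i < b + 2 + num_tapes M then
       if i = b then (fst ?r, Stay)
       else if i = b + 1 then (mcode (snd (snd ?r ! 0)), Move_Right)
       else snd ?r ! (i - b - 2)
     else (reads ?E i, Stay))" for i
    unfolding sim_act_def Let_def ss rb using q vcfg_reads(2)[OF v] by simp
  let ?d = "snd (snd ?r ! 0)"
  have "act (sim_act b M (reads ?E) i) (?E i) = embed b M T (step M (q, tps)) (w @ [mcode ?d]) i" for i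
  proof -
    consider "i = b" | "i = b + 1" | j where "i = b + 2 + j" "j < num_tapes M" | "i < b \<or> b + 2 +
        num_tapes M \<le> i"
    proof (cases "b + 2 \<le> i \<and> i < b + 2 + num_tapes M")
      case True
      then show ?thesis using that(3)[of "i - b - 2"] by auto
    qed (use that in linarith)
    then show ?thesis
    proof cases
      case 1
      then show ?thesis unfolding sa step_running[OF q refl]
        by (simp add: embed_def fun_upd_apply fun_eq_iff)
    next
      case 2
      then show ?thesis unfolding sa step_running[OF q refl]
        by (simp add: embed_def wtape_put put_def)
    next
      case 3
      then show ?thesis unfolding sa step_running[OF q refl] using w(2) l
        by (simp add: embed_def)
    next
      case 4
      then have "act (sim_act b M (reads ?E) i) (?E i) = ?E i" unfolding sa by auto
      with 4 show ?thesis by (auto simp: embed_def)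
    qed
  qed
  then have E: "embed b M T (step M (q, tps)) (w @ [mcode ?d]) = (\<lambda>i. act (sim_act b M (reads ?E) i) (?E i))"
    by auto
  have "snd (snd (step M (q, tps)) ! 0) = snd (tps ! 0) + offset ?d"
    unfolding step_running[OF q refl] using w(2) l by (cases "snd ?r ! 0"; cases "tps ! 0") auto
  moreover have "exec (Act (sim_act b M)) ?E 1 (embed b M T (step M (q, tps)) (w @ [mcode ?d]))"
    unfolding E by (rule exec.Act)
  ultimately show ?thesis using that by blast
qed

text \<open>The log sums up to the position of the first head throughout. If the machine halts
  before step \<open>t\<close>, the loop stops there and the configuration no longer changes; hence
  the time is only bounded from above.\<close>

lemma exec_sim_loop:
  assumes M: "wf_tm M"
  shows "vcfg M cfg \<Longrightarrow> fst ((step M ^^ t) cfg) = num_states M \<Longrightarrow> snd (snd cfg ! 0) = log_offset w \<Longrightarrow>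
    0 \<notin> set w \<Longrightarrow>
    \<exists>u w'. u \<le> 2 * t + 1 \<and> length w' \<le> length w + t \<and> 0 \<notin> set w' \<and>
      snd (snd ((step M ^^ t) cfg) ! 0) = log_offset w' \<and>
      exec (sim_loop b M) (embed b M T cfg w) u (embed b M T ((step M ^^ t) cfg) w')"
proof (induction t arbitrary: cfg w)
  case 0
  have "\<not> reads (embed b M T cfg w) b \<noteq> num_states M" using 0 by (simp add: reads_def embed_def)
  from exec.WhileF[of "\<lambda>rs. rs b \<noteq> num_states M", OF this] 0 show ?case
    unfolding sim_loop_def by fastforce
next
  case (Suc t)
  obtain q tps where c: "cfg = (q, tps)" by fastforce
  show ?case
  proof (cases "q = num_states M")
    case True
    then have "step M cfg = cfg" by (simp add: c)
    moreover from this have "(step M ^^ n) cfg = cfg" for n by (induction n) auto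
    moreover have "\<not> reads (embed b M T cfg w) b \<noteq> num_states M" using True by (simp add: reads_def
        embed_def c)
    note exec.WhileF[of "\<lambda>rs. rs b \<noteq> num_states M", OF this]
    ultimately show ?thesis using Suc.prems unfolding sim_loop_def by (intro exI[of _ 1] exI[of _ w]) auto
  next
    case False
    then have q: "q < num_states M" using Suc.prems(1) by (simp add: vcfg_def c)
    from exec_sim_step[OF M Suc.prems(1)[unfolded c] q, of b T w] obtain d where
      d: "exec (Act (sim_act b M)) (embed b M T cfg w) 1 (embed b M T (step M cfg) (w @ [mcode d]))"
        "snd (snd (step M cfg) ! 0) = snd (tps ! 0) + offset d"
      unfolding c by metis
    have "vcfg M (step M cfg)" by (rule vcfg_step[OF M Suc.prems(1)])
    moreover have "fst ((step M ^^ t) (step M cfg)) = num_states M"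
      using Suc.prems(2) by (simp only: funpow_Suc_right comp_apply)
    moreover have "snd (snd (step M cfg) ! 0) = log_offset (w @ [mcode d])"
      using d(2) Suc.prems(3) by (simp add: c log_offset_def offset_opp)
    moreover have "0 \<notin> set (w @ [mcode d])" using Suc.prems(4) mcode_bounds(2)[of d] by auto
    ultimately obtain u w' where u: "u \<le> 2 * t + 1" "length w' \<le> length (w @ [mcode d]) + t" "0 \<notin> set w'"
      "snd (snd ((step M ^^ t) (step M cfg)) ! 0) = log_offset w'"
      "exec (sim_loop b M) (embed b M T (step M cfg) (w @ [mcode d])) u (embed b M T ((step M ^^ t) (step
          M cfg)) w')"
      using Suc.IH by blast
    have "reads (embed b M T cfg w) b \<noteq> num_states M" using False by (simp add: reads_def embed_def c)
    from exec.WhileT[of "\<lambda>rs. rs b \<noteq> num_states M", OF this d(1) u(5)[unfolded sim_loop_def]]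
    have "exec (sim_loop b M) (embed b M T cfg w) (Suc (1 + u)) (embed b M T ((step M ^^ t) (step M cfg)) w')"
      unfolding sim_loop_def .
    then show ?thesis unfolding funpow_Suc_right comp_apply
      using u by (intro exI[of _ "Suc (1 + u)"] exI[of _ w']) auto
  qed
qed

lemma exec_undo_loop:
  assumes "0 \<notin> set w" "i \<le> length w"
  shows "exec (undo_loop b) (T(b + 1 := (contents w, int i - 1), b + 2 := (c, log_offset (take i w))))
    (2 * i + 1) (T(b + 1 := (contents w, - 1), b + 2 := (c, 0)))"
  using assms(2)
proof (induction i)
  case 0
  have "\<not> nonblank (b + 1) (reads (T(b + 1 := (contents w, - 1), b + 2 := (c, 0))))"
    by (simp add: reads_def nonblank_def contents_def)
  from exec.WhileF[of "nonblank (b + 1)", OF this] show ?case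
    by (simp add: undo_loop_def log_offset_def)
next
  case (Suc i)
  let ?E = "T(b + 1 := (contents w, int (Suc i) - 1), b + 2 := (c, log_offset (take (Suc i) w)))"
  let ?F = "T(b + 1 := (contents w, int i - 1), b + 2 := (c, log_offset (take i w)))"
  have i: "i < length w" using Suc.prems by simp
  then have "w ! i \<noteq> 0" using assms(1) by (metis nth_mem)
  then have 1: "nonblank (b + 1) (reads ?E)"
    using i by (simp add: reads_def nonblank_def contents_def)
  have rb: "reads ?E (b + 1) = w ! i" using i by (simp add: reads_def contents_def)
  have "log_offset (take (Suc i) w) + offset (opp (w ! i)) = log_offset (take i w)"
    using i by (simp add: take_Suc_conv_app_nth log_offset_def)
  then have "?F = (\<lambda>j. act (undo_act b (reads ?E) j) (?E j))"
    using rb by (auto simp: fun_eq_iff undo_act_def fun_upd_apply reads_def split: if_splits)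
  then have 2: "exec (Act (undo_act b)) ?E 1 ?F" by (simp only: exec.Act)
  have "exec (undo_loop b) ?E (Suc (1 + (2 * i + 1))) (T(b + 1 := (contents w, - 1), b + 2 := (c, 0)))"
    unfolding undo_loop_def
    by (rule exec.WhileT[of "nonblank (b + 1)", OF 1 2 Suc.IH[OF less_imp_le[OF i], unfolded undo_loop_def]])
  moreover have "Suc (1 + (2 * i + 1)) = 2 * Suc i + 1" by simp
  ultimately show ?case by (simp only:)
qed

lemma exec_call:
  assumes M: "wf_tm M" and out: "outputs_within M x n y"
    and T: "T b = wtape ([], 0)" "T (b + 1) = wtape ([], 0)" "T (b + 2) = wtape (map bit_sym x, 0)"
      "\<And>i. b + 3 \<le> i \<Longrightarrow> i < b + 2 + num_tapes M \<Longrightarrow> T i = wtape ([], 0)"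
  shows "\<exists>t T'. t \<le> 4 * n + 7 \<and> exec (call b M) T t T' \<and> tape_word (T' (b + 2)) y \<and> snd (T' (b + 2)) = 0 \<and>
    (\<forall>i. i < b \<or> b + 2 + num_tapes M \<le> i \<longrightarrow> T' i = T i)"
proof -
  have K: "num_tapes M \<ge> 1" using M by (simp add: wf_tm_def)
  from out obtain t where t: "t \<le> n" "fst ((step M ^^ t) (init_config M x)) = num_states M"
     "output_word ((step M ^^ t) (init_config M x)) y" unfolding outputs_within_def by blast
  have E: "T = embed b M T (init_config M x) []"
  proof
    fix i
    consider "i = b" | "i = b + 1" | "i = b + 2" | "b + 3 \<le> i \<and> i < b + 2 + num_tapes M" |
       "i < b \<or> b + 2 + num_tapes M \<le> i" using K by linarith
    then show "T i = embed b M T (init_config M x) [] i"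
      using T K
      by cases (auto simp: embed_def init_config_def wtape_def contents_Nil word_contents_eq
          fun_upd_apply nth_Cons')
  qed
  have "snd (snd (init_config M x) ! 0) = log_offset []" by (simp add: init_config_def log_offset_def)
  from exec_sim_loop[OF M vcfg_init[OF M] t(2) this, of b T] obtain u w where
    u: "u \<le> 2 * t + 1" "length w \<le> t" "0 \<notin> set w"
      "snd (snd ((step M ^^ t) (init_config M x)) ! 0) = log_offset w"
      "exec (sim_loop b M) T u (embed b M T ((step M ^^ t) (init_config M x)) w)"
    unfolding E[symmetric] by auto
  obtain q tps where c: "(step M ^^ t) (init_config M x) = (q, tps)" by fastforce
  have "vcfg M ((step M ^^ i) (init_config M x))" for i
    by (induction i) (use vcfg_step[OF M] vcfg_init[OF M] in auto)
  from this[of t] have l: "length tps = num_tapes M" by (simp add: c vcfg_def)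
  let ?E = "embed b M T (q, tps) w"
  obtain cc where t0: "tps ! 0 = (cc, log_offset w)" using u(4) c by (cases "tps ! 0") auto
  have 2: "exec (on (b + 1) (\<lambda>v. (v, Move_Left))) ?E 1
      (?E(b + 1 := (contents w, int (length w) - 1), b + 2 := (cc, log_offset (take (length w) w))))"
    using K t0 by (intro exec_on) (auto simp: fun_eq_iff fun_upd_apply embed_def reads_def wtape_def)
  let ?T' = "?E(b + 1 := (contents w, - 1), b + 2 := (cc, 0))"
  have ex: "exec (call b M) T (Suc (u + Suc (1 + (2 * length w + 1)))) ?T'"
    unfolding call_def
    by (rule exec.Seq[OF u(5)[unfolded c] exec.Seq[OF 2 exec_undo_loop[OF u(3) order_refl]]])
  have "hd tps = tps ! 0" using l K by (intro hd_conv_nth) auto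
  then have "tape_word (?T' (b + 2)) y"
    using t(3) t0 by (simp add: c tape_word_def output_word_def)
  moreover have "\<forall>i. i < b \<or> b + 2 + num_tapes M \<le> i \<longrightarrow> ?T' i = T i"
    using K by (auto simp: fun_upd_apply embed_def)
  moreover have "Suc (u + Suc (1 + (2 * length w + 1))) \<le> 4 * n + 7" using u(1,2) t(1) by simp
  ultimately show ?thesis using ex by (intro exI[of _ "Suc (u + Suc (1 + (2 * length w + 1)))"] exI[of _
      ?T']) auto
qed

section \<open>Composition and concatenation of polynomial-time functions\<close>

definition copy_act :: "nat \<Rightarrow> nat \<Rightarrow> (nat \<Rightarrow> nat) \<Rightarrow> nat \<Rightarrow> nat \<times> move" where
  "copy_act a b rs i = (if i = a \<or> i = b then (rs a, Move_Right) else (rs i, Stay))"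

definition copyc :: "nat \<Rightarrow> nat \<Rightarrow> com" where
  "copyc a b = While (nonblank a) (Act (copy_act a b))"

lemma wf_copyc: "wf_com (Suc (max a b)) 0 (copyc a b)"
  by (auto simp: copyc_def copy_act_def)

text \<open>A machine may leave arbitrary symbols behind the blank that ends its output, and to the
  left of cell 0. Copying up to the first blank transfers the output word alone to a clean tape,
  which then has the form \<open>wtape\<close>.\<close>

lemma exec_copyc:
  assumes y: "tape_word (c, 0) y" and ab: "a \<noteq> b"
  shows "exec (copyc a b) (T(a := (c, 0), b := wtape (w, length w))) (2 * length y + 1)
    (T(a := (c, int (length y)), b := wtape (w @ map bit_sym y, length w + length y)))"
proof -
  let ?S = "\<lambda>i. T(a := (c, int i), b := wtape (w @ map bit_sym (take i y), length w + i))"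
  have "exec (copyc a b) (?S i) (2 * (length y - i) + 1) (?S (length y))" if "i \<le> length y" for i
    using that
  proof (induction "length y - i" arbitrary: i)
    case 0
    then have i: "i = length y" by simp
    have "\<not> nonblank a (reads (?S i))"
      using y ab i by (simp add: nonblank_def reads_def tape_word_def)
    from exec.WhileF[of "nonblank a", OF this] show ?case using i by (simp add: copyc_def)
  next
    case (Suc n)
    then have i: "i < length y" by simp
    have rs: "reads (?S i) a = bit_sym (y ! i)"
      using y ab i by (simp add: reads_def tape_word_def)
    then have 1: "nonblank a (reads (?S i))" by (simp add: nonblank_def)
    have "act (bit_sym (y ! i), Move_Right) (c, int i) = (c, int (Suc i))"
      using y i by (auto simp: tape_word_def fun_eq_iff fun_upd_apply)
    moreover have "act (bit_sym (y ! i), Move_Right) (wtape (w @ map bit_sym (take i y), length w + i)) =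
        wtape (w @ map bit_sym (take (Suc i) y), length w + Suc i)"
      using i by (subst wtape_put) (auto simp: put_def take_Suc_conv_app_nth)
    ultimately have "?S (Suc i) = (\<lambda>j. act (copy_act a b (reads (?S i)) j) (?S i j))"
      unfolding fun_eq_iff copy_act_def rs using ab
      by (auto simp: fun_upd_apply reads_def simp del: act.simps)
    then have 2: "exec (Act (copy_act a b)) (?S i) 1 (?S (Suc i))" by (simp only: exec.Act)
    have 3: "exec (copyc a b) (?S (Suc i)) (2 * (length y - Suc i) + 1) (?S (length y))"
      by (rule Suc.hyps(1)) (use Suc in auto)
    have "exec (copyc a b) (?S i) (Suc (1 + (2 * (length y - Suc i) + 1))) (?S (length y))"
      unfolding copyc_def by (rule exec.WhileT[of "nonblank a", OF 1 2 3[unfolded copyc_def]])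
    moreover have "Suc (1 + (2 * (length y - Suc i) + 1)) = 2 * (length y - i) + 1" using i by simp
    ultimately show ?case by (simp only:)
  qed
  from this[of 0] show ?thesis by simp
qed

lemma tape_word_wtape: "tape_word (wtape (map bit_sym y, i)) y"
  by (simp add: tape_word_def wtape_def contents_def)

lemma copy_steps:
  assumes "tape_word (T a) y" "snd (T a) = 0" "a \<noteq> b" "T b = wtape (map bit_sym w, length w)"
  shows "exec (copyc a b) T (2 * length y + 1)
    (T(a := (fst (T a), int (length y)), b := wtape (map bit_sym (w @ y), length (w @ y))))"
proof -
  have "T = T(a := (fst (T a), 0), b := wtape (map bit_sym w, length (map bit_sym w)))"
    using assms by (auto simp: fun_eq_iff fun_upd_apply prod_eq_iff)
  with exec_copyc[of "fst (T a)" y a b T "map bit_sym w"] assms show ?thesis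
    by (simp add: tape_word_def)
qed

lemma zero_notin_bits: "0 \<notin> set (map bit_sym y)"
  by (auto simp: bit_sym_def)

lemma start_steps:
  assumes "T a = wtape (map bit_sym y, i)" "i \<le> length y"
  shows "\<exists>t \<le> 2 * length y + 6. exec (to_start a) T t (T(a := wtape (map bit_sym y, 0)))"
proof -
  have "T = T(a := wtape (map bit_sym y, i))" using assms by (auto simp: fun_eq_iff fun_upd_apply)
  with exec_to_start[OF zero_notin_bits, of i y a T] assms(2) show ?thesis by auto
qed

lemma erase_steps:
  assumes "T a = wtape (map bit_sym y, i)" "i \<le> length y"
  shows "\<exists>t \<le> 4 * length y + 12. exec (erase a) T t (T(a := wtape ([], 0)))"
proof -
  have "T = T(a := wtape (map bit_sym y, i))" using assms by (auto simp: fun_eq_iff fun_upd_apply)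
  with exec_erase[OF zero_notin_bits, of i y a T] assms(2) show ?thesis by auto
qed

lemma wf_com_Seq_ex:
  assumes "\<exists>K G. wf_com K G a" "\<exists>K G. wf_com K G b"
  shows "\<exists>K G. wf_com K G (Seq a b)"
proof -
  obtain K1 G1 K2 G2 where 1: "wf_com K1 G1 a" and 2: "wf_com K2 G2 b" using assms by blast
  have "wf_com (max K1 K2) (max G1 G2) (Seq a b)"
    using wf_com_mono[OF 1, of "max K1 K2" "max G1 G2"] wf_com_mono[OF 2, of "max K1 K2" "max G1 G2"] by simp
  then show ?thesis by blast
qed

lemma wf_utils: "\<exists>K G. wf_com K G (copyc a b)" "\<exists>K G. wf_com K G (to_start a)"
  "\<exists>K G. wf_com K G (erase a)" "wf_tm M \<Longrightarrow> \<exists>K G. wf_com K G (call b M)"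
  using wf_copyc wf_compile[of "Rewind a"] wf_compile[of "Clear a"] wf_call
  unfolding compile.simps by blast+

lemma init_tapes_eq: "init_tapes x = (\<lambda>_. wtape ([], 0))(0 := wtape (map bit_sym x, 0))"
  by (auto simp: fun_eq_iff fun_upd_apply init_tapes_def wtape_def contents_Nil word_contents_eq)

lemma exec_SeqI:
  "\<exists>t \<le> m. exec a T t T1 \<Longrightarrow> \<exists>u \<le> n. exec b T1 u T2 \<Longrightarrow> \<exists>v \<le> Suc (m + n). exec (Seq a b) T v T2"
  by (meson Suc_le_mono add_mono exec.Seq)

lemma fp_on_machine:
  assumes "fp_on X f"
  obtains M p where "wf_tm M" "\<And>x. x \<in> X \<Longrightarrow> outputs_within M x (poly p (length x)) (f x)"
  using assms unfolding fp_on_def polytime_solves_def by auto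

text \<open>Called with base 1, \<open>M\<close> occupies the tapes 1 to
  \<open>num_tapes M + 2\<close> and has its input on tape 3. Then \<open>b\<close> is the first
  tape behind them and \<open>b + 2\<close> the input tape of \<open>N\<close>. Tape 0 is erased
  early because it must finally hold nothing but the output.\<close>

lemma fp_on_compose:
  assumes f: "fp_on X f" and g: "fp_on Y g" and XY: "\<And>x. x \<in> X \<Longrightarrow> f x \<in> Y"
  shows "fp_on X (\<lambda>x. g (f x))"
proof -
  obtain M p where M: "wf_tm M" "\<And>x. x \<in> X \<Longrightarrow> outputs_within M x (poly p (length x)) (f x)"
    using fp_on_machine[OF f] by blast
  obtain N q where N: "wf_tm N" "\<And>x. x \<in> Y \<Longrightarrow> outputs_within N x (poly q (length x)) (g x)"
    using fp_on_machine[OF g] by blast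
  define b where "b = 3 + num_tapes M"
  define c where "c = Seq (copyc 0 3) (Seq (to_start 3) (Seq (erase 0) (Seq (call 1 M)
     (Seq (copyc 3 (b + 2)) (Seq (to_start (b + 2)) (Seq (call b N) (copyc (b + 2) 0)))))))"
  have "\<exists>K G. wf_com K G c" unfolding c_def using M(1) N(1) by (intro wf_com_Seq_ex wf_utils)
  then obtain K G where wf: "wf_com K G c" by blast
  \<comment> \<open>\<open>r\<close> bounds the length of \<open>f x\<close>, so
    \<open>pcompose q r\<close> bounds the time of \<open>N\<close> on it. The constants 100 in
    \<open>R\<close> are generous.\<close>
  define r where "r = [:0, 1:] + p"
  define R where "R = [:100, 100:] + [:100:] * r + [:100:] * p + [:100:] * (pcompose q r) +
    [:100:] * (r + pcompose q r)"
  show ?thesis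
  proof (rule fp_onI[OF wf, of X R])
    fix x assume x: "x \<in> X"
    let ?n = "length x" and ?y = "f x" and ?z = "g (f x)"
    note o1 = M(2)[OF x] and o2 = N(2)[OF XY[OF x]]
    have ly: "length ?y \<le> poly r ?n" using output_length[OF M(1) o1] by (simp add: r_def)
    have q: "poly q (length ?y) \<le> poly (pcompose q r) ?n"
      using poly_nat_mono[OF ly] by (simp add: poly_pcompose)
    have lz: "length ?z \<le> poly r ?n + poly (pcompose q r) ?n"
      using output_length[OF N(1) o2] ly q by linarith
    have K: "num_tapes M \<ge> 1" using M(1) by (simp add: wf_tm_def)
    let ?T0 = "init_tapes x"
    have 0: "?T0 0 = wtape (map bit_sym x, 0)" "\<And>i. i \<noteq> 0 \<Longrightarrow> ?T0 i = wtape ([], 0)"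
      by (auto simp: init_tapes_eq)
    define T1 where "T1 = ?T0(0 := wtape (map bit_sym x, ?n), 3 := wtape (map bit_sym x, ?n))"
    have e1: "\<exists>t \<le> 2 * ?n + 1. exec (copyc 0 3) ?T0 t T1"
      using copy_steps[of ?T0 0 x 3 "[]"] 0 tape_word_wtape[of x 0] by (auto simp: T1_def wtape_def)
    define T2 where "T2 = T1(3 := wtape (map bit_sym x, 0))"
    have e2: "\<exists>t \<le> 2 * ?n + 6. exec (to_start 3) T1 t T2"
      unfolding T2_def by (rule start_steps[of _ _ _ ?n]) (auto simp: T1_def)
    define T3 where "T3 = T2(0 := wtape ([], 0))"
    have e3: "\<exists>t \<le> 4 * ?n + 12. exec (erase 0) T2 t T3"
      unfolding T3_def by (rule erase_steps[of _ _ _ ?n]) (auto simp: T2_def T1_def)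
    have T3: "T3 i = (if i = 3 then wtape (map bit_sym x, 0) else wtape ([], 0))" for i
      using 0(2)[of i] by (auto simp: T3_def T2_def T1_def fun_upd_apply)
    obtain t4 T4 where e4: "t4 \<le> 4 * poly p ?n + 7" "exec (call 1 M) T3 t4 T4" "tape_word (T4 3) ?y"
      "snd (T4 3) = 0" "\<And>i. i < 1 \<or> b \<le> i \<Longrightarrow> T4 i = T3 i"
    proof -
      have 12: "(1::nat) + 2 = 3" by simp
      have "\<exists>t T'. t \<le> 4 * poly p ?n + 7 \<and> exec (call 1 M) T3 t T' \<and> tape_word (T' (1 + 2)) ?y \<and>
          snd (T' (1 + 2)) = 0 \<and> (\<forall>i. i < 1 \<or> 1 + 2 + num_tapes M \<le> i \<longrightarrow> T' i = T3 i)"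
        using K by (intro exec_call[OF M(1) o1]) (auto simp: T3 b_def)
      then show thesis using that unfolding b_def 12 by blast
    qed
    define T5 where "T5 = T4(3 := (fst (T4 3), int (length ?y)), b + 2 := wtape (map bit_sym ?y, length ?y))"
    have b4: "T4 i = wtape ([], 0)" if "i = 0 \<or> b \<le> i" for i
      using e4(5)[of i] T3[of i] that K by (auto simp: b_def)
    have e5: "\<exists>t \<le> 2 * length ?y + 1. exec (copyc 3 (b + 2)) T4 t T5"
      using copy_steps[of T4 3 ?y "b + 2" "[]"] e4(3,4) b4[of "b + 2"] K by (auto simp: T5_def b_def)
    define T6 where "T6 = T5(b + 2 := wtape (map bit_sym ?y, 0))"
    have e6: "\<exists>t \<le> 2 * length ?y + 6. exec (to_start (b + 2)) T5 t T6"
      unfolding T6_def by (rule start_steps[of _ _ _ "length ?y"]) (auto simp: T5_def)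
    have b6: "T6 i = wtape ([], 0)" if "i = 0 \<or> b \<le> i" "i \<noteq> b + 2" for i
      using b4[of i] that K by (auto simp: T6_def T5_def b_def fun_upd_apply)
    obtain t7 T7 where e7: "t7 \<le> 4 * poly q (length ?y) + 7" "exec (call b N) T6 t7 T7"
      "tape_word (T7 (b + 2)) ?z" "snd (T7 (b + 2)) = 0" "T7 0 = T6 0"
      using exec_call[OF N(1) o2, of T6 b] b6 unfolding T6_def by (auto simp: b_def)
    define T8 where "T8 = T7(b + 2 := (fst (T7 (b + 2)), int (length ?z)), 0 := wtape (map bit_sym ?z,
        length ?z))"
    have e8: "\<exists>t \<le> 2 * length ?z + 1. exec (copyc (b + 2) 0) T7 t T8"
      using copy_steps[of T7 "b + 2" ?z 0 "[]"] e7(3,4) b6[of 0] e7(5) by (auto simp: T8_def b_def)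
    have "\<exists>t \<le> Suc (2 * ?n + 1 + Suc (2 * ?n + 6 + Suc (4 * ?n + 12 + Suc (4 * poly p ?n + 7 +
        Suc (2 * length ?y + 1 + Suc (2 * length ?y + 6 + Suc (4 * poly q (length ?y) + 7 +
          (2 * length ?z + 1)))))))). exec c ?T0 t T8"
    proof -
      have e4': "\<exists>t \<le> 4 * poly p ?n + 7. exec (call 1 M) T3 t T4" using e4(1,2) by blast
      have e7': "\<exists>t \<le> 4 * poly q (length ?y) + 7. exec (call b N) T6 t T7" using e7(1,2) by blast
      show ?thesis unfolding c_def
        by (rule exec_SeqI[OF e1 exec_SeqI[OF e2 exec_SeqI[OF e3 exec_SeqI[OF e4' exec_SeqI[OF e5
            exec_SeqI[OF e6 exec_SeqI[OF e7' e8]]]]]]])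
    qed
    then obtain t where t: "t \<le> Suc (2 * ?n + 1 + Suc (2 * ?n + 6 + Suc (4 * ?n + 12 + Suc (4 * poly p ?n
        + 7 +
        Suc (2 * length ?y + 1 + Suc (2 * length ?y + 6 + Suc (4 * poly q (length ?y) + 7 +
          (2 * length ?z + 1))))))))" "exec c ?T0 t T8" by blast
    have "t \<le> poly R ?n" using t(1) ly q lz by (simp add: R_def)
    moreover have "tape_word (T8 0) ?z" using tape_word_wtape by (simp add: T8_def)
    ultimately show "\<exists>t T'. exec c (init_tapes x) t T' \<and> t \<le> poly R (length x) \<and> tape_word (T' 0) (g (f x))"
      using t(2) by blast
  qed
qed

text \<open>Both machines need the input, which is therefore duplicated onto both input tapes before
  tape 0 is erased. The second result continues the first because the head of tape 0 stays behind
  what was copied.\<close>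

lemma fp_on_append:
  assumes f: "fp_on X f" and g: "fp_on X g"
  shows "fp_on X (\<lambda>x. f x @ g x)"
proof -
  obtain M p where M: "wf_tm M" "\<And>x. x \<in> X \<Longrightarrow> outputs_within M x (poly p (length x)) (f x)"
    using fp_on_machine[OF f] by blast
  obtain N q where N: "wf_tm N" "\<And>x. x \<in> X \<Longrightarrow> outputs_within N x (poly q (length x)) (g x)"
    using fp_on_machine[OF g] by blast
  define b where "b = 3 + num_tapes M"
  define c where "c = Seq (copyc 0 3) (Seq (to_start 0) (Seq (copyc 0 (b + 2)) (Seq (erase 0)
     (Seq (to_start 3) (Seq (to_start (b + 2)) (Seq (call 1 M) (Seq (call b N)
     (Seq (copyc 3 0) (copyc (b + 2) 0)))))))))"
  have "\<exists>K G. wf_com K G c" unfolding c_def using M(1) N(1) by (intro wf_com_Seq_ex wf_utils)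
  then obtain K G where wf: "wf_com K G c" by blast
  define R where "R = [:100, 100:] + [:100:] * p + [:100:] * q"
  show ?thesis
  proof (rule fp_onI[OF wf, of X R])
    fix x assume x: "x \<in> X"
    let ?n = "length x" and ?y = "f x" and ?z = "g x"
    note o1 = M(2)[OF x] and o2 = N(2)[OF x]
    have ly: "length ?y \<le> ?n + poly p ?n" using output_length[OF M(1) o1] by simp
    have lz: "length ?z \<le> ?n + poly q ?n" using output_length[OF N(1) o2] by simp
    have K: "num_tapes M \<ge> 1" using M(1) by (simp add: wf_tm_def)
    let ?T0 = "init_tapes x"
    have 0: "?T0 0 = wtape (map bit_sym x, 0)" "\<And>i. i \<noteq> 0 \<Longrightarrow> ?T0 i = wtape ([], 0)"
      by (auto simp: init_tapes_eq)
    define T1 where "T1 = ?T0(0 := wtape (map bit_sym x, ?n), 3 := wtape (map bit_sym x, ?n))"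
    have e1: "\<exists>t \<le> 2 * ?n + 1. exec (copyc 0 3) ?T0 t T1"
      using copy_steps[of ?T0 0 x 3 "[]"] 0 tape_word_wtape[of x 0] by (auto simp: T1_def wtape_def)
    define T2 where "T2 = T1(0 := wtape (map bit_sym x, 0))"
    have e2: "\<exists>t \<le> 2 * ?n + 6. exec (to_start 0) T1 t T2"
      unfolding T2_def by (rule start_steps[of _ _ _ ?n]) (auto simp: T1_def)
    define T3 where "T3 = T2(0 := wtape (map bit_sym x, ?n), b + 2 := wtape (map bit_sym x, ?n))"
    have e3: "\<exists>t \<le> 2 * ?n + 1. exec (copyc 0 (b + 2)) T2 t T3"
      using copy_steps[of T2 0 x "b + 2" "[]"] 0 tape_word_wtape[of x 0]
      by (auto simp: T3_def T2_def T1_def b_def wtape_def)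
    define T4 where "T4 = T3(0 := wtape ([], 0))"
    have e4: "\<exists>t \<le> 4 * ?n + 12. exec (erase 0) T3 t T4"
      unfolding T4_def by (rule erase_steps[of _ _ _ ?n]) (auto simp: T3_def)
    define T5 where "T5 = T4(3 := wtape (map bit_sym x, 0))"
    have e5: "\<exists>t \<le> 2 * ?n + 6. exec (to_start 3) T4 t T5"
      unfolding T5_def by (rule start_steps[of _ _ _ ?n]) (auto simp: T4_def T3_def T2_def T1_def b_def)
    define T6 where "T6 = T5(b + 2 := wtape (map bit_sym x, 0))"
    have e6: "\<exists>t \<le> 2 * ?n + 6. exec (to_start (b + 2)) T5 t T6"
      unfolding T6_def by (rule start_steps[of _ _ _ ?n])
        (auto simp: T5_def T4_def T3_def T2_def T1_def b_def)
    have T6: "T6 i = (if i = 3 \<or> i = b + 2 then wtape (map bit_sym x, 0) else wtape ([], 0))" for i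
      using 0(2)[of i] by (auto simp: T6_def T5_def T4_def T3_def T2_def T1_def fun_upd_apply)
    obtain t7 T7 where e7: "t7 \<le> 4 * poly p ?n + 7" "exec (call 1 M) T6 t7 T7" "tape_word (T7 3) ?y"
      "snd (T7 3) = 0" "\<And>i. i < 1 \<or> b \<le> i \<Longrightarrow> T7 i = T6 i"
    proof -
      have 12: "(1::nat) + 2 = 3" by simp
      have "\<exists>t T'. t \<le> 4 * poly p ?n + 7 \<and> exec (call 1 M) T6 t T' \<and> tape_word (T' (1 + 2)) ?y \<and>
          snd (T' (1 + 2)) = 0 \<and> (\<forall>i. i < 1 \<or> 1 + 2 + num_tapes M \<le> i \<longrightarrow> T' i = T6 i)"
        using K by (intro exec_call[OF M(1) o1]) (auto simp: T6 b_def)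
      then show thesis using that unfolding b_def 12 by blast
    qed
    have b7: "T7 i = (if i = b + 2 then wtape (map bit_sym x, 0) else wtape ([], 0))" if "i = 0 \<or> b \<le> i" for i
      using e7(5)[of i] T6[of i] that K by (auto simp: b_def)
    obtain t8 T8 where e8: "t8 \<le> 4 * poly q ?n + 7" "exec (call b N) T7 t8 T8"
      "tape_word (T8 (b + 2)) ?z" "snd (T8 (b + 2)) = 0" "\<And>i. i < b \<Longrightarrow> T8 i = T7 i"
      using exec_call[OF N(1) o2, of T7 b] b7 by auto
    define T9 where "T9 = T8(3 := (fst (T8 3), int (length ?y)), 0 := wtape (map bit_sym ?y, length ?y))"
    have 83: "T8 3 = T7 3" "T8 0 = wtape ([], 0)" using e8(5) b7[of 0] K by (auto simp: b_def)
    have e9: "\<exists>t \<le> 2 * length ?y + 1. exec (copyc 3 0) T8 t T9"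
      using copy_steps[of T8 3 ?y 0 "[]"] 83 e7(3,4) by (auto simp: T9_def)
    define T10 where "T10 = T9(b + 2 := (fst (T9 (b + 2)), int (length ?z)),
        0 := wtape (map bit_sym (?y @ ?z), length (?y @ ?z)))"
    have 92: "T9 (b + 2) = T8 (b + 2)" using K by (auto simp: b_def T9_def)
    have e10: "\<exists>t \<le> 2 * length ?z + 1. exec (copyc (b + 2) 0) T9 t T10"
      unfolding T10_def
      by (intro exI[of _ "2 * length ?z + 1"] conjI copy_steps order_refl)
        (use 92 e8(3,4) in \<open>auto simp: T9_def\<close>)
    have "\<exists>t \<le> Suc (2 * ?n + 1 + Suc (2 * ?n + 6 + Suc (2 * ?n + 1 + Suc (4 * ?n + 12 +
        Suc (2 * ?n + 6 + Suc (2 * ?n + 6 + Suc (4 * poly p ?n + 7 + Suc (4 * poly q ?n + 7 +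
        Suc (2 * length ?y + 1 + (2 * length ?z + 1)))))))))). exec c ?T0 t T10"
    proof -
      have e7': "\<exists>t \<le> 4 * poly p ?n + 7. exec (call 1 M) T6 t T7" using e7(1,2) by blast
      have e8': "\<exists>t \<le> 4 * poly q ?n + 7. exec (call b N) T7 t T8" using e8(1,2) by blast
      show ?thesis unfolding c_def
        by (rule exec_SeqI[OF e1 exec_SeqI[OF e2 exec_SeqI[OF e3 exec_SeqI[OF e4 exec_SeqI[OF e5
            exec_SeqI[OF e6 exec_SeqI[OF e7' exec_SeqI[OF e8' exec_SeqI[OF e9 e10]]]]]]]]])
    qed
    then obtain t where t: "t \<le> Suc (2 * ?n + 1 + Suc (2 * ?n + 6 + Suc (2 * ?n + 1 + Suc (4 * ?n + 12 +
        Suc (2 * ?n + 6 + Suc (2 * ?n + 6 + Suc (4 * poly p ?n + 7 + Suc (4 * poly q ?n + 7 +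
        Suc (2 * length ?y + 1 + (2 * length ?z + 1))))))))))" "exec c ?T0 t T10" by blast
    have "t \<le> poly R ?n" using t(1) ly lz by (simp add: R_def)
    moreover have "tape_word (T10 0) (?y @ ?z)" using tape_word_wtape[of "?y @ ?z"] by (simp add: T10_def)
    ultimately show "\<exists>t T'. exec c (init_tapes x) t T' \<and> t \<le> poly R (length x) \<and> tape_word (T' 0) (f x @ g x)"
      using t(2) by blast
  qed
qed

section \<open>Congruence distance and sign vectors\<close>

datatype gtype = Edge | Other | Good | Bad

text \<open>A gadget consists of two vectors, one for each series, both supported on the coordinates \<open>i\<close> and \<open>j\<close>
  of the ordered pair it belongs to. The gadgets of length 20 force the orthogonal matrix to be
  diagonal with entries \<open>x\<^sub>i = \<plusminus>1\<close>. For such a matrix the gadgets of an edge cost 94, and 8 more if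
  \<open>x\<^sub>i = x\<^sub>j = 1\<close>; a good (bad) vertex costs \<open>94 + 8 / D\<close>, and 8 less (more) if \<open>x\<^sub>i = 1\<close>.\<close>

type_synonym gadget = "(rat \<times> rat) \<times> (rat \<times> rat)"

fun base_gadgets :: "nat \<Rightarrow> gtype \<Rightarrow> gadget list" where
  "base_gadgets D Edge = [((20, 0), (20, 0)), ((20, 0), (-20, 0)), ((0, 20), (0, 20)), ((0, 20), (0, -20)),
     ((3, 4), (3, -4)), ((3, 4), (-3, 4)), ((2, 0), (-2, 0)), ((0, 2), (0, -2))]"
| "base_gadgets D Other = [((94, 0), (0, 0))]"
| "base_gadgets D Good = [((20, 0), (20, 0)), ((20, 0), (-20, 0)), ((4, 0), (4, 0)), ((46 + 8 / of_nat D,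
    0), (0, 0))]"
| "base_gadgets D Bad = [((20, 0), (20, 0)), ((20, 0), (-20, 0)), ((4, 0), (-4, 0)), ((54 + 8 / of_nat D,
    0), (0, 0))]"

definition neg_gadget :: "gadget \<Rightarrow> gadget" where
  "neg_gadget = (\<lambda>((a, b), (c, d)). ((- a, - b), (- c, - d)))"

definition gadgets :: "nat \<Rightarrow> gtype \<Rightarrow> gadget list" where
  "gadgets D ty = concat (map (\<lambda>g. [g, neg_gadget g]) (base_gadgets D ty))"

definition gvec :: "nat \<Rightarrow> nat \<Rightarrow> nat \<Rightarrow> rat \<times> rat \<Rightarrow> rat vec" where
  "gvec k i j = (\<lambda>(a, b). vec k (\<lambda>l. (if l = i then a else 0) + (if l = j then b else 0)))"

definition all_gadgets :: "nat \<Rightarrow> nat \<Rightarrow> (nat \<Rightarrow> nat \<Rightarrow> gtype) \<Rightarrow> (nat \<times> nat \<times> gadget) list" where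
  "all_gadgets D k ty = concat (map (\<lambda>i. concat (map (\<lambda>j. map (\<lambda>g. (i, j, g)) (gadgets D (ty i j)))
      [0..<k])) [0..<k])"

definition gad_S :: "nat \<Rightarrow> nat \<Rightarrow> (nat \<Rightarrow> nat \<Rightarrow> gtype) \<Rightarrow> rat vec list" where
  "gad_S D k ty = map (\<lambda>(i, j, g). gvec k i j (fst g)) (all_gadgets D k ty)"

definition gad_T :: "nat \<Rightarrow> nat \<Rightarrow> (nat \<Rightarrow> nat \<Rightarrow> gtype) \<Rightarrow> rat vec list" where
  "gad_T D k ty = map (\<lambda>(i, j, g). gvec k i j (snd g)) (all_gadgets D k ty)"

section \<open>Euclidean norms of vectors given by their coordinate functions\<close>

definition nn :: "nat \<Rightarrow> (nat \<Rightarrow> real) \<Rightarrow> real" where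
  "nn k f = L2_set f {..<k}"

lemma nn_triangle: "nn k (\<lambda>l. f l + g l) \<le> nn k f + nn k g"
  unfolding nn_def by (rule L2_set_triangle_ineq)

lemma nn_nonneg: "0 \<le> nn k f"
  unfolding nn_def by (rule L2_set_nonneg)

lemma nn_scale: "nn k (\<lambda>l. c * f l) = \<bar>c\<bar> * nn k f"
  by (simp add: nn_def L2_set_def power_mult_distrib real_sqrt_mult flip: sum_distrib_left)

lemma nn_sq: "(nn k f)\<^sup>2 = (\<Sum>l<k. (f l)\<^sup>2)"
  by (simp add: nn_def L2_set_def sum_nonneg)

lemma nn_cong: "(\<And>l. l < k \<Longrightarrow> f l = g l) \<Longrightarrow> nn k f = nn k g"
  unfolding nn_def by (rule L2_set_cong) auto

definition kron :: "nat \<Rightarrow> nat \<Rightarrow> real" where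
  "kron i l = (if l = i then 1 else 0)"

lemma sum_kron: "i < k \<Longrightarrow> (\<Sum>l<k. kron i l * f l) = f i" "i < k \<Longrightarrow> (\<Sum>l<k. f l * kron i l) = f i"
  by (simp_all add: kron_def if_distrib if_distribR sum.delta cong: if_cong)

lemma nn_kron2:
  assumes "i < k" "j < k" "i \<noteq> j"
  shows "nn k (\<lambda>l. p * kron i l + q * kron j l) = sqrt (p\<^sup>2 + q\<^sup>2)"
proof -
  have "(p * kron i l + q * kron j l)\<^sup>2 = p\<^sup>2 * kron i l + q\<^sup>2 * kron j l" for l
    using assms(3) by (auto simp: kron_def)
  then show ?thesis
    using assms by (simp add: nn_def L2_set_def sum.distrib sum_kron)
qed

lemma nn_kron1:
  assumes "i < k"
  shows "nn k (\<lambda>l. p * kron i l) = \<bar>p\<bar>"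
proof -
  have "(p * kron i l)\<^sup>2 = p\<^sup>2 * kron i l" for l by (auto simp: kron_def)
  then show ?thesis using assms by (simp add: nn_def L2_set_def sum_kron)
qed

lemma nn_zero [simp]: "nn k (\<lambda>_. 0) = 0"
  by (simp add: nn_def L2_set_def)

text \<open>\<open>u i\<close> is the image of the unit vector with index \<open>i\<close>, that is,
  column \<open>i\<close> of the matrix, and \<open>v\<close> is the translation. Having columns as
  a free parameter allows replacing them by signed unit vectors.\<close>

definition gcost :: "nat \<Rightarrow> (nat \<Rightarrow> nat \<Rightarrow> real) \<Rightarrow> (nat \<Rightarrow> real) \<Rightarrow> nat \<Rightarrow> nat \<Rightarrow> gadget \<Rightarrow> real" where
  "gcost k u v i j = (\<lambda>((a, b), (c, d)). nn k (\<lambda>l. real_of_rat a * kron i l + real_of_rat b * kron j l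
      - real_of_rat c * u i l - real_of_rat d * u j l - v l))"

lemma euclidean_norm_nn: "x \<in> carrier_vec k \<Longrightarrow> euclidean_norm x = nn k (\<lambda>l. x $ l)"
  by (auto simp: euclidean_norm_def nn_def L2_set_def scalar_prod_def power2_eq_square lessThan_atLeast0)

lemma gadget_cost:
  assumes M: "M \<in> carrier_mat k k" and v: "v \<in> carrier_vec k" and ij: "i < k" "j < k"
  shows "euclidean_norm (map_vec real_of_rat (gvec k i j (fst g)) -
      (M *\<^sub>v map_vec real_of_rat (gvec k i j (snd g)) + v)) =
    gcost k (\<lambda>i l. M $$ (l, i)) (\<lambda>l. v $ l) i j g"
proof -
  obtain a b c d where g: "g = ((a, b), (c, d))" by (cases g) auto
  have mv: "(M *\<^sub>v map_vec real_of_rat (gvec k i j (c, d))) $ l =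
     real_of_rat c * M $$ (l, i) + real_of_rat d * M $$ (l, j)" if "l < k" for l
  proof -
    have "(M *\<^sub>v map_vec real_of_rat (gvec k i j (c, d))) $ l =
       (\<Sum>m<k. M $$ (l, m) * real_of_rat ((if m = i then c else 0) + (if m = j then d else 0)))"
      using M that by (auto simp: gvec_def mult_mat_vec_def scalar_prod_def lessThan_atLeast0 intro!:
          sum.cong)
    also have "\<dots> = (\<Sum>m<k. (real_of_rat c * M $$ (l, m)) * kron i m + (real_of_rat d * M $$ (l, m)) * kron
        j m)"
      by (rule sum.cong) (auto simp: kron_def of_rat_add algebra_simps)
    finally show ?thesis using ij by (simp add: sum.distrib sum_kron)
  qed
  have car: "map_vec real_of_rat (gvec k i j (a, b)) -
      (M *\<^sub>v map_vec real_of_rat (gvec k i j (c, d)) + v) \<in> carrier_vec k"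
    using M v by (auto simp: gvec_def)
  show ?thesis
    unfolding g gcost_def fst_conv snd_conv prod.case euclidean_norm_nn[OF car]
  proof (rule nn_cong)
    fix l assume l: "l < k"
    have dm: "dim_row M = k" "dim_vec v = k" using M v by auto
    show "(map_vec real_of_rat (gvec k i j (a, b)) - (M *\<^sub>v map_vec real_of_rat (gvec k i j (c, d)) + v))
        $ l =
      real_of_rat a * kron i l + real_of_rat b * kron j l - real_of_rat c * M $$ (l, i) - real_of_rat d *
          M $$ (l, j) - v $ l"
      using l dm by (simp add: mv del: index_mult_mat_vec) (simp add: gvec_def kron_def of_rat_add)
  qed
qed

lemma d1_map: "d1 (map f xs) (map g xs) = (\<Sum>x\<leftarrow>xs. euclidean_norm (f x - g x))"
  by (simp add: d1_def sum_list_sum_nth lessThan_atLeast0)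

lemma sum_list_all_gadgets:
  "(\<Sum>x\<leftarrow>all_gadgets D k ty. F x) = (\<Sum>i<k. \<Sum>j<k. \<Sum>g\<leftarrow>gadgets D (ty i j). F (i, j, g))"
  for F :: "nat \<times> nat \<times> gadget \<Rightarrow> real"
proof -
  have c: "sum_list (map F (concat xss)) = (\<Sum>xs\<leftarrow>xss. sum_list (map F xs))" for xss
    by (induction xss) auto
  have l: "(\<Sum>i\<leftarrow>[0..<k]. h i) = (\<Sum>i<k. h i)" for h :: "nat \<Rightarrow> real"
    by (simp add: interv_sum_list_conv_sum_set_nat lessThan_atLeast0)
  show ?thesis
    unfolding all_gadgets_def c map_map comp_def l
    by (simp add: comp_def)
qed

lemma set_all_gadgets: "(i, j, g) \<in> set (all_gadgets D k ty) \<Longrightarrow> i < k \<and> j < k"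
  by (auto simp: all_gadgets_def)

lemma d1_gadgets:
  assumes "M \<in> carrier_mat k k" "v \<in> carrier_vec k"
  shows "d1 (real_series (gad_S D k ty)) (transform M v (real_series (gad_T D k ty))) =
    (\<Sum>i<k. \<Sum>j<k. \<Sum>g\<leftarrow>gadgets D (ty i j). gcost k (\<lambda>i l. M $$ (l, i)) (\<lambda>l. v $ l) i j g)"
proof -
  have "d1 (real_series (gad_S D k ty)) (transform M v (real_series (gad_T D k ty))) =
    (\<Sum>x\<leftarrow>all_gadgets D k ty. euclidean_norm ((\<lambda>(i, j, g). map_vec real_of_rat (gvec k i j (fst g))) x -
      (\<lambda>(i, j, g). M *\<^sub>v map_vec real_of_rat (gvec k i j (snd g)) + v) x))"
    unfolding real_series_def transform_def gad_S_def gad_T_def map_map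
    by (subst d1_map[symmetric]) (simp add: comp_def case_prod_unfold)
  also have "\<dots> = (\<Sum>x\<leftarrow>all_gadgets D k ty.
      (\<lambda>(i, j, g). gcost k (\<lambda>i l. M $$ (l, i)) (\<lambda>l. v $ l) i j g) x)"
  proof (intro arg_cong[where f = sum_list] map_cong refl)
    fix x assume x: "x \<in> set (all_gadgets D k ty)"
    obtain i j g where xe: "x = (i, j, g)" by (cases x) auto
    from set_all_gadgets[OF x[unfolded xe]] gadget_cost[OF assms]
    show "euclidean_norm ((\<lambda>(i, j, g). map_vec real_of_rat (gvec k i j (fst g))) x -
      (\<lambda>(i, j, g). M *\<^sub>v map_vec real_of_rat (gvec k i j (snd g)) + v) x) =
      (\<lambda>(i, j, g). gcost k (\<lambda>i l. M $$ (l, i)) (\<lambda>l. v $ l) i j g) x"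
      by (simp only: xe prod.case)
  qed
  finally show ?thesis by (simp add: sum_list_all_gadgets)
qed

text \<open>Each gadget occurs together with its negative; averaging the two removes the translation.\<close>

lemma gcost_pair: "gcost k u v i j g + gcost k u v i j (neg_gadget g) \<ge> 2 * gcost k u (\<lambda>_. 0) i j g"
proof -
  obtain a b c d where g: "g = ((a, b), (c, d))" by (cases g) auto
  let ?x = "\<lambda>l. real_of_rat a * kron i l + real_of_rat b * kron j l - real_of_rat c * u i l - real_of_rat
      d * u j l"
  have "nn k (\<lambda>l. 2 * ?x l) = nn k (\<lambda>l. (?x l - v l) + (-1) * (- ?x l - v l))"
    by (rule nn_cong) simp
  also have "\<dots> \<le> nn k (\<lambda>l. ?x l - v l) + nn k (\<lambda>l. (-1) * (- ?x l - v l))" by (rule nn_triangle)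
  finally have "2 * nn k ?x \<le> nn k (\<lambda>l. ?x l - v l) + nn k (\<lambda>l. - ?x l - v l)"
    unfolding nn_scale by simp
  moreover have "(\<lambda>l. - ?x l - v l) = (\<lambda>l. real_of_rat (- a) * kron i l + real_of_rat (- b) * kron j l
      - real_of_rat (- c) * u i l - real_of_rat (- d) * u j l - v l)"
    by (simp add: fun_eq_iff of_rat_minus algebra_simps)
  ultimately show ?thesis by (simp add: g gcost_def neg_gadget_def)
qed

lemma gcost_pair0: "gcost k u (\<lambda>_. 0) i j g + gcost k u (\<lambda>_. 0) i j (neg_gadget g) = 2 * gcost k u (\<lambda>_.
    0) i j g"
proof -
  obtain a b c d where g: "g = ((a, b), (c, d))" by (cases g) auto
  let ?x = "\<lambda>l. real_of_rat a * kron i l + real_of_rat b * kron j l - real_of_rat c * u i l - real_of_rat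
      d * u j l"
  have "nn k (\<lambda>l. (-1) * ?x l) = nn k ?x" unfolding nn_scale by simp
  moreover have "(\<lambda>l. (-1) * ?x l) = (\<lambda>l. real_of_rat (- a) * kron i l + real_of_rat (- b) * kron j l
      - real_of_rat (- c) * u i l - real_of_rat (- d) * u j l)"
    by (simp add: fun_eq_iff of_rat_minus algebra_simps)
  ultimately show ?thesis by (simp add: g gcost_def neg_gadget_def)
qed

lemma gadgets_cost_ge:
  "(\<Sum>g\<leftarrow>gadgets D ty. gcost k u v i j g) \<ge> 2 * (\<Sum>g\<leftarrow>base_gadgets D ty. gcost k u (\<lambda>_. 0) i j g)"
proof -
  have "(\<Sum>g\<leftarrow>concat (map (\<lambda>g. [g, neg_gadget g]) gs). gcost k u v i j g) \<ge>
      2 * (\<Sum>g\<leftarrow>gs. gcost k u (\<lambda>_. 0) i j g)" for gs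
  proof (induction gs)
    case (Cons g gs)
    then show ?case using gcost_pair[where k = k and u = u and v = v and i = i and j = j and g = g] by simp
  qed simp
  then show ?thesis by (simp add: gadgets_def)
qed

lemma gadgets_cost0:
  "(\<Sum>g\<leftarrow>gadgets D ty. gcost k u (\<lambda>_. 0) i j g) = 2 * (\<Sum>g\<leftarrow>base_gadgets D ty. gcost k u (\<lambda>_. 0) i j g)"
proof -
  have "(\<Sum>g\<leftarrow>concat (map (\<lambda>g. [g, neg_gadget g]) gs). gcost k u (\<lambda>_. 0) i j g) =
      2 * (\<Sum>g\<leftarrow>gs. gcost k u (\<lambda>_. 0) i j g)" for gs
  proof (induction gs)
    case (Cons g gs)
    then show ?case using gcost_pair0[where k = k and u = u and i = i and j = j and g = g] by simp
  qed simp
  then show ?thesis by (simp add: gadgets_def)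
qed

section \<open>Costs under sign matrices and under arbitrary orthogonal matrices\<close>

definition sgn_of :: "nat set \<Rightarrow> nat \<Rightarrow> real" where
  "sgn_of X i = (if i \<in> X then 1 else - 1)"

definition pen :: "nat \<Rightarrow> nat set \<Rightarrow> (nat \<Rightarrow> nat \<Rightarrow> gtype) \<Rightarrow> nat \<Rightarrow> nat \<Rightarrow> real" where
  "pen D X ty i j = (case ty i j of
      Edge \<Rightarrow> (if i \<in> X \<and> j \<in> X then 8 else 0)
    | Other \<Rightarrow> 0
    | Good \<Rightarrow> 8 / D + (if i \<in> X then - 8 else 0)
    | Bad \<Rightarrow> 8 / D + (if i \<in> X then 8 else 0))"

text \<open>The cost of an edge is computed from two orthogonal coordinates, so its ends must
  differ. A vertex involves the coordinate \<open>i\<close> alone; the diagonal is reserved for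
  vertices.\<close>

definition diag_ok :: "nat \<Rightarrow> (nat \<Rightarrow> nat \<Rightarrow> gtype) \<Rightarrow> bool" where
  "diag_ok k ty \<longleftrightarrow> (\<forall>i<k. \<forall>j<k. i = j \<longleftrightarrow> ty i j \<in> {Good, Bad})"

lemma sqrt_100 [simp]: "sqrt 100 = (10::real)"
  using real_sqrt_abs[of 10] by simp

lemma sign_gadget:
  assumes "i < k" "j < k"
  shows "gcost k (\<lambda>i l. s i * kron i l) (\<lambda>_. 0) i j ((a, b), (c, d)) =
    nn k (\<lambda>l. (real_of_rat a - real_of_rat c * s i) * kron i l + (real_of_rat b - real_of_rat d * s j) *
        kron j l)"
  unfolding gcost_def prod.case by (rule nn_cong) (simp add: algebra_simps)

text \<open>For an edge, the two gadgets with first vector (3, 4) cost 6 + 8 = 14 if the signs agree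
  and 0 + 10 if they differ, and the gadgets of length 2 add 4 for each positive sign. This makes 22
  for two positive signs and 14 in the other three cases, on top of 80 from the two forcing pairs. A
  vertex has one forcing pair, of cost 40, and its last gadget, which is compared with the zero
  vector, pads the sum.\<close>

lemma sign_cost:
  assumes ij: "i < k" "j < k" and ok: "diag_ok k ty"
  shows "(\<Sum>g\<leftarrow>base_gadgets D (ty i j). gcost k (\<lambda>i l. sgn_of X i * kron i l) (\<lambda>_. 0) i j g) = 94 + pen D X
      ty i j"
proof (cases "ty i j")
  case Edge
  then have "i \<noteq> j" using ok ij by (auto simp: diag_ok_def)
  then show ?thesis
    by (simp add: Edge pen_def sign_gadget[OF ij] nn_kron2[OF ij] nn_kron1[OF ij(1)] nn_kron1[OF ij(2)]
        of_rat_minus sgn_of_def)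
next
  case Other
  then have "i \<noteq> j" using ok ij by (auto simp: diag_ok_def)
  then show ?thesis
    by (simp add: Other pen_def sign_gadget[OF ij] nn_kron2[OF ij] nn_kron1[OF ij(1)])
next
  case Good
  show ?thesis
    by (simp add: Good pen_def sign_gadget[OF ij] nn_kron1[OF ij(1)] of_rat_minus of_rat_add
        of_rat_divide sgn_of_def)
next
  case Bad
  show ?thesis
    by (simp add: Bad pen_def sign_gadget[OF ij] nn_kron1[OF ij(1)] of_rat_minus of_rat_add of_rat_divide
        sgn_of_def)
qed

text \<open>Here \<open>a\<close> and \<open>b\<close> are the distances of a unit vector to two
  opposite unit vectors, whence the sum of squares 4, and \<open>a\<close> is the smaller one. The
  line \<open>a + b = 2 + a / 2\<close> meets this circle at \<open>a = 0\<close> and at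
  \<open>a = 8 / 5\<close>, and \<open>8 / 5\<close> exceeds the square root of 2.\<close>

lemma force_ineq:
  fixes a b :: real
  assumes "0 \<le> a" "0 \<le> b" "a\<^sup>2 + b\<^sup>2 = 4" "a\<^sup>2 \<le> 2"
  shows "a + b \<ge> 2 + a / 2"
proof (rule ccontr)
  assume "\<not> ?thesis"
  then have b: "b < 2 - a / 2" by simp
  have "b\<^sup>2 < (2 - a / 2)\<^sup>2" using b assms(2) by (intro power_strict_mono) auto
  then have "2 * a < 5 / 4 * a\<^sup>2" using assms(3) by (simp add: power2_eq_square field_simps)
  then have "a * 2 < a * (5 / 4 * a)" by (simp add: power2_eq_square)
  then have "2 < 5 / 4 * a" using assms(1) by (metis mult_less_cancel_left_disj not_less)
  then have "8 / 5 < a" by simp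
  then have "(8 / 5)\<^sup>2 < a\<^sup>2" by (intro power_strict_mono) auto
  then show False using assms(4) by (simp add: power2_eq_square)
qed

text \<open>A unit vector \<open>u\<close> whose distances to \<open>\<plusminus>e\<^sub>i\<close> have a small sum is close to one of them: the
  excess over the minimum \<open>2\<close> of this sum is linear in the smaller distance. This exact penalty
  outweighs what the other gadgets can gain by moving \<open>u\<close> away from \<open>\<plusminus>e\<^sub>i\<close>.\<close>

lemma force:
  assumes i: "i < k" and un: "(\<Sum>l<k. (u l)\<^sup>2) = 1" and s: "s = (if u i \<ge> 0 then 1 else - 1)"
  shows "nn k (\<lambda>l. kron i l - u l) + nn k (\<lambda>l. kron i l + u l) \<ge> 2 + nn k (\<lambda>l. u l - s * kron i l) / 2"
proof -
  let ?a = "nn k (\<lambda>l. kron i l - u l)" and ?b = "nn k (\<lambda>l. kron i l + u l)"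
  have ee: "(\<Sum>l<k. (kron i l)\<^sup>2) = 1" using sum_kron(1)[OF i, of "kron i"] by (simp add: power2_eq_square
      kron_def)
  have a: "?a\<^sup>2 = 2 - 2 * u i"
    unfolding nn_sq power2_diff using ee un sum_kron(1)[OF i, of u]
    by (simp add: sum.distrib sum_subtractf mult.assoc flip: sum_distrib_left)
  have b: "?b\<^sup>2 = 2 + 2 * u i"
    unfolding nn_sq power2_sum using ee un sum_kron(1)[OF i, of u]
    by (simp add: sum.distrib mult.assoc flip: sum_distrib_left)
  show ?thesis
  proof (cases "u i \<ge> 0")
    case True
    have "nn k (\<lambda>l. u l - s * kron i l) = nn k (\<lambda>l. (-1) * (kron i l - u l))"
      by (rule nn_cong) (simp add: s True)
    also have "\<dots> = ?a" unfolding nn_scale by simp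
    finally show ?thesis using force_ineq[of ?a ?b] a b True nn_nonneg by simp
  next
    case False
    have "nn k (\<lambda>l. u l - s * kron i l) = ?b"
      by (rule nn_cong) (simp add: s False)
    then show ?thesis using force_ineq[of ?b ?a] a b False nn_nonneg by simp
  qed
qed

lemma gcost_lipschitz:
  assumes "i < k" "j < k"
  shows "gcost k u (\<lambda>_. 0) i j ((a, b), (c, d)) \<ge>
    gcost k (\<lambda>i l. s i * kron i l) (\<lambda>_. 0) i j ((a, b), (c, d))
     - \<bar>real_of_rat c\<bar> * nn k (\<lambda>l. u i l - s i * kron i l) - \<bar>real_of_rat d\<bar> * nn k (\<lambda>l. u j l - s j *
         kron j l)"
proof -
  let ?x = "\<lambda>l. real_of_rat a * kron i l + real_of_rat b * kron j l - real_of_rat c * u i l - real_of_rat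
      d * u j l - 0"
  let ?y = "\<lambda>l. real_of_rat c * (u i l - s i * kron i l)" and ?z = "\<lambda>l. real_of_rat d * (u j l - s j *
      kron j l)"
  have "gcost k (\<lambda>i l. s i * kron i l) (\<lambda>_. 0) i j ((a, b), (c, d)) = nn k (\<lambda>l. ?x l + (?y l + ?z l))"
    unfolding gcost_def prod.case by (rule nn_cong) (simp add: algebra_simps)
  also have "\<dots> \<le> nn k ?x + (nn k ?y + nn k ?z)"
    by (intro order_trans[OF nn_triangle] add_left_mono nn_triangle)
  finally show ?thesis unfolding nn_scale by (simp add: gcost_def)
qed

lemma gcost_force1:
  "gcost k u (\<lambda>_. 0) i j ((20, 0), (20, 0)) + gcost k u (\<lambda>_. 0) i j ((20, 0), (-20, 0)) =
    20 * (nn k (\<lambda>l. kron i l - u i l) + nn k (\<lambda>l. kron i l + u i l))"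
  using nn_scale[of k 20 "\<lambda>l. kron i l - u i l"] nn_scale[of k 20 "\<lambda>l. kron i l + u i l"]
  by (simp add: gcost_def of_rat_minus algebra_simps)

lemma gcost_force2:
  "gcost k u (\<lambda>_. 0) i j ((0, 20), (0, 20)) + gcost k u (\<lambda>_. 0) i j ((0, 20), (0, -20)) =
    20 * (nn k (\<lambda>l. kron j l - u j l) + nn k (\<lambda>l. kron j l + u j l))"
  using nn_scale[of k 20 "\<lambda>l. kron j l - u j l"] nn_scale[of k 20 "\<lambda>l. kron j l + u j l"]
  by (simp add: gcost_def of_rat_minus algebra_simps)

text \<open>Let \<open>d_i\<close> be the distance of column \<open>i\<close> from its signed unit
  vector. By \<open>force\<close>, a forcing pair of length 20 charges \<open>10 * d_i\<close>. By
  \<open>gcost_lipschitz\<close>, the other gadgets of an edge gain at most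
  \<open>(3 + 3 + 2) * d_i + (4 + 4 + 2) * d_j\<close>, and those of a vertex at most
  \<open>4 * d_i\<close>. The length 20 is just enough for the coefficient 10 of
  \<open>d_j\<close>.\<close>

lemma general_cost:
  assumes ij: "i < k" "j < k" and ok: "diag_ok k ty"
    and un: "\<And>i. i < k \<Longrightarrow> (\<Sum>l<k. (u i l)\<^sup>2) = 1" and X: "X = {i. i < k \<and> u i i \<ge> 0}"
  shows "(\<Sum>g\<leftarrow>base_gadgets D (ty i j). gcost k u (\<lambda>_. 0) i j g) \<ge> 94 + pen D X ty i j"
proof -
  let ?s = "sgn_of X"
  let ?d = "\<lambda>i. nn k (\<lambda>l. u i l - ?s i * kron i l)"
  have fo: "nn k (\<lambda>l. kron i l - u i l) + nn k (\<lambda>l. kron i l + u i l) \<ge> 2 + ?d i / 2" if "i < k" for i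
    using that by (intro force un) (auto simp: sgn_of_def X)
  note li = gcost_lipschitz[OF ij, where s = ?s and u = u]
  have d0: "?d i \<ge> 0" "?d j \<ge> 0" by (simp_all add: nn_nonneg)
  note sc = sign_cost[OF ij ok, where D = D and X = X]
  show ?thesis
  proof (cases "ty i j")
    case Edge
    then have "i \<noteq> j" using ok ij by (auto simp: diag_ok_def)
    show ?thesis
      using gcost_force1[of k u i j] gcost_force2[of k u i j] fo[OF ij(1)] fo[OF ij(2)] d0
        li[where a = 3 and b = 4 and c = 3 and d = "-4"] li[where a = 3 and b = 4 and c = "-3" and d = 4]
            li[where a = 2 and b = 0 and c = "-2" and d = 0] li[where a = 0 and b = 2 and c = 0 and d =
            "-2"] \<open>i \<noteq> j\<close>
      by (cases "i \<in> X"; cases "j \<in> X"; simp add: Edge pen_def sign_gadget[OF ij] nn_kron2[OF ij]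
          nn_kron1[OF ij(1)] nn_kron1[OF ij(2)] of_rat_minus sgn_of_def)
  next
    case Other
    with sc show ?thesis by (simp add: gcost_def)
  next
    case Good
    have "gcost k u (\<lambda>_. 0) i j ((46 + 8 / rat_of_nat D, 0), 0, 0) = 46 + 8 / D"
      using nn_kron1[OF ij(1)] by (simp add: gcost_def of_rat_add of_rat_divide)
    then show ?thesis
      using gcost_force1[of k u i j] fo[OF ij(1)] d0 li[where a = 4 and b = 0 and c = 4 and d = 0]
      by (auto simp: Good pen_def sign_gadget[OF ij] nn_kron1[OF ij(1)] of_rat_minus sgn_of_def)
  next
    case Bad
    have "gcost k u (\<lambda>_. 0) i j ((54 + 8 / rat_of_nat D, 0), 0, 0) = 54 + 8 / D"
      using nn_kron1[OF ij(1)] by (simp add: gcost_def of_rat_add of_rat_divide)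
    then show ?thesis
      using gcost_force1[of k u i j] fo[OF ij(1)] d0 li[where a = 4 and b = 0 and c = "-4" and d = 0]
      by (auto simp: Bad pen_def sign_gadget[OF ij] nn_kron1[OF ij(1)] of_rat_minus sgn_of_def)
  qed
qed

definition total_pen :: "nat \<Rightarrow> nat \<Rightarrow> (nat \<Rightarrow> nat \<Rightarrow> gtype) \<Rightarrow> nat set \<Rightarrow> real" where
  "total_pen D k ty X = (\<Sum>i<k. \<Sum>j<k. pen D X ty i j)"

text \<open>The signs are those of the diagonal of \<open>M\<close>. \<open>gadgets_cost_ge\<close>
  removes the translation, and orthogonality enters through the unit length of the columns, on which
  \<open>general_cost\<close> rests.\<close>

lemma d1_ge:
  assumes M: "M \<in> MO k" and v: "v \<in> carrier_vec k" and ok: "diag_ok k ty"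
  shows "\<exists>X \<subseteq> {..<k}. d1 (real_series (gad_S D k ty)) (transform M v (real_series (gad_T D k ty))) \<ge>
    2 * (94 * real k ^ 2 + total_pen D k ty X)"
proof -
  let ?u = "\<lambda>i l. M $$ (l, i)"
  define X where "X = {i. i < k \<and> ?u i i \<ge> 0}"
  have Mc: "M \<in> carrier_mat k k" and orth: "transpose_mat M * M = 1\<^sub>m k" using M by (auto simp: MO_def)
  have un: "(\<Sum>l<k. (?u i l)\<^sup>2) = 1" if "i < k" for i
  proof -
    have "(\<Sum>l<k. (?u i l)\<^sup>2) = (transpose_mat M * M) $$ (i, i)"
      using Mc that by (auto simp: scalar_prod_def power2_eq_square lessThan_atLeast0)
    then show ?thesis using orth that by simp
  qed
  have "2 * (94 * real k ^ 2 + total_pen D k ty X) = (\<Sum>i<k. \<Sum>j<k. 2 * (94 + pen D X ty i j))"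
    by (simp add: total_pen_def sum.distrib power2_eq_square flip: sum_distrib_left)
  also have "\<dots> \<le> (\<Sum>i<k. \<Sum>j<k. \<Sum>g\<leftarrow>gadgets D (ty i j). gcost k ?u (\<lambda>l. v $ l) i j g)"
  proof (intro sum_mono)
    fix i j assume "i \<in> {..<k}" "j \<in> {..<k}"
    then show "2 * (94 + pen D X ty i j) \<le> (\<Sum>g\<leftarrow>gadgets D (ty i j). gcost k ?u (\<lambda>l. v $ l) i j g)"
      using general_cost[where i = i and k = k and j = j and ty = ty and u = ?u and X = X and D = D] ok
          un X_def gadgets_cost_ge[where k = k and u = ?u and i = i and j = j and D = D and ty = "ty i j"
          and v = "\<lambda>l. v $ l"] by simp
  qed
  finally show ?thesis unfolding d1_gadgets[OF Mc v] by (intro exI[of _ X]) (auto simp: X_def)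
qed

lemma d1_sign:
  assumes ok: "diag_ok k ty"
  shows "\<exists>M \<in> MO k. \<exists>v \<in> carrier_vec k.
    d1 (real_series (gad_S D k ty)) (transform M v (real_series (gad_T D k ty))) =
      2 * (94 * real k ^ 2 + total_pen D k ty X)"
proof -
  let ?M = "mat k k (\<lambda>(l, i). sgn_of X i * kron i l)"
  have ss: "sgn_of X i * sgn_of X i = 1" for i by (simp add: sgn_of_def)
  have tr: "transpose_mat ?M = ?M" by (rule eq_matI) (auto simp: kron_def)
  have "?M * ?M = 1\<^sub>m k"
  proof (rule eq_matI)
    fix i j assume "i < dim_row (1\<^sub>m k :: real mat)" "j < dim_col (1\<^sub>m k :: real mat)"
    then have ij: "i < k" "j < k" by auto
    have "(?M * ?M) $$ (i, j) = (\<Sum>m<k. (sgn_of X m * kron m i * sgn_of X j) * kron j m)"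
      using ij by (simp add: scalar_prod_def lessThan_atLeast0 mult.assoc)
    also have "\<dots> = kron j i" unfolding sum_kron(2)[OF ij(2)] using ss[of j] by (simp add: kron_def)
    finally show "(?M * ?M) $$ (i, j) = 1\<^sub>m k $$ (i, j)" using ij by (simp add: kron_def)
  qed auto
  then have "?M \<in> MO k" using tr by (simp add: MO_def)
  have Mc: "?M \<in> carrier_mat k k" by simp
  have "d1 (real_series (gad_S D k ty)) (transform ?M (0\<^sub>v k) (real_series (gad_T D k ty))) =
     (\<Sum>i<k. \<Sum>j<k. 2 * (94 + pen D X ty i j))"
    unfolding d1_gadgets[OF Mc zero_carrier_vec]
  proof (intro sum.cong refl)
    fix i j assume ij: "i \<in> {..<k}" "j \<in> {..<k}"
    have "gcost k (\<lambda>i l. ?M $$ (l, i)) (\<lambda>l. 0\<^sub>v k $ l) i j g = gcost k (\<lambda>i l. sgn_of X i * kron i l) (\<lambda>_.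
        0) i j g" for g
      unfolding gcost_def using ij by (auto split: prod.splits intro!: nn_cong)
    then show "(\<Sum>g\<leftarrow>gadgets D (ty i j). gcost k (\<lambda>i l. ?M $$ (l, i)) (\<lambda>l. 0\<^sub>v k $ l) i j g) = 2 * (94 +
        pen D X ty i j)"
      using sign_cost[where i = i and k = k and j = j and ty = ty and D = D and X = X] ij ok by (simp
          only: gadgets_cost0) simp
  qed
  also have "\<dots> = 2 * (94 * real k ^ 2 + total_pen D k ty X)"
    by (simp add: total_pen_def sum.distrib power2_eq_square flip: sum_distrib_left)
  finally show ?thesis using \<open>?M \<in> MO k\<close> by (intro bexI[of _ ?M] bexI[of _ "0\<^sub>v k"]) auto
qed

section \<open>From penalties of sign vectors to the congruence distance\<close>

lemma congruence_distance_le: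
  assumes "M \<in> MO k" "v \<in> carrier_vec k"
  shows "congruence_distance k S T \<le> d1 S (transform M v T)"
proof -
  have "bdd_below ((\<lambda>(M, v). d1 S (transform M v T)) ` (MO k \<times> carrier_vec k))"
    by (rule bdd_belowI[of _ 0])
      (auto simp: d1_def euclidean_norm_def scalar_prod_def intro!: sum_nonneg)
  then show ?thesis unfolding congruence_distance_def
    using cINF_lower[of "\<lambda>(M, v). d1 S (transform M v T)" "MO k \<times> carrier_vec k" "(M, v)"] assms by auto
qed

lemma congruence_distance_ge:
  assumes "\<And>M v. M \<in> MO k \<Longrightarrow> v \<in> carrier_vec k \<Longrightarrow> c \<le> d1 S (transform M v T)"
  shows "c \<le> congruence_distance k S T"
proof -
  have "(1\<^sub>m k, 0\<^sub>v k) \<in> MO k \<times> carrier_vec k" by (auto simp: MO_def)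
  then have "MO k \<times> (carrier_vec k :: real vec set) \<noteq> {}" by (metis empty_iff)
  then show ?thesis unfolding congruence_distance_def
  proof (rule cINF_greatest)
    fix x assume "x \<in> MO k \<times> (carrier_vec k :: real vec set)"
    then show "c \<le> (case x of (M, v) \<Rightarrow> d1 S (transform M v T))"
      using assms[of "fst x" "snd x"] by (simp add: case_prod_unfold mem_Times_iff)
  qed
qed

lemma distance_le_pen:
  assumes "diag_ok k ty"
  shows "congruence_distance k (real_series (gad_S D k ty)) (real_series (gad_T D k ty)) \<le>
    2 * (94 * real k ^ 2 + total_pen D k ty X)"
  using d1_sign[OF assms, of D X] congruence_distance_le by metis

lemma distance_ge_pen:
  assumes "diag_ok k ty" "\<And>X. X \<subseteq> {..<k} \<Longrightarrow> c \<le> total_pen D k ty X"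
  shows "2 * (94 * real k ^ 2 + c) \<le>
    congruence_distance k (real_series (gad_S D k ty)) (real_series (gad_T D k ty))"
proof (rule congruence_distance_ge)
  fix M and v :: "real vec" assume "M \<in> MO k" "v \<in> carrier_vec k"
  from d1_ge[OF this assms(1), of D] assms(2) show "2 * (94 * real k ^ 2 + c) \<le>
      d1 (real_series (gad_S D k ty)) (transform M v (real_series (gad_T D k ty)))"
    by (smt (verit))
qed

text \<open>The offset \<open>8 / D\<close> on each of the \<open>N * D\<close> vertices adds up to
  \<open>8 * N\<close>. It normalises the total to 0 for \<open>N\<close> good vertices that come
  without bad vertices and without edges.\<close>

lemma total_pen_card:
  assumes ok: "diag_ok k ty" and k: "k = N * D" and D: "D > 0" and X: "X \<subseteq> {..<k}"
  shows "total_pen D k ty X = 8 * (real (card {(i, j). i \<in> X \<and> j \<in> X \<and> ty i j = Edge}) +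
    real (card {i \<in> X. ty i i = Bad}) - real (card {i \<in> X. ty i i = Good}) + real N)"
proof -
  have fX: "finite X" using X finite_subset by blast
  have p: "pen D X ty i j = 8 * (if (i, j) \<in> {(i, j). i \<in> X \<and> j \<in> X \<and> ty i j = Edge} then 1 else 0) +
     (if i = j then 8 * (if i \<in> {i \<in> X. ty i i = Bad} then 1 else 0)
        - 8 * (if i \<in> {i \<in> X. ty i i = Good} then 1 else 0) + 8 / real D else 0)" if "i < k" "j < k" for i j
  proof -
    have "i = j \<longleftrightarrow> ty i j \<in> {Good, Bad}" using ok that by (auto simp: diag_ok_def)
    then show ?thesis by (cases "ty i j") (auto simp: pen_def)
  qed
  have E: "(\<Sum>i<k. \<Sum>j<k. if (i, j) \<in> A then 1 else (0::real)) = card A" if "A \<subseteq> {..<k} \<times> {..<k}" for A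
  proof -
    have "(\<Sum>i<k. \<Sum>j<k. if (i, j) \<in> A then 1 else (0::real)) = (\<Sum>x\<in>{..<k} \<times> {..<k}. if x \<in> A then 1 else 0)"
      by (simp add: sum.cartesian_product case_prod_unfold)
    also have "\<dots> = (\<Sum>x\<in>({..<k} \<times> {..<k}) \<inter> A. 1)" by (subst sum.inter_restrict) auto
    also have "({..<k} \<times> {..<k}) \<inter> A = A" using that by blast
    finally show ?thesis by simp
  qed
  have B: "(\<Sum>i<k. if i \<in> A then 1 else (0::real)) = card A" if "A \<subseteq> {..<k}" for A
  proof -
    have "(\<Sum>i<k. if i \<in> A then 1 else (0::real)) = (\<Sum>i\<in>{..<k} \<inter> A. 1)" by (subst sum.inter_restrict) auto
    also have "{..<k} \<inter> A = A" using that by blast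
    finally show ?thesis by simp
  qed
  have "total_pen D k ty X = (\<Sum>i<k. \<Sum>j<k. 8 * (if (i, j) \<in> {(i, j). i \<in> X \<and> j \<in> X \<and> ty i j = Edge} then 1
      else 0) +
     (if i = j then 8 * (if i \<in> {i \<in> X. ty i i = Bad} then 1 else 0)
        - 8 * (if i \<in> {i \<in> X. ty i i = Good} then 1 else 0) + 8 / real D else 0))"
    unfolding total_pen_def by (intro sum.cong refl p) auto
  also have "\<dots> = 8 * (\<Sum>i<k. \<Sum>j<k. if (i, j) \<in> {(i, j). i \<in> X \<and> j \<in> X \<and> ty i j = Edge} then 1 else 0) +
     (\<Sum>i<k. 8 * (if i \<in> {i \<in> X. ty i i = Bad} then 1 else 0)
        - 8 * (if i \<in> {i \<in> X. ty i i = Good} then 1 else 0) + 8 / real D)"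
    unfolding sum.distrib sum_distrib_left by (simp add: sum.delta' sum.distrib)
  also have "\<dots> = 8 * real (card {(i, j). i \<in> X \<and> j \<in> X \<and> ty i j = Edge}) +
     (8 * real (card {i \<in> X. ty i i = Bad}) - 8 * real (card {i \<in> X. ty i i = Good}) + k * (8 / real D))"
    unfolding sum.distrib sum_subtractf sum_distrib_left[symmetric]
    by (subst E, use X in blast, subst B, use X in blast, subst B, use X in blast, simp)
  also have "k * (8 / real D) = 8 * real N" using k D by simp
  finally show ?thesis by simp
qed

text \<open>The number \<open>p * D + d\<close> is the vertex for tile \<open>d\<close> at location
  \<open>p\<close>. Each location is a clique and each violated constraint an edge: this is the
  classical graph in which solutions are independent sets of \<open>N\<close> good vertices. An edge
  is entered for one order of its ends only, so that it is counted once.\<close>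

definition csp_ty :: "nat \<Rightarrow> (nat \<Rightarrow> nat \<Rightarrow> bool) \<Rightarrow> (nat \<Rightarrow> nat \<Rightarrow> nat \<Rightarrow> nat \<Rightarrow> bool) \<Rightarrow> nat \<Rightarrow> nat \<Rightarrow> gtype" where
  "csp_ty D good bad i j =
    (if i div D = j div D \<and> i mod D = j mod D then if good (i div D) (i mod D) then Good else Bad
     else if (i div D = j div D \<and> i mod D < j mod D) \<or>
       (i div D < j div D \<and> bad (i div D) (j div D) (i mod D) (j mod D)) then Edge else Other)"

definition csp_sol :: "nat \<Rightarrow> nat \<Rightarrow> (nat \<Rightarrow> nat \<Rightarrow> bool) \<Rightarrow> (nat \<Rightarrow> nat \<Rightarrow> nat \<Rightarrow> nat \<Rightarrow> bool) \<Rightarrow> (nat \<Rightarrow> nat) \<Rightarrow>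
    bool" where
  "csp_sol N D good bad f \<longleftrightarrow> (\<forall>p<N. f p < D \<and> good p (f p)) \<and>
     (\<forall>p p'. p < p' \<and> p' < N \<longrightarrow> \<not> bad p p' (f p) (f p'))"

lemma div_mod_eq: "i div D = j div D \<Longrightarrow> i mod D = j mod D \<Longrightarrow> i = (j::nat)"
  by (metis div_mult_mod_eq)

lemma csp_diag_ok: "diag_ok k (csp_ty D good bad)"
  by (auto simp: diag_ok_def csp_ty_def dest: div_mod_eq)

lemma csp_sat:
  assumes f: "csp_sol N D good bad f" and D: "D > 0"
  shows "congruence_distance (N * D) (real_series (gad_S D (N * D) (csp_ty D good bad)))
    (real_series (gad_T D (N * D) (csp_ty D good bad))) \<le> 188 * real (N * D) ^ 2"
proof -
  let ?ty = "csp_ty D good bad"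
  define h where "h p = p * D + f p" for p
  have h: "h p div D = p" "h p mod D = f p" "h p < N * D" if "p < N" for p
  proof -
    have fp: "f p < D" using f that by (simp add: csp_sol_def)
    then show "h p div D = p" "h p mod D = f p" by (simp_all add: h_def)
    have "h p < Suc p * D" using fp by (simp add: h_def)
    also have "\<dots> \<le> N * D" using that by (intro mult_le_mono1) simp
    finally show "h p < N * D" .
  qed
  define X where "X = h ` {..<N}"
  have X: "X \<subseteq> {..<N * D}" using h(3) by (auto simp: X_def)
  have "inj_on h {..<N}" using h(1) by (intro inj_onI) (metis lessThan_iff)
  then have cX: "card X = N" by (simp add: X_def card_image)
  have E: "{(i, j). i \<in> X \<and> j \<in> X \<and> ?ty i j = Edge} = {}"
    using f h by (auto simp: X_def csp_ty_def csp_sol_def split: if_splits)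
  have g: "?ty i i = Good" if "i \<in> X" for i
    using that f h by (auto simp: X_def csp_ty_def csp_sol_def)
  then have B: "{i \<in> X. ?ty i i = Bad} = {}" and G: "{i \<in> X. ?ty i i = Good} = X" by auto
  have "total_pen D (N * D) ?ty X = 0"
    unfolding total_pen_card[OF csp_diag_ok refl D X] E B G cX by simp
  with distance_le_pen[OF csp_diag_ok[of "N * D" D good bad], where D = D and X = X] show ?thesis by simp
qed

text \<open>A set \<open>X\<close> of vertices gains at most one good vertex per location for free: the minimal good
  vertex \<open>m p\<close> of location \<open>p\<close> forms an edge with every other one.\<close>

lemma csp_unsat:
  assumes nf: "\<nexists>f. csp_sol N D good bad f" and D: "D > 0"
  shows "congruence_distance (N * D) (real_series (gad_S D (N * D) (csp_ty D good bad)))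
    (real_series (gad_T D (N * D) (csp_ty D good bad))) \<ge> 188 * real (N * D) ^ 2 + 16"
proof -
  let ?ty = "csp_ty D good bad"
  have "8 \<le> total_pen D (N * D) ?ty X" if X: "X \<subseteq> {..<N * D}" for X
  proof -
    have fX: "finite X" using X finite_subset by blast
    define E where "E = {(i, j). i \<in> X \<and> j \<in> X \<and> ?ty i j = Edge}"
    have fE: "finite E" by (rule finite_subset[of _ "X \<times> X"]) (auto simp: E_def fX)
    define Gd where "Gd = {i \<in> X. ?ty i i = Good}"
    define P where "P = (\<lambda>i. i div D) ` Gd"
    define m where "m p = Min {i \<in> Gd. i div D = p}" for p
    have fG: "finite Gd" using fX by (simp add: Gd_def)
    have m: "m p \<in> Gd \<and> m p div D = p \<and> (\<forall>i \<in> Gd. i div D = p \<longrightarrow> m p \<le> i)" if "p \<in> P" for p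
    proof -
      have ne: "{i \<in> Gd. i div D = p} \<noteq> {}" and fi: "finite {i \<in> Gd. i div D = p}"
        using that fG by (auto simp: P_def)
      from Min_in[OF fi ne] Min_le[OF fi] show ?thesis by (auto simp: m_def)
    qed
    have PN: "P \<subseteq> {..<N}" using X by (auto simp: P_def Gd_def less_mult_imp_div_less)
    have fP: "finite P" using PN finite_subset by blast
    define E' where "E' = (\<lambda>i. (m (i div D), i)) ` (Gd - m ` P)"
    have E': "E' \<subseteq> {(i, j) \<in> E. i div D = j div D}"
    proof (clarsimp simp: E'_def)
      fix i assume i: "i \<in> Gd" "i \<notin> m ` P"
      then have p: "i div D \<in> P" by (simp add: P_def)
      note mp = m[OF p]
      have "m (i div D) \<noteq> i" using i(2) p by (metis imageI)
      then have lt: "m (i div D) < i" using mp i(1) by (simp add: order_less_le)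
      then have "m (i div D) mod D < i mod D"
        using mp by (metis add_less_cancel_left div_mult_mod_eq)
      then have "?ty (m (i div D)) i = Edge" using mp by (auto simp: csp_ty_def)
      with mp i(1) show "(m (i div D), i) \<in> E \<and> m (i div D) div D = i div D"
        by (auto simp: E_def Gd_def)
    qed
    have cE': "card E' = card (Gd - m ` P)"
      unfolding E'_def by (rule card_image) (auto intro: inj_onI)
    have "inj_on m P" using m by (intro inj_onI) metis
    then have "card (Gd - m ` P) = card Gd - card P"
      using m fP by (subst card_Diff_subset) (auto simp: card_image)
    then have G: "card Gd \<le> card P + card E'" using cE' by simp
    have "card Gd + 1 \<le> N + card E"
    \<comment> \<open>The strict gain of one has two sources. Either some location has no good
      vertex in \<open>X\<close>, or the minimal good vertices form an assignment; this violates a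
      constraint and so yields an edge between two locations, whereas the edges in \<open>E'\<close>
      stay within one.\<close>
    proof (cases "P = {..<N}")
      case False
      then have "card P < N" using PN psubset_card_mono[of "{..<N}" P] by auto
      moreover have "card E' \<le> card E" using E' fE by (intro card_mono) auto
      ultimately show ?thesis using G by simp
    next
      case True
      define f where "f p = m p mod D" for p
      have "f p < D \<and> good p (f p)" if "p < N" for p
        using m[of p] True that D by (auto simp: f_def Gd_def csp_ty_def split: if_splits)
      with nf obtain p p' where p: "p < p'" "p' < N" "bad p p' (f p) (f p')"
        unfolding csp_sol_def by blast
      have mp: "m p \<in> Gd" "m p div D = p" "m p' \<in> Gd" "m p' div D = p'"
        using m[of p] m[of p'] True p by auto
      then have "(m p, m p') \<in> E" using p by (auto simp: E_def csp_ty_def f_def Gd_def)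
      moreover have "(m p, m p') \<notin> E'" using E' mp p by auto
      ultimately have "E' \<subset> E" using E' by auto
      then have "card E' < card E" using fE by (intro psubset_card_mono)
      with G True show ?thesis by simp
    qed
    then have "real (card Gd) + 1 \<le> real N + real (card E)" by linarith
    then show ?thesis
      unfolding total_pen_card[OF csp_diag_ok refl D X] E_def[symmetric] Gd_def[symmetric] by simp
  qed
  from distance_ge_pen[OF csp_diag_ok this] show ?thesis by simp
qed

section \<open>Computations as tilings\<close>

text \<open>The tile of a cell \<open>p\<close> at time \<open>t\<close> contains the state and the symbols read by all heads at
  time \<open>t\<close> (which are the same in the whole row) and, for each tape, the symbol in the cell and
  whether the head is there.\<close>

type_synonym tile = "nat \<times> nat list \<times> nat list \<times> bool list"

definition tiles :: "tm \<Rightarrow> tile set" where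
  "tiles M = {..num_states M} \<times> {r. set r \<subseteq> {..<num_syms M} \<and> length r = num_tapes M} \<times>
     {c. set c \<subseteq> {..<num_syms M} \<and> length c = num_tapes M} \<times> {h. set h \<subseteq> UNIV \<and> length h = num_tapes M}"

lemma finite_tiles: "finite (tiles M)"
  unfolding tiles_def by (intro finite_cartesian_product finite_lists_length_eq) auto

definition tile_list :: "tm \<Rightarrow> tile list" where
  "tile_list M = (SOME ts. set ts = tiles M)"

lemma set_tile_list: "set (tile_list M) = tiles M"
  unfolding tile_list_def by (rule someI_ex) (rule finite_list[OF finite_tiles])

text \<open>In the halting state the configuration is repeated, so that every halting run fills all
  rows.\<close>

definition delta :: "tm \<Rightarrow> nat \<Rightarrow> nat list \<Rightarrow> nat \<times> (nat \<times> move) list" where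
  "delta M q r = (if q < num_states M then trans_fun M q r else (q, map (\<lambda>s. (s, Stay)) r))"

text \<open>Columns are numbered as follows: 1, 2 are the first two and 11 is the last one, 4 is the one
  to the left of cell 0, 5 and 6 carry the given bits 0 and 1, 7 to 10 are the region of the
  certificate (7, 9 for the markers and 8 for the bits of a list, 10 for its end), and 3 is any
  other one. A label is a column number plus 16 (or 32) in all rows but the first (in the last row).\<close>

definition oksym :: "nat \<Rightarrow> nat \<Rightarrow> bool" where
  "oksym c s = (if c = 5 then s = 1 else if c = 6 then s = 2 else if c = 7 then s = 1 \<or> s = 2
     else if c = 8 \<or> c = 9 then s \<le> 2 else s = 0)"

definition ychk :: "nat \<Rightarrow> nat \<Rightarrow> nat \<Rightarrow> bool" where
  "ychk c u s = (if c = 8 then (u = 2 \<longleftrightarrow> s \<noteq> 0) else if c = 9 then (u \<noteq> 0 \<longleftrightarrow> s \<noteq> 0)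
     else if c = 10 then u \<noteq> 2 else True)"

definition okl :: "tm \<Rightarrow> nat \<Rightarrow> tile \<Rightarrow> bool" where
  "okl M v = (\<lambda>(q, r, c, h). (\<forall>j < num_tapes M. h ! j \<longrightarrow> c ! j = r ! j) \<and>
     (v div 16 = 0 \<longrightarrow> q = 0 \<and> (\<forall>j < num_tapes M. 1 \<le> j \<longrightarrow> c ! j = 0) \<and> oksym (v mod 16) (c ! 0) \<and>
        (v mod 16 = 1 \<longrightarrow> (\<forall>j < num_tapes M. \<not> h ! j))))"

text \<open>Relation 2 is the right neighbour; 3, 4 and 5 are the cells to the lower left, below and
  to the lower right. Locations are numbered row by row, so a relation is a difference of numbers,
  and column 1 marks where a difference wraps around into another row. Since all tiles of a row
  share the state and the symbols read, each tile determines the moves of all heads, even of those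
  that are elsewhere. The accepting condition is attached to column 4 because cell 0 is labelled
  like any other given bit.\<close>

definition cross :: "tm \<Rightarrow> nat \<Rightarrow> nat \<Rightarrow> tile \<Rightarrow> nat \<Rightarrow> tile \<Rightarrow> bool" where
  "cross M rel va = (\<lambda>(qa, ra, ca, ha) vb (qb, rb, cb, hb).
     (rel = 2 \<and> vb mod 16 \<noteq> 1 \<longrightarrow> qa = qb \<and> ra = rb \<and>
        (va div 16 = 0 \<longrightarrow> (\<forall>j < num_tapes M. hb ! j = (va mod 16 = 4)) \<and> ychk (vb mod 16) (ca ! 0) (cb ! 0)) \<and>
        (va div 16 = 2 \<and> va mod 16 = 4 \<longrightarrow> qb = num_states M \<and> cb ! 0 = 2)) \<and>
     (rel = 4 \<longrightarrow> qb = fst (delta M qa ra) \<and>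
        (\<forall>j < num_tapes M. cb ! j = (if ha ! j then fst (snd (delta M qa ra) ! j) else ca ! j))) \<and>
     (rel = 3 \<and> va mod 16 \<noteq> 1 \<longrightarrow> (\<forall>j < num_tapes M. snd (snd (delta M qa ra) ! j) = Move_Left \<longrightarrow> hb ! j =
         ha ! j)) \<and>
     (rel = 4 \<longrightarrow> (\<forall>j < num_tapes M. snd (snd (delta M qa ra) ! j) = Stay \<longrightarrow> hb ! j = ha ! j)) \<and>
     (rel = 5 \<and> vb mod 16 \<noteq> 1 \<longrightarrow> (\<forall>j < num_tapes M. snd (snd (delta M qa ra) ! j) = Move_Right \<longrightarrow> hb ! j =
         ha ! j)))"

text \<open>By the last row a head is at most \<open>T + 1\<close> cells away from cell 0, and the
  part of a row in which the tiles are known to be right has lost \<open>T + 1\<close> cells at each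
  border. The \<open>2 * T\<close> padding cells on either side, with the few fixed columns, make
  room for both.\<close>

definition row0 :: "bool list \<Rightarrow> nat \<Rightarrow> nat \<Rightarrow> nat list" where
  "row0 x P T = [1, 2] @ replicate (2 * T) 3 @ [4] @ map (\<lambda>b. if b then 6 else 5) (enc_word x) @ [7] @
     concat (replicate P [8, 9]) @ [10] @ replicate (2 * T) 3 @ [11]"

definition labs :: "nat \<Rightarrow> nat list \<Rightarrow> nat list" where
  "labs T rw = rw @ concat (replicate T (map (\<lambda>v. v + 16) rw)) @ map (\<lambda>v. v + 32) rw"

text \<open>The relation written as a word indexed by the difference of location numbers, with 1 for
  difference 0 and 6 for differences that mean nothing. A program obtains the relation by moving a
  head along this word.\<close>

definition relpos :: "nat \<Rightarrow> nat list" where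
  "relpos W = [1, 2] @ replicate (W - 3) 6 @ [3, 4, 5]"

definition rel :: "nat \<Rightarrow> nat \<Rightarrow> nat" where
  "rel W d = (if d < length (relpos W) then relpos W ! d else 0)"

section \<open>The first row: which words the column labels admit\<close>

fun yok :: "nat \<Rightarrow> nat list \<Rightarrow> nat list \<Rightarrow> bool" where
  "yok u [] [] = True"
| "yok u (c # cs) (s # ss) = (oksym c s \<and> ychk c u s \<and> yok s cs ss)"
| "yok u _ _ = False"

lemma yok_Nil [simp]: "yok u [] ss \<longleftrightarrow> ss = []"
  by (cases ss) auto

lemma yok_nth:
  "yok u cs ss \<longleftrightarrow> length cs = length ss \<and>
    (\<forall>p < length cs. oksym (cs ! p) (ss ! p) \<and> ychk (cs ! p) (if p = 0 then u else ss ! (p - 1)) (ss ! p))"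
proof (induction u cs ss rule: yok.induct)
  case (2 u c cs s ss)
  have all: "(\<forall>p < Suc n. Q p) \<longleftrightarrow> Q 0 \<and> (\<forall>p < n. Q (Suc p))" for n and Q :: "nat \<Rightarrow> bool"
    by (metis less_Suc_eq_0_disj)
  have "(if p = 0 then s else ss ! (p - 1)) = (s # ss) ! p" for p by (cases p) auto
  with 2 show ?case by (auto simp: all)
qed auto

lemma yok_append:
  "yok u (cs @ ds) ss \<longleftrightarrow> (\<exists>s1 s2. ss = s1 @ s2 \<and> yok u cs s1 \<and> yok (last (u # s1)) ds s2)"
proof (induction cs arbitrary: u ss)
  case Nil
  then show ?case by auto
next
  case (Cons c cs)
  show ?case
  proof (cases ss)
    case (Cons s ss')
    have "(\<exists>s1 s2. ss = s1 @ s2 \<and> yok u (c # cs) s1 \<and> yok (last (u # s1)) ds s2) \<longleftrightarrow> oksym c s \<and> ychk c u s \<and>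
      (\<exists>t1 s2. ss' = t1 @ s2 \<and> yok s cs t1 \<and> yok (last (s # t1)) ds s2)" (is "?L \<longleftrightarrow> ?R")
    proof
      assume ?L
      then obtain s1 s2 where 1: "ss = s1 @ s2" "yok u (c # cs) s1" "yok (last (u # s1)) ds s2" by blast
      have "s1 \<noteq> []" using 1(2) by auto
      then obtain t t1 where s1: "s1 = t # t1" by (meson neq_Nil_conv)
      have "t = s" "ss' = t1 @ s2" using 1(1) unfolding s1 \<open>ss = s # ss'\<close> by simp_all
      with 1(2,3) show ?R unfolding s1 by (simp only: yok.simps last_ConsR list.simps simp_thms) blast
    next
      assume ?R
      then obtain t1 s2 where 1: "oksym c s" "ychk c u s" "ss' = t1 @ s2" "yok s cs t1" "yok (last (s #
          t1)) ds s2" by blast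
      then have "ss = (s # t1) @ s2 \<and> yok u (c # cs) (s # t1) \<and> yok (last (u # s # t1)) ds s2"
        unfolding \<open>ss = s # ss'\<close> by simp
      then show ?L by blast
    qed
    then show ?thesis unfolding \<open>ss = s # ss'\<close> by (simp add: Cons.IH)
  next
    case Nil
    then show ?thesis by auto
  qed
qed

lemma yok_pad: "c \<notin> {5,6,7,8,9,10} \<Longrightarrow> yok u (replicate n c) ss \<longleftrightarrow> ss = replicate n 0"
proof (induction n arbitrary: u ss)
  case (Suc n)
  then show ?case by (cases ss) (auto simp: oksym_def ychk_def)
qed simp

lemma yok_given: "yok u (map (\<lambda>b. if b then 6 else 5) w) ss \<longleftrightarrow> ss = map bit_sym w"
proof (induction w arbitrary: u ss)
  case (Cons b w)
  then show ?case by (cases ss) (auto simp: oksym_def ychk_def bit_sym_def)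
qed simp

lemma enc_word_simps: "enc_word [] = [False]" "enc_word (b # y) = True # b # enc_word y"
  by (simp_all add: enc_word_def)

lemma length_enc_word: "length (enc_word x) = 2 * length x + 1"
  by (induction x) (auto simp: enc_word_simps)

text \<open>Here \<open>u\<close> is the marker just before the region. If it is 2, a bit
  \<open>b\<close> and the code of the remaining list \<open>y\<close> follow, whence
  \<open>y\<close> is shorter than \<open>P\<close>; otherwise the list has ended and all is blank.
  The induction removes one pair of columns.\<close>

lemma yok_certificate:
  "u \<le> 2 \<Longrightarrow> yok u (concat (replicate P [8, 9]) @ [10]) ss \<longleftrightarrow>
    (if u = 2 then \<exists>b y n. length y < P \<and> ss = bit_sym b # map bit_sym (enc_word y) @ replicate n 0 \<and>
        length ss = 2 * P + 1
     else ss = replicate (2 * P + 1) 0)"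
proof (induction P arbitrary: u ss)
  case 0
  then show ?case by (cases ss rule: list.exhaust[case_names Nil Cons]; cases "tl ss")
      (auto simp: oksym_def ychk_def)
next
  case (Suc P)
  show ?case
  proof (cases "\<exists>s1 s2 ss'. ss = s1 # s2 # ss'")
    case False
    then have "ss = [] \<or> (\<exists>s. ss = [s])" by (cases ss; cases "tl ss") auto
    then show ?thesis by auto
  next
    case True
    then obtain s1 s2 ss' where ss: "ss = s1 # s2 # ss'" by blast
    show ?thesis
    proof (cases "u = 2")
      case False
      then show ?thesis using Suc.IH[of 0 ss'] Suc.IH[of s2 ss'] Suc.prems unfolding ss
        by (auto simp: oksym_def ychk_def)
    next
      case True
      have "yok u (concat (replicate (Suc P) [8, 9]) @ [10]) ss \<longleftrightarrow>
        (s1 = 1 \<or> s1 = 2) \<and> (s2 = 1 \<or> s2 = 2) \<and> yok s2 (concat (replicate P [8, 9]) @ [10]) ss'"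
        unfolding ss True by (auto simp: oksym_def ychk_def)
      also have "\<dots> \<longleftrightarrow> (s1 = 1 \<or> s1 = 2) \<and> (s2 = 1 \<and> ss' = replicate (2 * P + 1) 0 \<or>
         s2 = 2 \<and> (\<exists>b y n. length y < P \<and> ss' = bit_sym b # map bit_sym (enc_word y) @ replicate n 0 \<and>
             length ss' = 2 * P + 1))"
      proof -
        have "yok 1 (concat (replicate P [8, 9]) @ [10]) ss' \<longleftrightarrow> ss' = replicate (2 * P + 1) 0"
          using Suc.IH[of 1 ss'] by simp
        moreover have "yok 2 (concat (replicate P [8, 9]) @ [10]) ss' \<longleftrightarrow>
          (\<exists>b y n. length y < P \<and> ss' = bit_sym b # map bit_sym (enc_word y) @ replicate n 0 \<and> length ss'
              = 2 * P + 1)"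
          using Suc.IH[of 2 ss'] by (simp only: order_refl if_True simp_thms)
        ultimately show ?thesis by metis
      qed
      also have "\<dots> \<longleftrightarrow> (\<exists>b y n. length y < Suc P \<and> ss = bit_sym b # map bit_sym (enc_word y) @ replicate n 0 \<and>
          length ss = 2 * Suc P + 1)"
      proof (intro iffI; elim conjE exE disjE)
        show "\<exists>b y n. length y < Suc P \<and> ss = bit_sym b # map bit_sym (enc_word y) @ replicate n 0 \<and>
            length ss = 2 * Suc P + 1"
          if "s1 = 1" "s2 = 1" "ss' = replicate (2 * P + 1) 0"
          using that ss by (intro exI[of _ False] exI[of _ "[]"] exI[of _ "2 * P + 1"]) (auto simp:
              enc_word_simps bit_sym_def)
        show "\<exists>b y n. length y < Suc P \<and> ss = bit_sym b # map bit_sym (enc_word y) @ replicate n 0 \<and>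
            length ss = 2 * Suc P + 1"
          if "s1 = 2" "s2 = 1" "ss' = replicate (2 * P + 1) 0"
          using that ss by (intro exI[of _ True] exI[of _ "[]"] exI[of _ "2 * P + 1"]) (auto simp:
              enc_word_simps bit_sym_def)
        show "\<exists>b y n. length y < Suc P \<and> ss = bit_sym b # map bit_sym (enc_word y) @ replicate n 0 \<and>
            length ss = 2 * Suc P + 1"
          if "s1 = 1" "s2 = 2" "length y < P" "ss' = bit_sym b # map bit_sym (enc_word y) @ replicate n
              0" "length ss' = 2 * P + 1" for b y n
          using that ss by (intro exI[of _ False] exI[of _ "b # y"] exI[of _ n]) (auto simp:
              enc_word_simps bit_sym_def)
        show "\<exists>b y n. length y < Suc P \<and> ss = bit_sym b # map bit_sym (enc_word y) @ replicate n 0 \<and>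
            length ss = 2 * Suc P + 1"
          if "s1 = 2" "s2 = 2" "length y < P" "ss' = bit_sym b # map bit_sym (enc_word y) @ replicate n
              0" "length ss' = 2 * P + 1" for b y n
          using that ss by (intro exI[of _ True] exI[of _ "b # y"] exI[of _ n]) (auto simp:
              enc_word_simps bit_sym_def)
        fix b y n assume y: "length y < Suc P" and s: "ss = bit_sym b # map bit_sym (enc_word y) @
            replicate n 0"
          and l: "length ss = 2 * Suc P + 1"
        have s1: "s1 = 1 \<or> s1 = 2" using s ss by (auto simp: bit_sym_def)
        show "(s1 = 1 \<or> s1 = 2) \<and> (s2 = 1 \<and> ss' = replicate (2 * P + 1) 0 \<or>
         s2 = 2 \<and> (\<exists>b y n. length y < P \<and> ss' = bit_sym b # map bit_sym (enc_word y) @ replicate n 0 \<and>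
             length ss' = 2 * P + 1))"
        proof (cases y)
          case Nil
          then have "s2 = 1" "ss' = replicate n 0" using s ss by (auto simp: enc_word_simps bit_sym_def)
          moreover from this l ss have "n = 2 * P + 1" by simp
          ultimately show ?thesis using s1 by simp
        next
          case (Cons b' y')
          then have "s2 = 2" "ss' = bit_sym b' # map bit_sym (enc_word y') @ replicate n 0"
            using s ss by (auto simp: enc_word_simps bit_sym_def)
          moreover have "length ss' = 2 * P + 1" using l ss by simp
          ultimately show ?thesis using s1 y Cons by auto
        qed
      qed
      finally show ?thesis using True by simp
    qed
  qed
qed

lemma bit_sym_True: "bit_sym True = 2" "bit_sym False = 1"
  by (simp_all add: bit_sym_def)

lemma length_row0: "length (row0 x P T) = 4 * T + 4 + length (enc_word x) + (2 * P + 2)"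
  by (simp add: row0_def length_concat sum_list_replicate)

text \<open>The row falls into independent segments: only the columns 8, 9 and 10 look at their left
  neighbour, and the first of them is preceded by column 7, which belongs to the certificate as
  well.\<close>

lemma yok_row0:
  "yok 0 (row0 x P T) ss \<longleftrightarrow> (\<exists>y n. length y \<le> P \<and>
     ss = replicate (2 * T + 3) 0 @ map bit_sym (enc_word x @ enc_word y) @ replicate n 0 \<and>
     length ss = length (row0 x P T))"
proof -
  let ?Y = "[7] @ concat (replicate P [8, 9]) @ [10]"
  have p0: "[1, 2] @ replicate (2 * T) 3 @ [4] @ r = (([1] @ [2]) @ (replicate (2 * T) 3 @ [4])) @ r" for
      r :: "nat list"
    by simp
  have one: "yok u [c] ss \<longleftrightarrow> (\<exists>s. ss = [s] \<and> oksym c s \<and> ychk c u s)" for u c ss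
    by (cases ss; cases "tl ss") auto
  have pre: "yok u (([1] @ [2]) @ (replicate (2 * T) 3 @ [4])) ss \<longleftrightarrow> ss = replicate (2 * T + 3) 0" for u ss
  proof -
    have "yok u (([1] @ [2]) @ (replicate (2 * T) 3 @ [4])) ss \<longleftrightarrow>
      ss = ([0] @ [0]) @ (replicate (2 * T) 0 @ [0])"
      unfolding yok_append one by (auto simp: yok_pad oksym_def ychk_def)
    also have "([0] @ [0]) @ (replicate (2 * T) 0 @ [0]) = replicate (2 * T + 3) (0::nat)"
      by (simp add: replicate_append_same flip: replicate_Suc)
    finally show ?thesis .
  qed
  have suf: "yok u (replicate (2 * T) 3 @ [11]) ss \<longleftrightarrow> ss = replicate (2 * T + 1) 0" for u ss
    unfolding yok_append one by (auto simp: yok_pad oksym_def ychk_def replicate_append_same)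
  have Y: "yok u ?Y ss \<longleftrightarrow> (\<exists>y n. length y \<le> P \<and> ss = map bit_sym (enc_word y) @ replicate n 0 \<and> length ss
      = 2 * P + 2)"
    for u ss
  proof (cases ss)
    case (Cons s ss')
    have "yok u ?Y ss \<longleftrightarrow> (s = 1 \<or> s = 2) \<and> yok s (concat (replicate P [8, 9]) @ [10]) ss'"
      unfolding Cons by (auto simp: oksym_def ychk_def)
    also have "\<dots> \<longleftrightarrow> s = 1 \<and> ss' = replicate (2 * P + 1) 0 \<or> s = 2 \<and>
      (\<exists>b y n. length y < P \<and> ss' = bit_sym b # map bit_sym (enc_word y) @ replicate n 0 \<and> length ss' = 2
          * P + 1)"
    proof -
      have "yok 1 (concat (replicate P [8, 9]) @ [10]) ss' \<longleftrightarrow> ss' = replicate (2 * P + 1) 0"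
        using yok_certificate[of 1 P ss'] by simp
      moreover have "yok 2 (concat (replicate P [8, 9]) @ [10]) ss' \<longleftrightarrow>
        (\<exists>b y n. length y < P \<and> ss' = bit_sym b # map bit_sym (enc_word y) @ replicate n 0 \<and> length ss' =
            2 * P + 1)"
        using yok_certificate[of 2 P ss'] by (simp only: order_refl if_True simp_thms)
      ultimately show ?thesis by metis
    qed
    also have "\<dots> \<longleftrightarrow> (\<exists>y n. length y \<le> P \<and> ss = map bit_sym (enc_word y) @ replicate n 0 \<and> length ss = 2 *
        P + 2)"
    proof (intro iffI; elim disjE conjE exE)
      assume "s = 1" "ss' = replicate (2 * P + 1) 0"
      then show "\<exists>y n. length y \<le> P \<and> ss = map bit_sym (enc_word y) @ replicate n 0 \<and> length ss = 2 * P + 2"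
        using Cons by (intro exI[of _ "[]"] exI[of _ "2 * P + 1"]) (auto simp: enc_word_simps bit_sym_True)
    next
      fix b y n assume "s = 2" "length y < P" "ss' = bit_sym b # map bit_sym (enc_word y) @ replicate n
          0" "length ss' = 2 * P + 1"
      then show "\<exists>y n. length y \<le> P \<and> ss = map bit_sym (enc_word y) @ replicate n 0 \<and> length ss = 2 * P + 2"
        using Cons by (intro exI[of _ "b # y"] exI[of _ n]) (auto simp: enc_word_simps bit_sym_True)
    next
      fix y n assume y: "length y \<le> P" "ss = map bit_sym (enc_word y) @ replicate n 0" "length ss = 2 * P + 2"
      show "s = 1 \<and> ss' = replicate (2 * P + 1) 0 \<or> s = 2 \<and>
        (\<exists>b y n. length y < P \<and> ss' = bit_sym b # map bit_sym (enc_word y) @ replicate n 0 \<and> length ss' =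
            2 * P + 1)"
      proof (cases y)
        case Nil
        then have "s = 1" "ss' = replicate n 0" using y Cons by (auto simp: enc_word_simps bit_sym_True)
        moreover from this y Cons have "n = 2 * P + 1" by simp
        ultimately show ?thesis by simp
      next
        case (Cons b y')
        then have "s = 2" "ss' = bit_sym b # map bit_sym (enc_word y') @ replicate n 0"
          using y \<open>ss = s # ss'\<close> by (auto simp: enc_word_simps bit_sym_True)
        moreover have "length ss' = 2 * P + 1" using y(3) unfolding \<open>ss = s # ss'\<close> by simp
        moreover have "length y' < P" using y(1) Cons by simp
        ultimately show ?thesis by blast
      qed
    qed
    finally show ?thesis .
  qed auto
  have R: "row0 x P T = (([1] @ [2]) @ (replicate (2 * T) 3 @ [4])) @
     (map (\<lambda>b. if b then 6 else 5) (enc_word x) @ (?Y @ (replicate (2 * T) 3 @ [11])))"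
    by (simp add: row0_def)
  have "yok 0 (row0 x P T) ss \<longleftrightarrow> (\<exists>s3. ss = replicate (2 * T + 3) 0 @ map bit_sym (enc_word x) @ s3 @
      replicate (2 * T + 1) 0 \<and>
     (\<exists>y n. length y \<le> P \<and> s3 = map bit_sym (enc_word y) @ replicate n 0 \<and> length s3 = 2 * P + 2))"
    unfolding R yok_append[of _ "(([1] @ [2]) @ (replicate (2 * T) 3 @ [4]))"]
      yok_append[of _ "map (\<lambda>b. if b then 6 else 5) (enc_word x)"] yok_append[of _ ?Y] pre yok_given suf
          Y by blast
  also have "\<dots> \<longleftrightarrow> (\<exists>y n. length y \<le> P \<and>
     ss = replicate (2 * T + 3) 0 @ map bit_sym (enc_word x @ enc_word y) @ replicate n 0 \<and>
     length ss = length (row0 x P T))"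
  proof (intro iffI; elim exE conjE)
    fix s3 y n assume "ss = replicate (2 * T + 3) 0 @ map bit_sym (enc_word x) @ s3 @ replicate (2 * T + 1) 0"
      "length y \<le> P" "s3 = map bit_sym (enc_word y) @ replicate n 0" "length s3 = 2 * P + 2"
    then show "\<exists>y n. length y \<le> P \<and>
     ss = replicate (2 * T + 3) 0 @ map bit_sym (enc_word x @ enc_word y) @ replicate n 0 \<and>
     length ss = length (row0 x P T)"
      by (intro exI[of _ y] exI[of _ "n + (2 * T + 1)"]) (auto simp: replicate_add length_row0
          replicate_app_Cons_same replicate_append_same)
  next
    fix y n assume a: "length y \<le> P"
      "ss = replicate (2 * T + 3) 0 @ map bit_sym (enc_word x @ enc_word y) @ replicate n 0"
      "length ss = length (row0 x P T)"
    then have "2 * P + 2 + (2 * T + 1) = length (enc_word y) + n" by (simp add: length_row0)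
    then have n: "n = (2 * P + 2 - length (enc_word y)) + (2 * T + 1)" and "length (enc_word y) \<le> 2 * P + 2"
      using a(1) by (auto simp: length_enc_word)
    then show "\<exists>s3. ss = replicate (2 * T + 3) 0 @ map bit_sym (enc_word x) @ s3 @ replicate (2 * T + 1) 0 \<and>
     (\<exists>y n. length y \<le> P \<and> s3 = map bit_sym (enc_word y) @ replicate n 0 \<and> length s3 = 2 * P + 2)"
      using a(1) unfolding a(2) n replicate_add
      by (intro exI[of _ "map bit_sym (enc_word y) @ replicate (2 * P + 2 - length (enc_word y)) 0"]) auto
  qed
  finally show ?thesis .
qed

definition tile_good :: "tm \<Rightarrow> nat list \<Rightarrow> nat \<Rightarrow> nat \<Rightarrow> bool" where
  "tile_good M lb p d = okl M (lb ! p) (tile_list M ! d)"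

definition tile_bad :: "tm \<Rightarrow> nat \<Rightarrow> nat list \<Rightarrow> nat \<Rightarrow> nat \<Rightarrow> nat \<Rightarrow> nat \<Rightarrow> bool" where
  "tile_bad M W lb p p' d d' \<longleftrightarrow>
     \<not> cross M (rel W (p' - p)) (lb ! p) (tile_list M ! d) (lb ! p') (tile_list M ! d')"

lemma row0_bound: "p < length (row0 x P T) \<Longrightarrow> row0 x P T ! p < 16"
proof -
  have "\<forall>v \<in> set (row0 x P T). v < 16" by (auto simp: row0_def)
  then show "p < length (row0 x P T) \<Longrightarrow> row0 x P T ! p < 16" by (meson nth_mem)
qed

lemma row0_0: "row0 x P T ! p = 1 \<longleftrightarrow> p = 0" if "p < length (row0 x P T)"
proof (cases p)
  case 0
  then show ?thesis by (simp add: row0_def)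
next
  case (Suc p')
  let ?r = "[2] @ replicate (2 * T) 3 @ [4] @ map (\<lambda>b. if b then 6 else 5) (enc_word x) @ [7] @
     concat (replicate P [8, 9]) @ [10] @ replicate (2 * T) 3 @ [11 :: nat]"
  have "row0 x P T = 1 # ?r" by (simp add: row0_def)
  moreover have "\<forall>v \<in> set ?r. v \<noteq> 1" by auto
  moreover have "p' < length ?r" using that Suc by (simp add: row0_def)
  ultimately show ?thesis unfolding Suc by (metis nat.distinct(1) nth_Cons_Suc nth_mem)
qed

lemma row0_4: "row0 x P T ! p = 4 \<longleftrightarrow> p = 2 * T + 2" if "p < length (row0 x P T)"
proof -
  let ?a = "[1, 2] @ replicate (2 * T) (3 :: nat)"
  let ?b = "map (\<lambda>b. if b then 6 else 5) (enc_word x) @ [7] @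
     concat (replicate P [8, 9]) @ [10] @ replicate (2 * T) 3 @ [11 :: nat]"
  have r: "row0 x P T = ?a @ 4 # ?b" by (simp add: row0_def)
  have a: "\<forall>v \<in> set ?a. v \<noteq> 4" and b: "\<forall>v \<in> set ?b. v \<noteq> 4" by auto
  have la: "length ?a = 2 * T + 2" by simp
  consider "p < 2 * T + 2" | "p = 2 * T + 2" | p' where "p = 2 * T + 2 + Suc p'"
    by (metis less_imp_Suc_add linorder_neqE_nat add_Suc_right)
  then show ?thesis
  proof cases
    case 1
    then have "row0 x P T ! p = ?a ! p" unfolding r nth_append la by simp
    moreover have "?a ! p \<in> set ?a" using 1 la by (metis nth_mem)
    ultimately show ?thesis using a 1 by (metis nat_neq_iff)
  next
    case 2
    then show ?thesis unfolding r by (metis la nth_append_length)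
  next
    case 3
    then have "row0 x P T ! p = ?b ! p'"
      unfolding r 3 la[symmetric] nth_append_length_plus by (simp only: nth_Cons_Suc)
    moreover have "p' < length ?b" using that 3 unfolding r length_append la by simp
    then have "?b ! p' \<in> set ?b" by (metis nth_mem)
    ultimately show ?thesis using b 3 by (metis add_Suc_right nat_neq_iff less_add_Suc1)
  qed
qed

definition lrow :: "nat \<Rightarrow> nat \<Rightarrow> nat" where
  "lrow T t = (if t = 0 then 0 else if t \<le> T then 1 else 2)"

lemma concat_replicate_nth: "t < n \<Longrightarrow> p < length xs \<Longrightarrow> concat (replicate n xs) ! (t * length xs + p) = xs ! p"
proof (induction n arbitrary: t)
  case (Suc n)
  then show ?case by (cases t) (simp_all add: nth_append)
qed simp

lemma labs_nth:
  assumes "t < T + 2" "p < length rw"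
  shows "labs T rw ! (t * length rw + p) = rw ! p + 16 * lrow T t"
proof -
  let ?W = "length rw"
  consider "t = 0" | t' where "t = Suc t'" "t' < T" | "t = Suc T"
    using assms(1) by (metis Suc_less_eq add_2_eq_Suc' less_antisym not0_implies_Suc)
  then show ?thesis
  proof cases
    case 1
    then show ?thesis using assms(2) by (simp add: labs_def lrow_def nth_append)
  next
    case 2
    have "t' * ?W + p < T * ?W"
    proof -
      have "t' * ?W + p < Suc t' * ?W" using assms(2) by simp
      also have "\<dots> \<le> T * ?W" using 2 by (intro mult_le_mono1) simp
      finally show ?thesis .
    qed
    then show ?thesis using 2 assms(2) concat_replicate_nth[of t' T p "map (\<lambda>v. v + 16) rw"]
      by (simp add: labs_def lrow_def nth_append length_concat sum_list_replicate add.assoc)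
  next
    case 3
    then show ?thesis using assms(2)
      by (simp add: labs_def lrow_def nth_append length_concat sum_list_replicate add.assoc)
  qed
qed

lemma length_labs: "length (labs T rw) = (T + 2) * length rw"
  by (simp add: labs_def length_concat sum_list_replicate)

lemma rel_simps:
  assumes "W \<ge> 4"
  shows "rel W d = 2 \<longleftrightarrow> d = 1" "rel W d = 3 \<longleftrightarrow> d = W - 1" "rel W d = 4 \<longleftrightarrow> d = W" "rel W d = 5 \<longleftrightarrow> d = W + 1"
proof -
  have "rel W d = (if d = 0 then 1 else if d = 1 then 2 else if d < W - 1 then 6 else if d = W - 1 then 3
     else if d = W then 4 else if d = W + 1 then 5 else 0)"
  proof -
    obtain n where n: "W = n + 3" using that[of "W - 3"] assms by simp
    have "n \<ge> 1" using n assms by simp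
    show ?thesis
    proof (cases "d < 2")
      case True
      then show ?thesis using n by (cases "d = 0") (auto simp: rel_def relpos_def less_2_cases_iff)
    next
      case False
      then obtain d' where d: "d = Suc (Suc d')" by (metis add_2_eq_Suc le_Suc_ex not_less)
      consider "d' < n" | "d' = n" | "d' = Suc n" | "d' = Suc (Suc n)" | "d' > Suc (Suc n)" by linarith
      then show ?thesis using \<open>n \<ge> 1\<close> by cases (simp_all add: rel_def relpos_def n d nth_append)
    qed
  qed
  then show "rel W d = 2 \<longleftrightarrow> d = 1" "rel W d = 3 \<longleftrightarrow> d = W - 1" "rel W d = 4 \<longleftrightarrow> d = W" "rel W d = 5 \<longleftrightarrow> d = W + 1"
    using assms by auto
qed

lemma step_delta:
  assumes "length tps = num_tapes M"
  shows "step M (q, tps) = (fst (delta M q (map (\<lambda>tp. fst tp (snd tp)) tps)),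
     map2 act (snd (delta M q (map (\<lambda>tp. fst tp (snd tp)) tps))) tps)"
proof (cases "q < num_states M")
  case False
  have "map2 act (map (\<lambda>s. (s, Stay)) (map (\<lambda>tp. fst tp (snd tp)) tps)) tps = tps"
    by (rule nth_equalityI) auto
  with False show ?thesis by (simp add: delta_def)
next
  case True
  show ?thesis unfolding step_running[OF True refl] using True by (simp add: delta_def)
qed

lemma length_delta:
  assumes "wf_tm M" "vcfg M (q, tps)"
  shows "length (snd (delta M q (map (\<lambda>tp. fst tp (snd tp)) tps))) = num_tapes M"
  using assms wf_tmD(2)[OF assms(1) _ vcfg_reads[OF assms(2)]] by (auto simp: delta_def vcfg_def)

lemma div_mod_mult_add: "p < w \<Longrightarrow> (t * w + p) div w = t \<and> (t * w + p) mod w = (p :: nat)"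
  by simp

section \<open>Correct tilings are the accepting runs on some certificate\<close>

locale tiling =
  fixes M :: tm and x :: "bool list" and P T :: nat
  assumes wf: "wf_tm M"
begin

abbreviation rw :: "nat list" where
  "rw \<equiv> row0 x P T"

abbreviation W :: nat where
  "W \<equiv> length (row0 x P T)"

abbreviation sol :: "(nat \<Rightarrow> nat) \<Rightarrow> bool" where
  "sol \<equiv> csp_sol ((T + 2) * W) (length (tile_list M)) (tile_good M (labs T rw)) (tile_bad M W (labs T rw))"

abbreviation cell :: "nat \<Rightarrow> int" where
  "cell p \<equiv> int p - (2 * int T + 3)"

definition cfg :: "bool list \<Rightarrow> nat \<Rightarrow> config" where
  "cfg y t = (step M ^^ t) (init_config M (enc_word x @ enc_word y))"

definition dl :: "bool list \<Rightarrow> nat \<Rightarrow> nat \<times> (nat \<times> move) list" where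
  "dl y t = delta M (fst (cfg y t)) (map (\<lambda>tp. fst tp (snd tp)) (snd (cfg y t)))"

definition C :: "bool list \<Rightarrow> nat \<Rightarrow> nat \<Rightarrow> nat \<Rightarrow> nat" where
  "C y t p j = fst (snd (cfg y t) ! j) (cell p)"

definition H :: "bool list \<Rightarrow> nat \<Rightarrow> nat \<Rightarrow> nat \<Rightarrow> bool" where
  "H y t p j \<longleftrightarrow> snd (snd (cfg y t) ! j) = cell p"

definition real_tile :: "bool list \<Rightarrow> nat \<Rightarrow> nat \<Rightarrow> tile" where
  "real_tile y t p = (fst (cfg y t), map (\<lambda>tp. fst tp (snd tp)) (snd (cfg y t)),
     map (C y t p) [0..<num_tapes M], map (H y t p) [0..<num_tapes M])"

lemma vcfg_cfg: "vcfg M (cfg y t)"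
  unfolding cfg_def by (induction t) (simp_all add: vcfg_init[OF wf] vcfg_step[OF wf])

lemma length_tapes: "length (snd (cfg y t)) = num_tapes M" "num_tapes M \<ge> 1"
  using vcfg_cfg[of y t] wf by (simp_all add: vcfg_def wf_tm_def)

lemma cfg_Suc:
  "fst (cfg y (Suc t)) = fst (dl y t)"
  "j < num_tapes M \<Longrightarrow> snd (cfg y (Suc t)) ! j = act (snd (dl y t) ! j) (snd (cfg y t) ! j)"
proof -
  obtain q tps where c: "cfg y t = (q, tps)" by fastforce
  have v: "vcfg M (q, tps)" using vcfg_cfg[of y t] c by simp
  have "cfg y (Suc t) = step M (q, tps)" using c by (simp add: cfg_def)
  also have "\<dots> = (fst (dl y t), map2 act (snd (dl y t)) tps)"
    using step_delta[of tps M q] v by (simp add: dl_def c vcfg_def)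
  finally have s: "cfg y (Suc t) = (fst (dl y t), map2 act (snd (dl y t)) tps)" .
  have "length (snd (dl y t)) = num_tapes M" using length_delta[OF wf v] by (simp add: dl_def c)
  then show "fst (cfg y (Suc t)) = fst (dl y t)"
    "j < num_tapes M \<Longrightarrow> snd (cfg y (Suc t)) ! j = act (snd (dl y t) ! j) (snd (cfg y t) ! j)"
    using s c v by (auto simp: vcfg_def)
qed

lemma C_Suc: "j < num_tapes M \<Longrightarrow> C y (Suc t) p j = (if H y t p j then fst (snd (dl y t) ! j) else C y t p j)"
  unfolding C_def H_def cfg_Suc by (cases "snd (dl y t) ! j"; cases "snd (cfg y t) ! j") (auto simp:
      fun_upd_apply)

lemma head_Suc: "j < num_tapes M \<Longrightarrow>
    snd (snd (cfg y (Suc t)) ! j) = snd (snd (cfg y t) ! j) + offset (snd (snd (dl y t) ! j))"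
  unfolding cfg_Suc by (cases "snd (dl y t) ! j"; cases "snd (cfg y t) ! j") auto

lemma H_Suc:
  assumes "j < num_tapes M"
  shows "snd (snd (dl y t) ! j) = Move_Left \<Longrightarrow> H y (Suc t) p j = H y t (Suc p) j"
    "snd (snd (dl y t) ! j) = Stay \<Longrightarrow> H y (Suc t) p j = H y t p j"
    "snd (snd (dl y t) ! j) = Move_Right \<Longrightarrow> H y (Suc t) (Suc p) j = H y t p j"
  using assms by (auto simp: H_def head_Suc)

lemma head_bound: "j < num_tapes M \<Longrightarrow> \<bar>snd (snd (cfg y t) ! j)\<bar> \<le> int t"
proof (induction t)
  case 0
  then show ?case by (auto simp: cfg_def init_config_def nth_Cons')
next
  case (Suc t)
  have "\<bar>offset d\<bar> \<le> 1" for d by (cases d) auto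
  from this[of "snd (snd (dl y t) ! j)"] Suc show ?case by (simp add: head_Suc)
qed

lemma C_H_0:
  assumes "j < num_tapes M"
  shows "H y 0 p j \<longleftrightarrow> p = 2 * T + 3" "C y 0 p j = (if j = 0 then word_contents (enc_word x @ enc_word y)
      (cell p) else 0)"
  using assms by (auto simp: H_def C_def cfg_def init_config_def nth_Cons')

lemma cell_contents:
  assumes "p < length (replicate (2 * T + 3) 0 @ map bit_sym z @ replicate n 0)"
  shows "(replicate (2 * T + 3) 0 @ map bit_sym z @ replicate n 0) ! p = word_contents z (cell p)"
proof (cases "p < 2 * T + 3")
  case False
  then obtain i where i: "p = 2 * T + 3 + i" using le_Suc_ex not_less by blast
  have c: "cell p = int i" by (simp add: i)
  have "(replicate (2 * T + 3) 0 @ map bit_sym z @ replicate n 0) ! p = (map bit_sym z @ replicate n 0) ! i"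
    by (simp add: i nth_append)
  then show ?thesis using assms unfolding c by (auto simp: i word_contents_def nth_append)
qed (simp add: nth_append word_contents_def)

lemma width: "W \<ge> 4 * T + 7" "W \<ge> 4"
  by (auto simp: length_row0 length_enc_word)

lemma rw_nonempty: "rw \<noteq> []"
  by (simp add: row0_def)

lemma row_yok:
  "length y \<le> P \<Longrightarrow> yok 0 rw (map (\<lambda>p. word_contents (enc_word x @ enc_word y) (cell p)) [0..<W])"
proof -
  assume y: "length y \<le> P"
  let ?z = "enc_word x @ enc_word y"
  let ?n = "W - (2 * T + 3 + length ?z)"
  let ?s = "replicate (2 * T + 3) 0 @ map bit_sym ?z @ replicate ?n 0"
  have l: "length ?s = W" using y by (simp add: length_row0 length_enc_word)
  have "map (\<lambda>p. word_contents ?z (cell p)) [0..<W] = ?s"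
    using cell_contents[of _ ?z ?n] l by (intro nth_equalityI) simp_all
  then show ?thesis unfolding yok_row0 using y l by metis
qed

lemma yok_row:
  assumes "yok 0 rw ss"
  obtains y where "length y \<le> P" "\<And>p. p < W \<Longrightarrow> ss ! p = word_contents (enc_word x @ enc_word y) (cell p)"
proof -
  obtain y n where y: "length y \<le> P"
    "ss = replicate (2 * T + 3) 0 @ map bit_sym (enc_word x @ enc_word y) @ replicate n 0" "length ss = W"
    using assms unfolding yok_row0 by blast
  show ?thesis by (rule that[OF y(1)]) (use cell_contents[of _ "enc_word x @ enc_word y" n] y in metis)
qed

lemma label:
  assumes "t < T + 2" "p < W"
  shows "(labs T rw ! (t * W + p)) mod 16 = rw ! p" "(labs T rw ! (t * W + p)) div 16 = lrow T t"
  using labs_nth[OF assms] row0_bound[OF assms(2)] by simp_all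

lemma pos_less: "t < T + 2 \<Longrightarrow> p < W \<Longrightarrow> t * W + p < (T + 2) * W"
proof -
  assume t: "t < T + 2" and p: "p < W"
  have "t * W + p < Suc t * W" using p by simp
  also have "\<dots> \<le> (T + 2) * W" using t by (intro mult_le_mono1) simp
  finally show ?thesis .
qed

text \<open>At the borders heads could enter from outside the diagram, so agreement with the run is
  claimed only for the columns from \<open>t\<close> to \<open>W - t - 1\<close> of row
  \<open>t\<close>. All heads lie in this window. The tile under a head ties the symbol claimed to
  be read to the symbol of its cell, and the claim is constant along the row; hence the whole row
  applies the transition that the machine makes.\<close>

lemma sol_imp_accept:
  assumes f: "sol f"
  shows "\<exists>y. length y \<le> P \<and> fst (cfg y (Suc T)) = num_states M \<and> fst (snd (cfg y (Suc T)) ! 0) 0 = 2"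
proof -
  define tl where "tl t p = tile_list M ! f (t * W + p)" for t p
  define Q where "Q t p = fst (tl t p)" for t p
  define R where "R t p = fst (snd (tl t p))" for t p
  define CC where "CC t p = fst (snd (snd (tl t p)))" for t p
  define HH where "HH t p = snd (snd (snd (tl t p)))" for t p
  have tl: "tl t p = (Q t p, R t p, CC t p, HH t p)" for t p by (simp add: Q_def R_def CC_def HH_def)
  have "tl t p \<in> tiles M \<and> okl M (labs T rw ! (t * W + p)) (tl t p)" if "t < T + 2" "p < W" for t p
  proof -
    have "f (t * W + p) < length (tile_list M)" "tile_good M (labs T rw) (t * W + p) (f (t * W + p))"
      using f pos_less[OF that] by (auto simp: csp_sol_def)
    then show ?thesis unfolding tl_def tile_good_def set_tile_list[symmetric] by simp
  qed
  note t1 = this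
  have lR: "length (R t p) = num_tapes M" if "t < T + 2" "p < W" for t p
    using t1[OF that] by (auto simp: tl tiles_def)
  have hc: "CC t p ! j = R t p ! j" if "t < T + 2" "p < W" "j < num_tapes M" "HH t p ! j" for t p j
    using t1[OF that(1,2)] that by (auto simp: tl okl_def)
  have o0: "(1 \<le> j \<longrightarrow> CC 0 p ! j = 0) \<and> Q 0 p = 0 \<and> oksym (rw ! p) (CC 0 p ! 0) \<and> (p = 0 \<longrightarrow> \<not> HH 0 p ! j)"
    if "p < W" "j < num_tapes M" for p j
    using t1[of 0 p] that label[of 0 p] row0_0[of p x P T] by (auto simp: tl okl_def lrow_def)
  have cr: "cross M (rel W (b - a)) (labs T rw ! a) (tile_list M ! f a) (labs T rw ! b) (tile_list M ! f b)"
    if "a < b" "b < (T + 2) * W" for a b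
    using f that by (auto simp: csp_sol_def tile_bad_def)
  have hz: "Q t p = Q t (Suc p) \<and> R t p = R t (Suc p) \<and>
     (t = 0 \<longrightarrow> (\<forall>j < num_tapes M. HH t (Suc p) ! j = (p = 2 * T + 2)) \<and> ychk (rw ! Suc p) (CC t p ! 0) (CC
         t (Suc p) ! 0)) \<and>
     (t = Suc T \<and> p = 2 * T + 2 \<longrightarrow> Q t (Suc p) = num_states M \<and> CC t (Suc p) ! 0 = 2)"
    if "t < T + 2" "Suc p < W" for t p
  proof -
    have "cross M 2 (labs T rw ! (t * W + p)) (tl t p) (labs T rw ! (t * W + Suc p)) (tl t (Suc p))"
      using cr[of "t * W + p" "t * W + Suc p"] pos_less[OF that] rel_simps(1)[OF width(2), of 1] by (simp
          add: tl_def)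
    moreover have "rw ! Suc p \<noteq> 1" using row0_0[OF that(2)] by simp
    moreover have "p < W" using that by simp
    ultimately show ?thesis using label[of t p] label[OF that] that(1) row0_4[of p x P T]
      by (auto simp: cross_def tl lrow_def)
  qed
  have v4: "Q (Suc t) p = fst (delta M (Q t p) (R t p)) \<and> (\<forall>j < num_tapes M.
        CC (Suc t) p ! j = (if HH t p ! j then fst (snd (delta M (Q t p) (R t p)) ! j) else CC t p ! j) \<and>
        (snd (snd (delta M (Q t p) (R t p)) ! j) = Stay \<longrightarrow> HH (Suc t) p ! j = HH t p ! j))"
    if "Suc t < T + 2" "p < W" for t p
  proof -
    have "cross M 4 (labs T rw ! (t * W + p)) (tl t p) (labs T rw ! (Suc t * W + p)) (tl (Suc t) p)"
      using cr[of "t * W + p" "Suc t * W + p"] pos_less[OF that] rel_simps(3)[OF width(2), of W]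
          rw_nonempty by (simp add: tl_def)
    then show ?thesis by (auto simp: cross_def tl)
  qed
  have v3: "snd (snd (delta M (Q t (Suc p)) (R t (Suc p))) ! j) = Move_Left \<longrightarrow> HH (Suc t) p ! j = HH t
      (Suc p) ! j"
    if "Suc t < T + 2" "Suc p < W" "j < num_tapes M" for t p j
  proof -
    have d: "(Suc t * W + p) - (t * W + Suc p) = W - 1" by simp
    have "cross M 3 (labs T rw ! (t * W + Suc p)) (tl t (Suc p)) (labs T rw ! (Suc t * W + p)) (tl (Suc t) p)"
      using cr[of "t * W + Suc p" "Suc t * W + p"] pos_less[of "Suc t" p] that rel_simps(2)[OF width(2),
          of "W - 1"] width
      unfolding d by (simp add: tl_def)
    moreover have "rw ! Suc p \<noteq> 1" using row0_0[OF that(2)] by simp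
    ultimately show ?thesis using label[of t "Suc p"] that by (auto simp: cross_def tl)
  qed
  have v5: "snd (snd (delta M (Q t p) (R t p)) ! j) = Move_Right \<longrightarrow> HH (Suc t) (Suc p) ! j = HH t p ! j"
    if "Suc t < T + 2" "Suc p < W" "j < num_tapes M" for t p j
  proof -
    have d: "(Suc t * W + Suc p) - (t * W + p) = W + 1" by simp
    have "cross M 5 (labs T rw ! (t * W + p)) (tl t p) (labs T rw ! (Suc t * W + Suc p)) (tl (Suc t) (Suc p))"
      using cr[of "t * W + p" "Suc t * W + Suc p"] pos_less[OF that(1,2)] rel_simps(4)[OF width(2), of "W
          + 1"]
      unfolding d by (simp add: tl_def)
    moreover have "rw ! Suc p \<noteq> 1" using row0_0[OF that(2)] by simp
    ultimately show ?thesis using label[OF that(1,2)] that by (auto simp: cross_def tl)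
  qed
  have "yok 0 rw (map (\<lambda>p. CC 0 p ! 0) [0..<W])"
    unfolding yok_nth
  proof (intro conjI allI impI)
    fix p assume p: "p < W"
    show "oksym (rw ! p) (map (\<lambda>p. CC 0 p ! 0) [0..<W] ! p)" using o0[OF p, of 0] length_tapes(2) p by simp
    show "ychk (rw ! p) (if p = 0 then 0 else map (\<lambda>p. CC 0 p ! 0) [0..<W] ! (p - 1)) (map (\<lambda>p. CC 0 p !
        0) [0..<W] ! p)"
    proof (cases p)
      case 0
      then show ?thesis using row0_0[OF p] by (simp add: ychk_def)
    next
      case (Suc p')
      then show ?thesis using hz[of 0 p'] p by simp
    qed
  qed simp
  then obtain y where y: "length y \<le> P" "\<And>p. p < W \<Longrightarrow> CC 0 p ! 0 = word_contents (enc_word x @ enc_word y)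
      (cell p)"
    by (rule yok_row) simp
  have row: "Q t p = Q t 0 \<and> R t p = R t 0" if "t < T + 2" "p < W" for t p
    using that(2) by (induction p) (use hz that(1) in auto)
  define agr where "agr t \<longleftrightarrow> Q t 0 = fst (cfg y t) \<and> (\<forall>p j. t \<le> p \<and> p < W - t \<and> j < num_tapes M \<longrightarrow>
     CC t p ! j = C y t p j \<and> (HH t p ! j \<longleftrightarrow> H y t p j))" for t
  have reads: "R t p = map (\<lambda>tp. fst tp (snd tp)) (snd (cfg y t))" if "agr t" "t < T + 2" "p < W" for t p
  proof (rule nth_equalityI)
    show "length (R t p) = length (map (\<lambda>tp. fst tp (snd tp)) (snd (cfg y t)))"
      using lR that length_tapes by simp
    fix j assume "j < length (R t p)"
    then have j: "j < num_tapes M" using lR that by simp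
    \<comment> \<open>The column in which the head of tape \<open>j\<close> stands; cell 0 is column
      \<open>2 * T + 3\<close>.\<close>
    define c where "c = nat (snd (snd (cfg y t) ! j) + (2 * int T + 3))"
    have c: "t \<le> c" "c < W - t" "cell c = snd (snd (cfg y t) ! j)"
      using head_bound[OF j, of y t] that(2) width(1) by (auto simp: c_def)
    then have "H y t c j" by (simp add: H_def)
    with that(1) c j have "HH t c ! j" "CC t c ! j = C y t c j" by (auto simp: agr_def)
    then have "R t c ! j = C y t c j" using hc[OF that(2) _ j] c by simp
    moreover have "R t c = R t p" using row[OF that(2), of p] row[OF that(2), of c] that(3) c by simp
    ultimately show "R t p ! j = map (\<lambda>tp. fst tp (snd tp)) (snd (cfg y t)) ! j"
      using j length_tapes c(3) by (simp add: C_def)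
  qed
  have "t < T + 2 \<Longrightarrow> agr t" for t
  proof (induction t)
    case 0
    show ?case unfolding agr_def
    proof (intro conjI allI impI)
      show "Q 0 0 = fst (cfg y 0)" using o0[of 0 0] rw_nonempty length_tapes(2) by (auto simp: cfg_def
          init_config_def)
      fix p j assume a: "0 \<le> p \<and> p < W - 0 \<and> j < num_tapes M"
      show "CC 0 p ! j = C y 0 p j" using a o0[of p j] y(2)[of p] C_H_0(2)[of j y p] by auto
      show "HH 0 p ! j = H y 0 p j"
      proof (cases p)
        case 0
        then show ?thesis using a o0[of p j] C_H_0(1)[of j y p] by auto
      next
        case (Suc p')
        then show ?thesis using a hz[of 0 p'] C_H_0(1)[of j y p] by auto
      qed
    qed
  next
    case (Suc t)
    then have i: "agr t" and t: "t < T + 2" by simp_all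
    have dl: "delta M (Q t p) (R t p) = dl y t" if "p < W" for p
      using reads[OF i t that] row[OF t that] i by (simp add: dl_def agr_def)
    show ?case unfolding agr_def
    proof (intro conjI allI impI)
      show "Q (Suc t) 0 = fst (cfg y (Suc t))"
        using v4[OF Suc.prems, of 0] dl[of 0] rw_nonempty cfg_Suc(1) by auto
      fix p j assume a: "Suc t \<le> p \<and> p < W - Suc t \<and> j < num_tapes M"
      then have p: "p < W" "Suc p < W" "j < num_tapes M" "t \<le> p" "p < W - t" "t \<le> Suc p" "Suc p < W - t"
          by auto
      show "CC (Suc t) p ! j = C y (Suc t) p j"
        using v4[OF Suc.prems p(1)] dl[OF p(1)] i p by (auto simp: agr_def C_Suc)
      obtain p' where p': "p = Suc p'" "t \<le> p'" "p' < W - t" "p' < W" using a by (cases p) auto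
      show "HH (Suc t) p ! j = H y (Suc t) p j"
      proof (cases "snd (snd (dl y t) ! j)")
        case Move_Left
        then show ?thesis using v3[OF Suc.prems p(2,3)] dl[OF p(2)] H_Suc(1)[OF p(3), of y t p] i p by
            (simp add: agr_def)
      next
        case Stay
        then show ?thesis using v4[OF Suc.prems p(1)] dl[OF p(1)] H_Suc(2)[OF p(3), of y t p] i p by
            (simp add: agr_def)
      next
        case Move_Right
        then show ?thesis using v5[OF Suc.prems, of p'] dl[OF p'(4)] H_Suc(3)[OF p(3), of y t p'] i p p'
            by (simp add: agr_def)
      qed
    qed
  qed
  from this[of "Suc T"] have i: "agr (Suc T)" by simp
  have w: "Suc (2 * T + 2) < W" using width by simp
  from hz[of "Suc T" "2 * T + 2"] w
  have "Q (Suc T) (2 * T + 3) = num_states M" "CC (Suc T) (2 * T + 3) ! 0 = 2"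
    by (simp_all add: numeral_3_eq_3)
  moreover have "Q (Suc T) (2 * T + 3) = Q (Suc T) 0" using row[of "Suc T" "2 * T + 3"] width by simp
  moreover have "CC (Suc T) (2 * T + 3) ! 0 = C y (Suc T) (2 * T + 3) 0"
    using i width length_tapes(2) by (auto simp: agr_def)
  ultimately have "fst (cfg y (Suc T)) = num_states M" "fst (snd (cfg y (Suc T)) ! 0) 0 = 2"
    using i by (simp_all add: agr_def C_def)
  with y(1) show ?thesis by blast
qed

lemma real_tile_in: "real_tile y t p \<in> tiles M"
proof -
  have "fst tp i < num_syms M" if "tp \<in> set (snd (cfg y t))" for tp i
    using vcfg_cfg[of y t] that by (auto simp: vcfg_def)
  moreover from this have "C y t p j < num_syms M" if "j < num_tapes M" for j
    using that length_tapes(1)[of y t] by (simp add: C_def)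
  ultimately show ?thesis using vcfg_cfg[of y t] length_tapes(1)[of y t]
    by (auto simp: tiles_def real_tile_def vcfg_def)
qed

text \<open>All tiles are read off the run. The delicate pairs are those whose numbers differ by 1,
  \<open>W - 1\<close> or \<open>W + 1\<close> although they are not neighbours: one of the two is
  then in the first column, where \<open>cross\<close> demands nothing for this difference.\<close>

lemma accept_imp_sol:
  assumes y: "length y \<le> P" and acc: "fst (cfg y (Suc T)) = num_states M" "fst (snd (cfg y (Suc T)) ! 0)
      0 = 2"
  shows "\<exists>f. sol f"
proof -
  have "\<exists>d < length (tile_list M). tile_list M ! d = real_tile y t p" for t p
    using real_tile_in set_tile_list by (metis in_set_conv_nth)
  then obtain g where g: "\<And>t p. g t p < length (tile_list M)" "\<And>t p. tile_list M ! g t p = real_tile y t p"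
    by metis
  define f where "f i = g (i div W) (i mod W)" for i
  have Wpos: "W > 0" using width(2) by linarith
  have split: "\<exists>t p. i = t * W + p \<and> t < T + 2 \<and> p < W" if "i < (T + 2) * W" for i
    using that Wpos by (intro exI[of _ "i div W"] exI[of _ "i mod W"]) (auto simp: less_mult_imp_div_less)
  have f: "f (t * W + p) = g t p" if "p < W" for t p using div_mod_mult_add[OF that] by (simp add: f_def)
  have yk: "oksym (rw ! p) (C y 0 p 0) \<and> ychk (rw ! p) (if p = 0 then 0 else C y 0 (p - 1) 0) (C y 0 p
      0)" if "p < W" for p
  proof -
    have "(if p = 0 then 0 else map (\<lambda>p. word_contents (enc_word x @ enc_word y) (cell p)) [0..<W] ! (p -
        1)) =
        (if p = 0 then 0 else C y 0 (p - 1) 0)"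
      using that C_H_0(2)[of 0 y "p - 1"] length_tapes(2) by auto
    moreover have "map (\<lambda>p. word_contents (enc_word x @ enc_word y) (cell p)) [0..<W] ! p = C y 0 p 0"
      using that C_H_0(2)[of 0 y p] length_tapes(2) by auto
    moreover have "oksym (rw ! p) (map (\<lambda>p. word_contents (enc_word x @ enc_word y) (cell p)) [0..<W] ! p) \<and>
      ychk (rw ! p) (if p = 0 then 0 else map (\<lambda>p. word_contents (enc_word x @ enc_word y) (cell p))
          [0..<W] ! (p - 1))
        (map (\<lambda>p. word_contents (enc_word x @ enc_word y) (cell p)) [0..<W] ! p)"
      using row_yok[OF y, unfolded yok_nth] that by blast
    ultimately show ?thesis by (simp only:)
  qed
  have "okl M (labs T rw ! (t * W + p)) (real_tile y t p)" if "t < T + 2" "p < W" for t p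
  proof -
    have "C y t p j = map (\<lambda>tp. fst tp (snd tp)) (snd (cfg y t)) ! j" if "H y t p j" "j < num_tapes M" for j
      using that length_tapes by (simp add: C_def H_def)
    moreover have "t = 0" if "lrow T t = 0" using that by (simp add: lrow_def split: if_splits)
    ultimately show ?thesis
      using label[OF that] yk[OF that(2)] C_H_0[of _ y p] length_tapes(2) row0_0[OF that(2)]
      by (auto simp: okl_def real_tile_def cfg_def init_config_def)
  qed
  then have 1: "f i < length (tile_list M) \<and> tile_good M (labs T rw) i (f i)" if "i < (T + 2) * W" for i
    using split[OF that] f g by (auto simp: tile_good_def)
  have 2: "\<not> tile_bad M W (labs T rw) a b (f a) (f b)" if ab: "a < b" "b < (T + 2) * W" for a b
  proof -
    from split[of a] ab obtain t p where a: "a = t * W + p" "t < T + 2" "p < W" by auto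
    from split[of b] ab obtain u r where b: "b = u * W + r" "u < T + 2" "r < W" by auto
    have un: "u = u' \<and> r = r'" if "b = u' * W + r'" "r' < W" for u' r'
      using that b by (metis div_mod_mult_add)
    note la = label[OF a(2,3)] and lb = label[OF b(2,3)]
    have ta: "tile_list M ! f a = real_tile y t p" and tb: "tile_list M ! f b = real_tile y u r"
      using f g a b by simp_all
    have r1: "rw ! r = 1 \<longleftrightarrow> r = 0" "rw ! p = 1 \<longleftrightarrow> p = 0" using row0_0 a b by auto
    have c2: "r \<noteq> 0 \<longrightarrow> u = t \<and> r = Suc p" if "b - a = 1"
    proof -
      have bb: "b = t * W + Suc p" using that ab a by simp
      show ?thesis
      proof (cases "Suc p < W")
        case False
        then have "b = Suc t * W + 0" using bb a by simp
        then show ?thesis using un[of "Suc t" 0] Wpos by simp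
      qed (use un[OF bb] in simp)
    qed
    have c4: "u = Suc t \<and> r = p" if "b - a = W"
    proof -
      have "b = Suc t * W + p" using that ab a by simp
      then show ?thesis using un a by blast
    qed
    have c3: "p \<noteq> 0 \<longrightarrow> u = Suc t \<and> p = Suc r" if "b - a = W - 1"
    proof
      assume p: "p \<noteq> 0"
      have "b = Suc t * W + (p - 1)" using that ab a p Wpos by simp
      then show "u = Suc t \<and> p = Suc r" using un[of "Suc t" "p - 1"] a p by simp
    qed
    have c5: "r \<noteq> 0 \<longrightarrow> u = Suc t \<and> r = Suc p" if "b - a = W + 1"
    proof -
      have bb: "b = Suc t * W + Suc p" using that ab a by simp
      show ?thesis
      proof (cases "Suc p < W")
        case False
        then have "b = Suc (Suc t) * W + 0" using bb a by simp
        then show ?thesis using un[of "Suc (Suc t)" 0] Wpos by simp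
      qed (use un[OF bb] in simp)
    qed
    have t0: "lrow T t = 0 \<longleftrightarrow> t = 0" "lrow T t = 2 \<longleftrightarrow> t = Suc T" using a(2) by (auto simp: lrow_def)
    have row4: "rw ! p = 4 \<longleftrightarrow> p = 2 * T + 2" using row0_4 a by auto
    have D: "delta M (fst (cfg y t)) (map (\<lambda>tp. fst tp (snd tp)) (snd (cfg y t))) = dl y t" by (simp add:
        dl_def)
    have h2: "(\<forall>j < num_tapes M. H y 0 (Suc p) j = (p = 2 * T + 2)) \<and>
       (Suc p < W \<longrightarrow> ychk (rw ! Suc p) (C y 0 p 0) (C y 0 (Suc p) 0)) \<and>
       C y (Suc T) (Suc (2 * T + 2)) 0 = 2"
      using C_H_0(1)[of _ y "Suc p"] yk[of "Suc p"] acc by (auto simp: C_def)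
    have "cross M (rel W (b - a)) (labs T rw ! a) (real_tile y t p) (labs T rw ! b) (real_tile y u r)"
    proof -
      consider "b - a = 1" | "b - a = W - 1" | "b - a = W" | "b - a = W + 1" |
        "b - a \<noteq> 1" "b - a \<noteq> W - 1" "b - a \<noteq> W" "b - a \<noteq> W + 1" by blast
      then show ?thesis
      proof cases
        case 1
        then show ?thesis using rel_simps[OF width(2), of "b - a"] width(1) c2 h2 la lb r1 t0 row4 acc
            b(3) length_tapes(2)
          unfolding a(1)[symmetric] b(1)[symmetric] cross_def real_tile_def prod.case by auto
      next
        case 2
        then show ?thesis using rel_simps[OF width(2), of "b - a"] width(1) c3 la lb r1 H_Suc(1)[of _ y t r]
          unfolding a(1)[symmetric] b(1)[symmetric] cross_def real_tile_def prod.case D by auto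
      next
        case 3
        then show ?thesis using rel_simps[OF width(2), of "b - a"] width(1) c4 H_Suc(2)[of _ y t r] C_Suc
            cfg_Suc(1)
          unfolding a(1)[symmetric] b(1)[symmetric] cross_def real_tile_def prod.case D by auto
      next
        case 4
        then show ?thesis using rel_simps[OF width(2), of "b - a"] width(1) c5 la lb r1 H_Suc(3)[of _ y t p]
          unfolding a(1)[symmetric] b(1)[symmetric] cross_def real_tile_def prod.case D by auto
      next
        case 5
        then show ?thesis using rel_simps[OF width(2), of "b - a"]
          unfolding cross_def real_tile_def prod.case by auto
      qed
    qed
    then show ?thesis by (simp add: tile_bad_def ta tb)
  qed
  show ?thesis using 1 2 by (auto simp: csp_sol_def)
qed

end

text \<open>The answer is inspected at time \<open>T + 1\<close>. A machine that halts within
  \<open>T\<close> steps has not changed since, and a one-bit answer is positive iff cell 0 holds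
  the symbol 2.\<close>

lemma tiling_correct:
  assumes M: "wf_tm M" and dec: "\<And>y. length y \<le> P \<Longrightarrow>
    outputs_within M (enc_word x @ enc_word y) T [enc_word x @ enc_word y \<in> V]"
  shows "(\<exists>f. csp_sol ((T + 2) * length (row0 x P T)) (length (tile_list M))
      (tile_good M (labs T (row0 x P T))) (tile_bad M (length (row0 x P T)) (labs T (row0 x P T))) f) \<longleftrightarrow>
    (\<exists>y. length y \<le> P \<and> enc_word x @ enc_word y \<in> V)"
proof -
  interpret tiling M x P T by unfold_locales (rule M)
  have acc: "fst (cfg y (Suc T)) = num_states M \<and>
      (fst (snd (cfg y (Suc T)) ! 0) 0 = 2 \<longleftrightarrow> enc_word x @ enc_word y \<in> V)" if "length y \<le> P" for y
  proof -
    from dec[OF that] obtain t where t: "t \<le> T" "fst (cfg y t) = num_states M"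
      "output_word (cfg y t) [enc_word x @ enc_word y \<in> V]" unfolding outputs_within_def cfg_def by blast
    have stay: "cfg y (t + n) = cfg y t" for n
    proof (induction n)
      case (Suc n)
      have "cfg y (t + Suc n) = step M (cfg y t)" using Suc by (simp add: cfg_def)
      also have "\<dots> = cfg y t" using t(2) by (cases "cfg y t") simp
      finally show ?case .
    qed simp
    have "cfg y (Suc T) = cfg y t" using stay[of "Suc T - t"] t(1) by simp
    moreover have "hd (snd (cfg y t)) = snd (cfg y t) ! 0"
      using length_tapes(1)[of y t] length_tapes(2) by (intro hd_conv_nth) auto
    ultimately show ?thesis using t(2,3) by (auto simp: output_word_def bit_sym_def)
  qed
  show ?thesis using sol_imp_accept accept_imp_sol acc by blast
qed

section \<open>Writing programs\<close>

definition seqs :: "prog list \<Rightarrow> prog" where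
  "seqs ps = foldr (;;) ps Skip"

definition emit :: "nat \<Rightarrow> nat list \<Rightarrow> prog" where
  "emit r ws = seqs (map (Put r) ws)"

definition loop :: "nat \<Rightarrow> prog \<Rightarrow> prog" where
  "loop q b = Rewind q ;; For q b"

text \<open>In contrast to \<open>touch\<close>, moving a head does not count: a register that an
  inner loop rewinds and scans keeps its word.\<close>

primrec mods :: "prog \<Rightarrow> nat set" where
  "mods Skip = {}"
| "mods (Put r v) = {r}"
| "mods (Adv r) = {}"
| "mods (Rewind r) = {}"
| "mods (End r) = {}"
| "mods (Clear r) = {r}"
| "mods (p ;; q) = mods p \<union> mods q"
| "mods (IfR P p q) = mods p \<union> mods q"
| "mods (For r p) = mods p"

lemma den_seqs [simp]: "den (seqs []) s = s" "den (seqs (p # ps)) s = den (seqs ps) (den p s)"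
  by (simp_all add: seqs_def)

lemma sets_seqs [simp]:
  "touch (seqs ps) = (\<Union>p \<in> set ps. touch p)" "mods (seqs ps) = (\<Union>p \<in> set ps. mods p)"
  "loops (seqs ps) = (\<Union>p \<in> set ps. loops p)" "grown (seqs ps) = (\<Union>p \<in> set ps. grown p)"
  "okp (seqs ps) \<longleftrightarrow> (\<forall>p \<in> set ps. okp p)"
  by (induction ps) (simp_all add: seqs_def)

lemma sets_emit [simp]:
  "touch (emit r ws) = (if ws = [] then {} else {r})" "mods (emit r ws) = (if ws = [] then {} else {r})"
  "loops (emit r ws) = {}" "grown (emit r ws) = (if ws = [] then {} else {r})" "okp (emit r ws) \<longleftrightarrow> 0 \<notin> set ws"
  by (auto simp: emit_def) (metis gr0I)

lemma sets_loop [simp]: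
  "touch (loop q b) = insert q (touch b)" "mods (loop q b) = mods b"
  "loops (loop q b) = insert q (loops b)" "grown (loop q b) = grown b"
  "okp (loop q b) \<longleftrightarrow> okp b \<and> q \<notin> touch b"
  by (auto simp: loop_def)

lemma fst_unmod: "r \<notin> mods p \<Longrightarrow> fst (den p s r) = fst (s r)"
proof (induction p arbitrary: s)
  case (For q p)
  have "fst (((\<lambda>s. (den p s)(q := adv (den p s q))) ^^ n) s r) = fst (s r)" for n
    by (induction n) (use For in \<open>auto simp: fun_upd_apply adv_def\<close>)
  then show ?case by simp
qed (auto simp: fun_upd_apply adv_def)

definition at_end :: "regs \<Rightarrow> nat \<Rightarrow> bool" where
  "at_end s r \<longleftrightarrow> snd (s r) = length (fst (s r))"

text \<open>Reduces the effect on an output register to the word appended. The premise that the head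
  is at the end holds again afterwards, so the notion composes, and nothing need be known about the
  word already present.\<close>

definition App :: "prog \<Rightarrow> nat \<Rightarrow> regs \<Rightarrow> nat list \<Rightarrow> bool" where
  "App b r s w \<longleftrightarrow> (at_end s r \<longrightarrow> den b s r = (fst (s r) @ w, length (fst (s r)) + length w))"

lemma App_den: "App b r s w \<Longrightarrow> at_end s r \<Longrightarrow> fst (den b s r) = fst (s r) @ w"
  by (simp add: App_def)

lemma App_Then: "App a r s u \<Longrightarrow> App b r (den a s) v \<Longrightarrow> App (a ;; b) r s (u @ v)"
  by (simp add: App_def at_end_def)

lemma App_Put: "App (Put r v) r s [v]"
  by (simp add: App_def at_end_def put_def)

lemma App_none: "r \<notin> touch b \<Longrightarrow> App b r s []"
  by (simp add: App_def at_end_def den_untouched prod_eq_iff)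

lemma App_seqs:
  assumes "\<And>i. i < length ps \<Longrightarrow> App (ps ! i) r (den (seqs (take i ps)) s) (g i)"
  shows "App (seqs ps) r s (concat (map g [0..<length ps]))"
  using assms
proof (induction ps rule: rev_induct)
  case Nil
  then show ?case by (simp add: App_none)
next
  case (snoc p ps)
  have d: "den (seqs (ps @ [p])) t = den p (den (seqs ps) t)" for t
    by (induction ps arbitrary: t) simp_all
  have "App (seqs ps) r s (concat (map g [0..<length ps]))"
  proof (rule snoc.IH)
    fix i assume "i < length ps"
    with snoc.prems[of i] show "App (ps ! i) r (den (seqs (take i ps)) s) (g i)" by (simp add: nth_append)
  qed
  moreover have "App p r (den (seqs ps) s) (g (length ps))"
    using snoc.prems[of "length ps"] by simp
  ultimately show ?case by (simp add: App_def d at_end_def)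
qed

lemma App_emit: "App (emit r ws) r s ws"
proof -
  have "App (seqs (map (Put r) ws)) r s (concat (map (\<lambda>i. [ws ! i]) [0..<length (map (Put r) ws)]))"
    by (rule App_seqs) (simp add: App_Put)
  moreover have "concat (map (\<lambda>i. [ws ! i]) [0..<length (map (Put r) ws)]) = ws"
    by (simp add: map_nth)
  ultimately show ?thesis by (simp add: emit_def)
qed

lemma App_IfR: "(P (rd s) \<Longrightarrow> App a r s u) \<Longrightarrow> (\<not> P (rd s) \<Longrightarrow> App b r s v) \<Longrightarrow>
    App (IfR P a b) r s (if P (rd s) then u else v)"
  by (simp add: App_def)

text \<open>The information about the initial state \<open>s\<close> that remains valid in every
  round of \<open>loop q b\<close>.\<close>

definition frame :: "prog \<Rightarrow> nat \<Rightarrow> regs \<Rightarrow> regs \<Rightarrow> bool" where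
  "frame b q s t \<longleftrightarrow> (\<forall>p. p \<notin> mods b \<longrightarrow> fst (t p) = fst (s p)) \<and> (\<forall>p. p \<noteq> q \<longrightarrow> p \<notin> touch b \<longrightarrow> t p = s p)"

lemma loop_inv:
  assumes q: "q \<notin> touch b" and 0: "I 0 (s(q := (fst (s q), 0)))"
    and step: "\<And>i t. i < length (fst (s q)) \<Longrightarrow> I i t \<Longrightarrow> t q = (fst (s q), i) \<Longrightarrow> frame b q s t \<Longrightarrow>
      I (Suc i) ((den b t)(q := (fst (s q), Suc i)))"
  shows "I (length (fst (s q))) (den (loop q b) s)"
proof -
  let ?w = "fst (s q)"
  let ?F = "\<lambda>t. (den b t)(q := adv (den b t q))"
  let ?s = "s(q := (?w, 0))"
  have "i \<le> length ?w \<Longrightarrow> I i ((?F ^^ i) ?s) \<and> (?F ^^ i) ?s q = (?w, i) \<and> frame b q s ((?F ^^ i) ?s)" for i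
  proof (induction i)
    case 0
    have "frame b q s ?s" by (simp add: frame_def fun_upd_apply)
    then show ?case using assms(2) by simp
  next
    case (Suc i)
    let ?t = "(?F ^^ i) ?s"
    from Suc have t: "I i ?t" "?t q = (?w, i)" "frame b q s ?t" and i: "i < length ?w" by auto
    have F: "?F ?t = (den b ?t)(q := (?w, Suc i))"
      using den_untouched[OF q, of ?t] t(2) i by (simp add: adv_def)
    have "frame b q s (?F ?t)"
      using t(3) fst_unmod[of _ b ?t] den_untouched[of _ b ?t] t(2)
      by (auto simp: frame_def fun_upd_apply F)
    with step[OF i t] F show ?case by simp
  qed
  from this[OF order_refl] show ?thesis by (simp add: loop_def)
qed

lemma App_loop:
  assumes r: "r \<noteq> q" and q: "q \<notin> touch b" and 0: "I 0 (s(q := (fst (s q), 0)))"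
    and step: "\<And>i t. i < length (fst (s q)) \<Longrightarrow> I i t \<Longrightarrow> t q = (fst (s q), i) \<Longrightarrow> frame b q s t \<Longrightarrow>
      at_end t r \<Longrightarrow> App b r t (g i) \<and> I (Suc i) ((den b t)(q := (fst (s q), Suc i)))"
  shows "App (loop q b) r s (concat (map g [0..<length (fst (s q))]))"
proof (cases "at_end s r")
  case True
  define J where "J i t \<longleftrightarrow> I i t \<and> at_end t r \<and> fst (t r) = fst (s r) @ concat (map g [0..<i])" for i t
  have "J (length (fst (s q))) (den (loop q b) s)"
  proof (rule loop_inv[OF q])
    show "J 0 (s(q := (fst (s q), 0)))" using 0 True r by (simp add: J_def at_end_def)
    fix i t assume i: "i < length (fst (s q))" and t: "J i t" "t q = (fst (s q), i)" "frame b q s t"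
    from step[OF i _ t(2,3)] t(1)
    have "App b r t (g i)" "I (Suc i) ((den b t)(q := (fst (s q), Suc i)))" by (auto simp: J_def)
    then show "J (Suc i) ((den b t)(q := (fst (s q), Suc i)))"
      using t(1) r by (auto simp: J_def App_def at_end_def)
  qed
  then show ?thesis by (simp add: J_def App_def at_end_def prod_eq_iff)
qed (simp add: App_def)

lemma App_loop_simple:
  assumes "r \<noteq> q" "q \<notin> touch b"
    "\<And>i t. i < length (fst (s q)) \<Longrightarrow> t q = (fst (s q), i) \<Longrightarrow> frame b q s t \<Longrightarrow> App b r t (g (fst (s q) ! i))"
  shows "App (loop q b) r s (concat (map g (fst (s q))))"
proof -
  have "App (loop q b) r s (concat (map (\<lambda>i. g (fst (s q) ! i)) [0..<length (fst (s q))]))"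
    by (rule App_loop[where I = "\<lambda>_ _. True"]) (use assms in auto)
  moreover have "map (\<lambda>i. g (fst (s q) ! i)) [0..<length (fst (s q))] = map g (fst (s q))"
    by (rule nth_equalityI) auto
  ultimately show ?thesis by simp
qed

text \<open>\<open>Put\<close> writes constants only, so the symbol under the head of
  \<open>q\<close> is transferred by cases over its value. The shift \<open>c\<close> turns column
  numbers into labels of later rows.\<close>

definition copy :: "nat \<Rightarrow> nat \<Rightarrow> nat \<Rightarrow> nat \<Rightarrow> prog" where
  "copy n c q r = seqs (map (\<lambda>v. IfR (\<lambda>rd. rd q = v) (Put r (v + c)) Skip) [1..<n])"

lemma sets_copy [simp]: "loops (copy n c q r) = {}" "touch (copy n c q r) = (if n \<le> 1 then {} else {r})"
  "mods (copy n c q r) = (if n \<le> 1 then {} else {r})" "grown (copy n c q r) = (if n \<le> 1 then {} else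
      {r})" "okp (copy n c q r)"
  by (auto simp: copy_def split: if_splits)

lemma App_copy:
  assumes "q \<noteq> r" "0 < rd s q" "rd s q < n"
  shows "App (copy n c q r) r s [rd s q + c]"
proof -
  define g where "g i = (if rd s q = Suc i then [Suc i + c] else [])" for i
  let ?ps = "map (\<lambda>v. IfR (\<lambda>rd. rd q = v) (Put r (v + c)) Skip) [1..<n]"
  have "App (seqs ?ps) r s (concat (map g [0..<length ?ps]))"
  proof (rule App_seqs)
    fix i assume i: "i < length ?ps"
    have "q \<notin> touch (seqs (take i ?ps))" using assms(1) by (auto dest!: in_set_takeD split: if_splits)
    then have "rd (den (seqs (take i ?ps)) s) q = rd s q" by (simp add: rd_def den_untouched)
    then show "App (?ps ! i) r (den (seqs (take i ?ps)) s) (g i)"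
      using i App_Put[of r "Suc i + c"] App_none[of r Skip] by (auto simp: g_def App_def)
  qed
  moreover have "concat (map g [0..<n - 1]) = [rd s q + c]"
  proof -
    obtain v where v: "rd s q = Suc v" "v < n - 1" using assms by (cases "rd s q") auto
    have "[0..<n - 1] = [0..<v] @ v # [Suc v..<n - 1]" using v by (metis upt_add_eq_append upt_conv_Cons
        le_add_diff_inverse less_imp_le zero_le add_0)
    then have "concat (map g [0..<n - 1]) = concat (map g [0..<v]) @ g v @ concat (map g [Suc v..<n - 1])"
      by simp
    also have "concat (map g [0..<v]) = []" by (auto simp: g_def v)
    also have "concat (map g [Suc v..<n - 1]) = []" by (auto simp: g_def v)
    finally show ?thesis using v(1) unfolding g_def[of v] by simp
  qed
  ultimately show ?thesis by (simp add: copy_def)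
qed

lemma rd_at: "t q = (w, i) \<Longrightarrow> i < length w \<Longrightarrow> rd t q = w ! i"
  by (simp add: rd_def rdw_def)

lemma App_copy_loop:
  assumes "q \<noteq> r" "\<forall>v \<in> set (fst (s q)). 0 < v \<and> v < n"
  shows "App (loop q (copy n c q r)) r s (map (\<lambda>v. v + c) (fst (s q)))"
proof -
  have "q \<notin> touch (copy n c q r)" using assms(1) by simp
  then have "App (loop q (copy n c q r)) r s (concat (map (\<lambda>v. [v + c]) (fst (s q))))"
  proof (rule App_loop_simple[OF assms(1)[symmetric]])
    fix i t assume i: "i < length (fst (s q))" and t: "t q = (fst (s q), i)"
    have "0 < fst (s q) ! i \<and> fst (s q) ! i < n" using assms(2) i by simp
    then show "App (copy n c q r) r t [fst (s q) ! i + c]"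
      using App_copy[OF assms(1), of t n c] rd_at[of t q _ i, OF t i] by simp
  qed
  then show ?thesis by simp
qed

lemma App_loop_word:
  assumes "fst (s q) = w" "r \<noteq> q" "q \<notin> touch b" "\<And>i t. i < length w \<Longrightarrow> t q = (w, i) \<Longrightarrow> frame b q s t \<Longrightarrow> App
      b r t (g (w ! i))"
    "ws = concat (map g w)"
  shows "App (loop q b) r s ws"
  using App_loop_simple[of r q b s g] assms by simp

lemma init_regs_simps [simp]: "init_regs x 0 = (map bit_sym x, 0)" "r \<noteq> 0 \<Longrightarrow> init_regs x r = ([], 0)"
  by (simp_all add: init_regs_def)

lemma at_end_init: "r \<noteq> 0 \<Longrightarrow> at_end (init_regs x) r"
  by (simp add: at_end_def)

text \<open>Register 0 remains readable as the input until the end, so the output is collected in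
  register 14. Moving it to register 0 is a phase of its own, since register 14, grown before, now
  controls a loop.\<close>

lemma fp_on_out:
  assumes "okp b" "polyprog b" "\<And>x. x \<in> X \<Longrightarrow> App b 14 (init_regs x) (map bit_sym (f x))"
  shows "fp_on X f"
proof (rule fp_on_prog)
  let ?c = "Clear 0 ;; loop 14 (copy 3 0 14 0)"
  show "okp (b ;; ?c)" using assms(1) by simp
  show "polyprog (b ;; ?c)" by (rule polyprog_Then[OF assms(2) polyprog_static]) simp
  fix x assume "x \<in> X"
  let ?s = "den b (init_regs x)"
  let ?t = "?s(0 := ([], 0))"
  have 14: "fst (?t 14) = map bit_sym (f x)"
    using App_den[OF assms(3)[OF \<open>x \<in> X\<close>] at_end_init] by simp
  have "App (loop 14 (copy 3 0 14 0)) 0 ?t (map (\<lambda>v. v + 0) (fst (?t 14)))"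
    by (rule App_copy_loop) (simp, unfold 14, auto simp: bit_sym_def)
  from App_den[OF this] show "fst (den (b ;; ?c) (init_regs x) 0) = map bit_sym (f x)"
    unfolding 14 by (simp add: at_end_def)
qed

section \<open>Encoding and decoding of words, and the inclusion of P in NP\<close>

definition encP :: "nat \<Rightarrow> prog" where
  "encP q = loop q (emit 14 [2] ;; copy 3 0 q 14) ;; emit 14 [1]"

lemma App_encP:
  assumes "fst (s q) = map bit_sym w" "q \<noteq> 14"
  shows "App (encP q) 14 s (map bit_sym (enc_word w))"
proof -
  have "App (loop q (emit 14 [2] ;; copy 3 0 q 14)) 14 s (concat (map (\<lambda>v. [2] @ [v]) (map bit_sym w)))"
  proof (rule App_loop_word[where s = s and q = q, OF assms(1)])
    fix i t assume i: "i < length (map bit_sym w)" and t: "t q = (map bit_sym w, i)"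
    have r: "rd (den (emit 14 [2]) t) q = bit_sym (w ! i)"
      using t i assms(2) by (simp add: rd_def rdw_def den_untouched)
    then have "App (copy 3 0 q 14) 14 (den (emit 14 [2]) t) [bit_sym (w ! i) + 0]"
      using App_copy[OF assms(2), of "den (emit 14 [2]) t" 3 0] by (simp add: bit_sym_def split: if_splits)
    then show "App (emit 14 [2] ;; copy 3 0 q 14) 14 t ([2] @ [map bit_sym w ! i])"
      using i by (intro App_Then App_emit) simp
  qed (use assms in auto)
  moreover have "concat (map (\<lambda>v. [2] @ [v]) (map bit_sym w)) @ [1] = map bit_sym (enc_word w)"
    by (induction w) (simp_all add: enc_word_simps bit_sym_True)
  ultimately show ?thesis unfolding encP_def by (metis App_Then App_emit)
qed

lemma fp_enc_word: "fp_on UNIV enc_word"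
proof (rule fp_on_out)
  show "polyprog (encP 0)" by (rule polyprog_static) (simp add: encP_def)
  show "App (encP 0) 14 (init_regs x) (map bit_sym (enc_word x))" for x by (rule App_encP) simp_all
qed (simp add: encP_def)

text \<open>In state 2 a marker is expected, in state 3 a bit, and in state 4 something to be ignored.\<close>

fun unlist :: "nat \<Rightarrow> bool list \<Rightarrow> bool list" where
  "unlist st [] = []"
| "unlist st (a # z) = (if st = 2 then unlist (if a then 3 else 4) z else if st = 3 then a # unlist 2 z
    else unlist 2 z)"

lemma unlist_enc_word: "unlist 2 (enc_word x @ [False]) = x"
  by (induction x) (simp_all add: enc_word_simps)

text \<open>The state is the head position on the word \<open>[2, 3, 4]\<close> in register 20:
  \<open>Adv\<close> leads from 2 to 3 and on to 4, and \<open>Rewind\<close> leads back to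
  2.\<close>

definition unlistP :: prog where
  "unlistP = emit 20 [2, 3, 4] ;; Rewind 20 ;; loop 0 (IfR (\<lambda>rd. rd 20 = 2) (Adv 20 ;; IfR (\<lambda>rd. rd 0 =
      2) Skip (Adv 20))
     (IfR (\<lambda>rd. rd 20 = 3) (copy 3 0 0 14) Skip ;; Rewind 20))"

lemma fp_unlist: "fp_on UNIV (unlist 2)"
proof (rule fp_on_out)
  show "polyprog unlistP" by (rule polyprog_static) (simp add: unlistP_def)
  show "okp unlistP" by (simp add: unlistP_def)
  fix x
  let ?b = "IfR (\<lambda>rd. rd 20 = 2) (Adv 20 ;; IfR (\<lambda>rd. rd 0 = 2) Skip (Adv 20))
     (IfR (\<lambda>rd. rd 20 = 3) (copy 3 0 0 14) Skip ;; Rewind 20)"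
  define s where "s = den (emit 20 [2, 3, 4] ;; Rewind 20) (init_regs x)"
  have s: "s 20 = ([2, 3, 4], 0)" "s 0 = (map bit_sym x, 0)" "s 14 = ([], 0)"
    using App_den[OF App_emit[of 20 "[2,3,4]" "init_regs x"]] by (simp_all add: s_def at_end_def
        den_untouched)
  define I where "I i t \<longleftrightarrow> (\<exists>st \<in> {2, 3, 4}. t 20 = ([2, 3, 4], st - 2) \<and> at_end t 14 \<and>
     fst (t 14) @ map bit_sym (unlist st (drop i x)) = map bit_sym (unlist 2 x))" for i t
  have "I (length (fst (s 0))) (den (loop 0 ?b) s)"
  proof (rule loop_inv)
    show "I 0 (s(0 := (fst (s 0), 0)))" unfolding I_def by (rule bexI[of _ 2]) (simp_all add: s at_end_def)
    fix i t assume i: "i < length (fst (s 0))" and I: "I i t" and t: "t 0 = (fst (s 0), i)"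
    have i': "i < length x" using i s by simp
    have r: "rd t 0 = bit_sym (x ! i)" using t i' s by (simp add: rd_def rdw_def)
    have d: "drop i x = x ! i # drop (Suc i) x" using i' by (simp add: Cons_nth_drop_Suc)
    from I obtain st where st: "st \<in> {2, 3, 4}" "t 20 = ([2, 3, 4], st - 2)" "at_end t 14"
      "fst (t 14) @ map bit_sym (unlist st (drop i x)) = map bit_sym (unlist 2 x)" unfolding I_def by blast
    have r1: "rd t 20 = st" using st by (auto simp: rd_def rdw_def)
    consider "st = 2" "x ! i" | "st = 2" "\<not> x ! i" | "st = 3" | "st = 4" using st(1) by auto
    then show "I (Suc i) ((den ?b t)(0 := (fst (s 0), Suc i)))"
    proof cases
      case 1
      then show ?thesis using st r r1 d unfolding I_def
        by (intro bexI[of _ 3]) (simp_all add: rd_def adv_def bit_sym_def at_end_def)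
    next
      case 2
      then show ?thesis using st r r1 d unfolding I_def
        by (intro bexI[of _ 4]) (simp_all add: rd_def adv_def bit_sym_def at_end_def)
    next
      case 3
      have "App (copy 3 0 0 14) 14 t [bit_sym (x ! i) + 0]"
        using App_copy[of 0 14 t 3 0] r by (simp add: bit_sym_def split: if_splits)
      then have "den (copy 3 0 0 14) t 14 = (fst (t 14) @ [bit_sym (x ! i)], Suc (length (fst (t 14))))"
        using st(3) by (simp add: App_def)
      then show ?thesis using 3 st r r1 d unfolding I_def
        by (intro bexI[of _ 2]) (simp_all add: at_end_def den_untouched)
    next
      case 4
      then show ?thesis using st r r1 d unfolding I_def
        by (intro bexI[of _ 2]) (simp_all add: at_end_def)
    qed
  qed simp
  then have "at_end (den unlistP (init_regs x)) 14" "fst (den unlistP (init_regs x) 14) = map bit_sym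
      (unlist 2 x)"
    using s by (auto simp: I_def unlistP_def s_def)
  then show "App unlistP 14 (init_regs x) (map bit_sym (unlist 2 x))"
    by (simp add: App_def at_end_def prod_eq_iff)
qed

text \<open>The theorem assumes that the classes differ, so a contradiction requires both
  inclusions. The verifier decodes the input from the pair and decides it. With the zero polynomial
  as bound, the only certificate is the empty word, whose code is \<open>[False]\<close>.\<close>

lemma P_subset_NP: "class_P \<subseteq> class_NP"
proof
  fix L assume "L \<in> class_P"
  then have L: "fp_on UNIV (\<lambda>x. [x \<in> L])" by (simp add: class_P_def fp_on_def)
  define V where "V = {z. unlist 2 z \<in> L}"
  have "fp_on UNIV (\<lambda>z. [unlist 2 z \<in> L])" using fp_on_compose[OF fp_unlist L] by simp
  then have V: "V \<in> class_P" by (simp add: class_P_def fp_on_def V_def)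
  have e: "enc_word [] = [False]" by (simp add: enc_word_def)
  have "x \<in> L \<longleftrightarrow> (\<exists>y. length y \<le> poly 0 (length x) \<and> enc_prod enc_word enc_word (x, y) \<in> V)" for x
    by (simp add: enc_prod_def e V_def unlist_enc_word)
  with V show "L \<in> class_NP" unfolding class_NP_def by blast
qed

text \<open>Evaluation in unary at the length of register 0. The update of \<open>u\<close> to
  \<open>a + n * u\<close> would make \<open>u\<close> grow while it controls a loop; it therefore
  goes through register 3, in two separate phases.\<close>

primrec horner :: "nat list \<Rightarrow> nat \<Rightarrow> prog" where
  "horner [] u = Clear u"
| "horner (a # as) u = horner as u ;; (Clear 3 ;; loop 0 (loop u (Put 3 2)) ;; emit 3 (replicate a 2)) ;;
     (Clear u ;; loop 3 (Put u 2))"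

lemma sets_horner:
  "touch (horner as u) \<subseteq> {0, 3, u}" "mods (horner as u) \<subseteq> {3, u}"
  "u \<noteq> 0 \<Longrightarrow> u \<noteq> 3 \<Longrightarrow> okp (horner as u)" "u \<noteq> 0 \<Longrightarrow> u \<noteq> 3 \<Longrightarrow> polyprog (horner as u)"
proof -
  show "touch (horner as u) \<subseteq> {0, 3, u}" "mods (horner as u) \<subseteq> {3, u}" by (induction as) auto
  show "okp (horner as u)" if "u \<noteq> 0" "u \<noteq> 3" using that by (induction as) (auto split: if_splits)
  show "polyprog (horner as u)" if "u \<noteq> 0" "u \<noteq> 3"
  proof (induction as)
    case Nil
    show ?case by (simp add: polyprog_static)
  next
    case (Cons a as)
    have "polyprog (Clear 3 ;; loop 0 (loop u (Put 3 2)) ;; emit 3 (replicate a 2))" "polyprog (Clear u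
        ;; loop 3 (Put u 2))"
      using that by (auto intro!: polyprog_static split: if_splits)
    with Cons show ?case by (auto intro!: polyprog_Then)
  qed
qed

lemma concat_replicate_const: "concat (replicate n (replicate m c)) = replicate (n * m) c"
  by (induction n) (simp_all add: replicate_add)

lemma den_horner:
  assumes "u \<noteq> 0" "u \<noteq> 3"
  shows "fst (den (horner as u) s u) = replicate (poly (Poly as) (length (fst (s 0)))) 2"
proof (induction as arbitrary: s)
  case (Cons a as)
  let ?n = "length (fst (s 0))" and ?v = "poly (Poly as) (length (fst (s 0)))"
  define s1 where "s1 = (den (horner as u) s)(3 := ([], 0))"
  have s1: "fst (s1 u) = replicate ?v 2" "fst (s1 0) = fst (s 0)" "s1 3 = ([], 0)"
    using Cons.IH[of s] assms subsetD[OF sets_horner(2), of 0 as u] fst_unmod[of 0 "horner as u" s] by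
        (auto simp: s1_def)
  have inn: "App (loop u (Put 3 2)) 3 t (replicate ?v 2)" if "fst (t u) = replicate ?v 2" for t
    by (rule App_loop_word[where s = t and q = u, OF that, where g = "\<lambda>_. [2]"]) (use assms App_Put in
        \<open>auto simp: concat_replicate_const[of _ 1, simplified]\<close>)
  have 1: "App (loop 0 (loop u (Put 3 2))) 3 s1 (replicate (?n * ?v) 2)"
  proof (rule App_loop_word[where s = s1 and q = 0, OF s1(2), where g = "\<lambda>_. replicate ?v 2"])
    fix t assume "frame (loop u (Put 3 2)) 0 s1 t"
    then have "fst (t u) = replicate ?v 2" using assms s1(1) by (simp add: frame_def)
    then show "App (loop u (Put 3 2)) 3 t (replicate ?v 2)" by (rule inn)
  qed (use assms in \<open>auto simp: concat_replicate_const map_replicate_const\<close>)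
  define s2 where "s2 = den (loop 0 (loop u (Put 3 2)) ;; emit 3 (replicate a 2)) s1"
  have "App (loop 0 (loop u (Put 3 2)) ;; emit 3 (replicate a 2)) 3 s1 (replicate (?n * ?v) 2 @ replicate
      a 2)"
    by (rule App_Then[OF 1 App_emit])
  from App_den[OF this] have s2: "fst (s2 3) = replicate (a + ?n * ?v) 2"
    using s1(3) by (simp add: s2_def at_end_def add.commute flip: replicate_add)
  have "App (loop 3 (Put u 2)) u (s2(u := ([], 0))) (replicate (a + ?n * ?v) 2)"
    by (rule App_loop_word[where g = "\<lambda>_. [2]" and w = "replicate (a + ?n * ?v) 2"])
      (use s2 assms App_Put in \<open>auto simp: concat_replicate_const[of _ 1, simplified]\<close>)
  from App_den[OF this] have "fst (den (loop 3 (Put u 2)) (s2(u := ([], 0))) u) = replicate (a + ?n * ?v) 2"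
    by (simp add: at_end_def)
  then show ?case by (simp add: s2_def s1_def Cons.IH)
qed simp

section \<open>Programs for the labels and for the table of relations\<close>

definition rowP :: prog where
  "rowP = emit 4 [1, 2] ;; loop 2 (emit 4 [3, 3]) ;; emit 4 [4] ;;
     loop 0 (emit 4 [6] ;; IfR (\<lambda>rd. rd 0 = 2) (emit 4 [6]) (emit 4 [5])) ;; emit 4 [5, 7] ;;
     loop 19 (emit 4 [8, 9]) ;; emit 4 [10] ;; loop 2 (emit 4 [3, 3]) ;; emit 4 [11]"

definition relP :: prog where
  "relP = emit 9 [1, 2] ;; loop 2 (emit 9 [6, 6, 6, 6]) ;; loop 0 (emit 9 [6, 6]) ;; loop 19 (emit 9 [6,
      6]) ;;
     emit 9 [6, 6, 6, 6, 3, 4, 5]"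

text \<open>The target is a parameter because three nested loops run over the same labels: a loop
  may not touch its controlling register in its body, so each loop needs a copy of its own.\<close>

definition labsP :: "nat \<Rightarrow> prog" where
  "labsP r = loop 4 (copy 12 0 4 r) ;; loop 2 (loop 4 (copy 12 16 4 r)) ;; loop 4 (copy 12 32 4 r)"

lemma App_loop_const:
  assumes "length (fst (s q)) = n" "r \<noteq> q" "ws = concat (replicate n us)"
  shows "App (loop q (emit r us)) r s ws"
  by (rule App_loop_word[where s = s and q = q, OF refl, where g = "\<lambda>_. us"]) (use assms App_emit in
      \<open>auto simp: map_replicate_const\<close>)

lemma App_rowP:
  assumes "fst (s 0) = map bit_sym x" "fst (s 19) = replicate P 2" "fst (s 2) = replicate T 2"
  shows "App rowP 4 s (row0 x P T)"
proof -
  have L2: "App (loop 2 (emit 4 [3, 3])) 4 t (replicate (2 * T) 3)" if "fst (t 2) = replicate T 2" for t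
  proof -
    have e: "[3, 3] = replicate 2 (3 :: nat)" by (simp add: numeral_2_eq_2)
    show ?thesis unfolding e
      by (intro App_loop_const[where n = T]) (simp_all add: that concat_replicate_const mult.commute)
  qed
  have L19: "App (loop 19 (emit 4 [8, 9])) 4 t (concat (replicate P [8, 9]))" if "fst (t 19) = replicate
      P 2" for t
    by (intro App_loop_const[where n = P]) (simp_all add: that)
  have L0: "App (loop 0 (emit 4 [6] ;; IfR (\<lambda>rd. rd 0 = 2) (emit 4 [6]) (emit 4 [5]))) 4 t
      (concat (map (\<lambda>v. [6] @ (if v = 2 then [6] else [5])) (map bit_sym x)))" if "fst (t 0) = map
          bit_sym x" for t
  proof (rule App_loop_word[where s = t and q = 0, OF that])
    fix i and u :: regs assume i: "i < length (map bit_sym x)" and u: "u 0 = (map bit_sym x, i)"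
    have "rd (den (emit 4 [6]) u) 0 = map bit_sym x ! i"
      using u i by (simp add: rd_def rdw_def den_untouched)
    then have "App (IfR (\<lambda>rd. rd 0 = 2) (emit 4 [6]) (emit 4 [5])) 4 (den (emit 4 [6]) u) (if map bit_sym
        x ! i = 2 then [6] else [5])"
      using App_IfR[of "\<lambda>rd. rd 0 = 2" "den (emit 4 [6]) u" "emit 4 [6]" 4 "[6]" "emit 4 [5]" "[5]"]
          App_emit by auto
    then show "App (emit 4 [6] ;; IfR (\<lambda>rd. rd 0 = 2) (emit 4 [6]) (emit 4 [5])) 4 u
       ([6] @ (if map bit_sym x ! i = 2 then [6] else [5]))"
      by (intro App_Then App_emit)
  qed simp_all
  have e: "concat (map (\<lambda>v. [6] @ (if v = 2 then [6] else [5])) (map bit_sym x)) @ [5, 7] =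
     map (\<lambda>b. if b then 6 else 5 :: nat) (enc_word x) @ [7]"
    by (induction x) (simp_all add: enc_word_simps bit_sym_def)
  have "App rowP 4 s ([1, 2] @ replicate (2 * T) 3 @ [4] @
    concat (map (\<lambda>v. [6] @ (if v = 2 then [6] else [5])) (map bit_sym x)) @ [5, 7] @
     concat (replicate P [8, 9]) @ [10] @ replicate (2 * T) 3 @ [11])"
    unfolding rowP_def by (intro App_Then App_emit L2 L19 L0) (simp_all add: fst_unmod assms)
  also have "[1, 2] @ replicate (2 * T) 3 @ [4] @
    concat (map (\<lambda>v. [6] @ (if v = 2 then [6] else [5])) (map bit_sym x)) @ [5, 7] @
     concat (replicate P [8, 9]) @ [10] @ replicate (2 * T) 3 @ [11] = row0 x P T"
    using arg_cong[OF e, of "\<lambda>l. l @ concat (replicate P [8, 9]) @ [10] @ replicate (2 * T) 3 @ [11]"]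
    by (simp add: row0_def)
  finally show ?thesis .
qed

text \<open>The groups of symbols 6 reflect
  \<open>W - 3 = 4 * T + 2 * length x + 2 * P + 4\<close>.\<close>

lemma App_relP:
  assumes "fst (s 0) = map bit_sym x" "fst (s 19) = replicate P 2" "fst (s 2) = replicate T 2"
  shows "App relP 9 s (relpos (length (row0 x P T)))"
proof -
  let ?n = "length x"
  have L: "App (loop q (emit 9 (replicate m 6))) 9 t (replicate (n * m) 6)" if "length (fst (t q)) = n"
      "q \<noteq> 9" for t n m q
    using that by (intro App_loop_const[where n = n]) (simp_all add: concat_replicate_const)
  have "App relP 9 s ([1, 2] @ replicate (T * 4) 6 @ replicate (?n * 2) 6 @ replicate (P * 2) 6 @ [6, 6,
      6, 6, 3, 4, 5])"
  proof -
    have e: "[6, 6, 6, 6] = replicate 4 (6 :: nat)" "[6, 6] = replicate 2 (6 :: nat)" by (simp_all add: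
        numeral_eq_Suc)
    show ?thesis unfolding relP_def e(1) unfolding e(2)
      by (intro App_Then App_emit L) (simp_all add: fst_unmod assms)
  qed
  also have "[1, 2] @ replicate (T * 4) 6 @ replicate (?n * 2) 6 @ replicate (P * 2) 6 @ [6, 6, 6, 6, 3,
      4, 5] =
     relpos (length (row0 x P T))"
  proof -
    have "length (row0 x P T) - 3 = T * 4 + ?n * 2 + P * 2 + 4" by (simp add: length_row0 length_enc_word)
    moreover have "replicate 4 (6::nat) = [6, 6, 6, 6]" by (simp add: numeral_eq_Suc)
    ultimately show ?thesis by (simp add: relpos_def replicate_add)
  qed
  finally show ?thesis .
qed

lemma App_labsP:
  assumes "fst (s 4) = rw" "\<forall>v \<in> set rw. 0 < v \<and> v < 12" "fst (s 2) = replicate T 2" "r \<noteq> 2" "r \<noteq> 4"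
  shows "App (labsP r) r s (labs T rw)"
proof -
  have C: "App (loop 4 (copy 12 c 4 r)) r t (map (\<lambda>v. v + c) rw)" if "fst (t 4) = rw" for t c
    using App_copy_loop[of 4 r t 12 c] assms that by simp
  have L: "App (loop 2 (loop 4 (copy 12 16 4 r))) r t (concat (replicate T (map (\<lambda>v. v + 16) rw)))"
    if "fst (t 4) = rw" "fst (t 2) = replicate T 2" for t
  proof (rule App_loop_word[where s = t and q = 2, OF that(2), where g = "\<lambda>_. map (\<lambda>v. v + 16) rw"])
    fix u assume "frame (loop 4 (copy 12 16 4 r)) 2 t u"
    then show "App (loop 4 (copy 12 16 4 r)) r u (map (\<lambda>v. v + 16) rw)"
      using assms that by (intro C) (simp add: frame_def)
  qed (use assms in \<open>simp_all add: map_replicate_const\<close>)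
  have "App (labsP r) r s (map (\<lambda>v. v + 0) rw @ concat (replicate T (map (\<lambda>v. v + 16) rw)) @ map (\<lambda>v. v +
      32) rw)"
    unfolding labsP_def using assms by (intro App_Then C L) (simp_all add: fst_unmod)
  then show ?thesis by (simp add: labs_def)
qed

section \<open>Writing the time series\<close>

text \<open>Splits an index into a location, over which the program loops, and a tile, over which it
  is unrolled.\<close>

lemma concat_upt_mult: "concat (map f [0..<N * D]) = concat (map (\<lambda>p. concat (map (\<lambda>d. f (p * D + d))
    [0..<D])) [0..<N])"
proof (induction N)
  case (Suc N)
  have "[0..<Suc N * D] = [0..<N * D] @ [N * D..<N * D + D]"
    using upt_add_eq_append[of 0 "N * D" D] by (simp add: add.commute)
  moreover have "map f [N * D..<N * D + D] = map (\<lambda>d. f (N * D + d)) [0..<D]"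
    by (rule nth_equalityI) auto
  ultimately show ?case using Suc by simp
qed simp

lemma concat_concat: "concat (concat xss) = concat (map concat xss)"
  by (induction xss) simp_all

lemma enc_list_concat: "enc_list f xs = concat (map (\<lambda>x. True # f x) xs) @ [False]"
  by (induction xs) simp_all

text \<open>The registers \<open>a\<close> and \<open>b\<close> locate a position \<open>m\<close> that is moving from left to right relatively to \<open>n\<close>:
  as long as \<open>m < n\<close> the head of \<open>a\<close> reads a symbol, and from then on the head of \<open>b\<close> is at \<open>m - n\<close>.\<close>

definition ptr :: "nat \<Rightarrow> nat \<Rightarrow> nat \<Rightarrow> nat list \<Rightarrow> nat \<Rightarrow> regs \<Rightarrow> bool" where
  "ptr a b n w m s \<longleftrightarrow> s a = (replicate n 7, min n m) \<and> s b = (w, min (m - n) (length w))"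

definition stepP :: "nat \<Rightarrow> nat \<Rightarrow> prog" where
  "stepP a b = IfR (\<lambda>rd. rd a \<noteq> 0) (Adv a) (Adv b)"

lemma sets_stepP [simp]: "touch (stepP a b) = {a, b}" "mods (stepP a b) = {}" "loops (stepP a b) = {}"
  "grown (stepP a b) = {}" "okp (stepP a b)"
  by (auto simp: stepP_def)

lemma ptr_rd:
  assumes "ptr a b n w m s"
  shows "rd s a = 0 \<longleftrightarrow> n \<le> m" "n \<le> m \<Longrightarrow> rd s b = (if m - n < length w then w ! (m - n) else 0)"
  using assms by (auto simp: ptr_def rd_def rdw_def min_def)

lemma ptr_step: "ptr a b n w m s \<Longrightarrow> a \<noteq> b \<Longrightarrow> ptr a b n w (Suc m) (den (stepP a b) s)"
  using ptr_rd(1)[of a b n w m s] by (auto simp: ptr_def stepP_def adv_def)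

lemma ptr_cong: "ptr a b n w m s \<Longrightarrow> s' a = s a \<Longrightarrow> s' b = s b \<Longrightarrow> ptr a b n w m s'"
  by (simp add: ptr_def)

text \<open>With the one-symbol word \<open>[2]\<close> in register \<open>b\<close>, a pointer
  becomes a test for equality of positions.\<close>

lemma ptr_eq: "ptr a b n [2] m s \<Longrightarrow> rd s a = 0 \<and> rd s b = 2 \<longleftrightarrow> n = m"
  using ptr_rd[of a b n "[2]" m s] by (auto split: if_splits)

definition rat_syms :: "rat \<Rightarrow> nat list" where
  "rat_syms c = map bit_sym (enc_rat c)"

text \<open>\<open>e1\<close> and \<open>e2\<close> say whether the tile of the current coordinate
  is that of \<open>i\<close> and that of \<open>j\<close>. This is known when the program is built,
  as tiles are unrolled; whether the locations agree is tested at run time by the pointers. Both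
  hold at once on the diagonal, hence the case with the sum.\<close>

definition entryP :: "bool \<Rightarrow> bool \<Rightarrow> rat \<times> rat \<Rightarrow> prog" where
  "entryP e1 e2 c = emit 14 [2] ;; IfR (\<lambda>rd. (rd 10 = 0 \<and> rd 11 = 2) \<and> e1)
     (IfR (\<lambda>rd. (rd 12 = 0 \<and> rd 13 = 2) \<and> e2) (emit 14 (rat_syms (fst c + snd c))) (emit 14 (rat_syms
         (fst c))))
     (IfR (\<lambda>rd. (rd 12 = 0 \<and> rd 13 = 2) \<and> e2) (emit 14 (rat_syms (snd c))) (emit 14 (rat_syms 0)))"

definition vecP :: "nat \<Rightarrow> nat \<Rightarrow> nat \<Rightarrow> rat \<times> rat \<Rightarrow> prog" where
  "vecP D d d' c = Rewind 10 ;; Rewind 11 ;; Rewind 12 ;; Rewind 13 ;;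
     loop 7 (seqs (map (\<lambda>x. entryP (x = d) (x = d') c) [0..<D]) ;; stepP 10 11 ;; stepP 12 13) ;; emit 14 [1]"

lemma rat_syms_pos: "0 \<notin> set (rat_syms c)"
  by (auto simp: rat_syms_def)

lemma sets_entryP: "touch (entryP e1 e2 c) = {14}" "mods (entryP e1 e2 c) = {14}" "loops (entryP e1 e2 c)
    = {}"
  "grown (entryP e1 e2 c) = {14}" "okp (entryP e1 e2 c)"
  by (auto simp: entryP_def rat_syms_pos)

lemma sets_vecP: "touch (vecP D d d' c) \<subseteq> {7, 10, 11, 12, 13, 14}" "mods (vecP D d d' c) \<subseteq> {14}"
  "loops (vecP D d d' c) \<subseteq> {7}" "grown (vecP D d d' c) \<subseteq> {14}" "okp (vecP D d d' c)"
  by (auto simp: vecP_def sets_entryP)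

lemma App_entryP:
  assumes "ptr 10 11 p [2] m s" "ptr 12 13 p' [2] m s"
  shows "App (entryP e1 e2 (a, b)) 14 s
    (map bit_sym (True # enc_rat ((if p = m \<and> e1 then a else 0) + (if p' = m \<and> e2 then b else 0))))"
proof -
  let ?s = "den (emit 14 [2]) s"
  have 1: "ptr 10 11 p [2] m ?s" "ptr 12 13 p' [2] m ?s"
    by (rule ptr_cong[OF assms(1)]; simp add: den_untouched) (rule ptr_cong[OF assms(2)]; simp add:
        den_untouched)
  have "App (entryP e1 e2 (a, b)) 14 s ([2] @
     (if (rd ?s 10 = 0 \<and> rd ?s 11 = 2) \<and> e1 then if (rd ?s 12 = 0 \<and> rd ?s 13 = 2) \<and> e2 then rat_syms (a +
         b) else rat_syms a
      else if (rd ?s 12 = 0 \<and> rd ?s 13 = 2) \<and> e2 then rat_syms b else rat_syms 0))"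
    unfolding entryP_def fst_conv snd_conv by (intro App_Then App_emit App_IfR)
  then show ?thesis unfolding ptr_eq[OF 1(1)] ptr_eq[OF 1(2)]
    by (auto simp: rat_syms_def bit_sym_True split: if_splits)
qed

lemma App_vecP:
  assumes "length (fst (s 7)) = N" "fst (s 10) = replicate p 7" "fst (s 11) = [2]" "fst (s 12) =
      replicate p' 7"
    "fst (s 13) = [2]" "d < D" "d' < D"
  shows "App (vecP D d d' c) 14 s (map bit_sym (enc_list enc_rat (list_of_vec (gvec (N * D) (p * D + d)
      (p' * D + d') c))))"
proof -
  obtain a b where c: "c = (a, b)" by fastforce
  define h where "h = (\<lambda>l. map bit_sym (True # enc_rat ((if l = p * D + d then a else 0) + (if l = p' * D
      + d' then b else 0))))"
  let ?e = "seqs (map (\<lambda>x. entryP (x = d) (x = d') c) [0..<D])"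
  let ?b = "?e ;; stepP 10 11 ;; stepP 12 13"
  let ?s = "den (Rewind 10 ;; Rewind 11 ;; Rewind 12 ;; Rewind 13) s"
  define I where "I m t \<longleftrightarrow> ptr 10 11 p [2] m t \<and> ptr 12 13 p' [2] m t" for m t
  have te: "touch ?e \<subseteq> {14}" by (auto simp: sets_entryP)
  have E: "App ?e 14 t (concat (map (\<lambda>x. h (m * D + x)) [0..<D]))" if I: "I m t" for m t
  proof -
    let ?ps = "map (\<lambda>x. entryP (x = d) (x = d') c) [0..<D]"
    have "App (seqs ?ps) 14 t (concat (map (\<lambda>x. h (m * D + x)) [0..<length ?ps]))"
    proof (rule App_seqs)
      fix x assume x: "x < length ?ps"
      let ?t = "den (seqs (take x ?ps)) t"
      have "r \<notin> touch (seqs (take x ?ps))" if "r \<noteq> 14" for r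
        using that by (auto simp: sets_entryP dest!: in_set_takeD)
      then have "?t r = t r" if "r \<noteq> 14" for r using that by (simp add: den_untouched)
      then have "ptr 10 11 p [2] m ?t" "ptr 12 13 p' [2] m ?t"
        using I by (auto simp: I_def ptr_def)
      from App_entryP[OF this, of "x = d" "x = d'" a b] x
      have A: "App (?ps ! x) 14 ?t (map bit_sym (True # enc_rat ((if p = m \<and> x = d then a else 0) + (if
          p' = m \<and> x = d' then b else 0))))"
        by (simp add: c)
      have "m * D + x = q * D + y \<longleftrightarrow> q = m \<and> x = y" if "y < D" for q y
        using div_mod_mult_add[OF that] div_mod_mult_add[of x D m] x by (metis length_map length_upt
            minus_nat.diff_0)
      with A assms(6,7) show "App (?ps ! x) 14 ?t (h (m * D + x))" by (simp add: h_def)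
    qed
    then show ?thesis by simp
  qed
  have "App (loop 7 ?b) 14 ?s (concat (map (\<lambda>m. concat (map (\<lambda>x. h (m * D + x)) [0..<D])) [0..<length
      (fst (?s 7))]))"
  proof (rule App_loop[where I = I])
    show "7 \<notin> touch ?b" using te by auto
    show "I 0 (?s(7 := (fst (?s 7), 0)))" using assms by (simp add: I_def ptr_def)
    fix m t assume I: "I m t"
    let ?t = "den ?e t"
    have u: "?t r = t r" if "r \<noteq> 14" for r using that by (auto intro!: den_untouched simp: sets_entryP
        split: if_splits)
    have "I m ?t" using I by (simp add: I_def ptr_def u)
    then have 1: "ptr 10 11 p [2] m ?t" "ptr 12 13 p' [2] m ?t" by (auto simp: I_def)
    have 2: "ptr 10 11 p [2] (Suc m) (den (stepP 10 11) ?t)" by (rule ptr_step[OF 1(1)]) simp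
    have 3: "ptr 12 13 p' [2] m (den (stepP 10 11) ?t)" by (rule ptr_cong[OF 1(2)]) (simp_all add:
        den_untouched)
    have 4: "ptr 12 13 p' [2] (Suc m) (den ?b t)" using ptr_step[OF 3] by simp
    have 5: "ptr 10 11 p [2] (Suc m) (den ?b t)" by (rule ptr_cong[OF 2]) (simp_all add: den_untouched)
    have "App ?b 14 t (concat (map (\<lambda>x. h (m * D + x)) [0..<D]) @ [] @ [])"
      by (intro App_Then E[OF I] App_none) simp_all
    then show "App ?b 14 t (concat (map (\<lambda>x. h (m * D + x)) [0..<D])) \<and> I (Suc m) ((den ?b t)(7 := (fst
        (?s 7), Suc m)))"
      using 4 5 by (auto simp: I_def intro: ptr_cong)
  qed simp
  moreover have "length (fst (?s 7)) = N" using assms(1) by simp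
  ultimately have L: "App (loop 7 ?b) 14 ?s (concat (map h [0..<N * D]))" by (simp only: concat_upt_mult)
  have "App (vecP D d d' c) 14 s ([] @ [] @ [] @ [] @ concat (map h [0..<N * D]) @ [1])"
    unfolding vecP_def by (intro App_Then App_none App_emit) (use L in simp_all)
  moreover have "list_of_vec (gvec (N * D) (p * D + d) (p' * D + d') c) =
     map (\<lambda>l. (if l = p * D + d then a else 0) + (if l = p' * D + d' then b else 0)) [0..<N * D]"
    by (simp add: gvec_def c list_of_vec_vec)
  ultimately show ?thesis
    by (simp add: enc_list_concat map_concat h_def comp_def bit_sym_True)
qed

definition gadP :: "nat \<Rightarrow> (gadget \<Rightarrow> rat \<times> rat) \<Rightarrow> nat \<Rightarrow> nat \<Rightarrow> gtype \<Rightarrow> prog" where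
  "gadP D sel d d' ty = seqs (map (\<lambda>g. emit 14 [2] ;; vecP D d d' (sel g)) (gadgets D ty))"

lemma sets_gadP: "touch (gadP D sel d d' ty) \<subseteq> {7, 10, 11, 12, 13, 14}" "mods (gadP D sel d d' ty) \<subseteq> {14}"
  "loops (gadP D sel d d' ty) \<subseteq> {7}" "grown (gadP D sel d d' ty) \<subseteq> {14}" "okp (gadP D sel d d' ty)"
  unfolding gadP_def
  by (auto split: if_splits simp: sets_vecP(5) dest: subsetD[OF sets_vecP(1)] subsetD[OF sets_vecP(2)]
      subsetD[OF sets_vecP(3)] subsetD[OF sets_vecP(4)])

definition enc_gads :: "nat \<Rightarrow> (gadget \<Rightarrow> rat \<times> rat) \<Rightarrow> nat \<Rightarrow> nat \<Rightarrow> nat \<Rightarrow> gtype \<Rightarrow> nat list" where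
  "enc_gads D sel k i j ty = map bit_sym (concat (map (\<lambda>g. True # enc_list enc_rat (list_of_vec (gvec k i
      j (sel g)))) (gadgets D ty)))"

definition lregs :: "nat \<Rightarrow> nat \<Rightarrow> nat \<Rightarrow> regs \<Rightarrow> bool" where
  "lregs N p p' s \<longleftrightarrow> length (fst (s 7)) = N \<and> fst (s 10) = replicate p 7 \<and> fst (s 11) = [2] \<and>
     fst (s 12) = replicate p' 7 \<and> fst (s 13) = [2]"

lemma lregs_den: "lregs N p p' s \<Longrightarrow> mods b \<subseteq> {14} \<Longrightarrow> lregs N p p' (den b s)"
proof -
  assume 1: "lregs N p p' s" and "mods b \<subseteq> {14}"
  then have "fst (den b s r) = fst (s r)" if "r \<noteq> 14" for r using that by (intro fst_unmod) auto
  with 1 show ?thesis by (simp add: lregs_def)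
qed

lemma App_gadP:
  assumes "lregs N p p' s" "d < D" "d' < D"
  shows "App (gadP D sel d d' ty) 14 s (enc_gads D sel (N * D) (p * D + d) (p' * D + d') ty)"
proof -
  let ?ps = "map (\<lambda>g. emit 14 [2] ;; vecP D d d' (sel g)) (gadgets D ty)"
  let ?h = "\<lambda>g. map bit_sym (True # enc_list enc_rat (list_of_vec (gvec (N * D) (p * D + d) (p' * D + d')
      (sel g))))"
  have "App (seqs ?ps) 14 s (concat (map (\<lambda>i. ?h (gadgets D ty ! i)) [0..<length ?ps]))"
  proof (rule App_seqs)
    fix i assume i: "i < length ?ps"
    let ?t = "den (seqs (take i ?ps)) s"
    have "mods (seqs (take i ?ps)) \<subseteq> {14}" by (auto dest!: in_set_takeD subsetD[OF sets_vecP(2)])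
    then have "lregs N p p' ?t" by (rule lregs_den[OF assms(1)])
    then have "lregs N p p' (den (emit 14 [2]) ?t)" by (rule lregs_den) simp
    then have "App (emit 14 [2] ;; vecP D d d' (sel (gadgets D ty ! i))) 14 ?t ([2] @
       map bit_sym (enc_list enc_rat (list_of_vec (gvec (N * D) (p * D + d) (p' * D + d') (sel (gadgets D
           ty ! i))))))"
      using assms(2,3) unfolding lregs_def by (intro App_Then App_emit App_vecP) auto
    then show "App (?ps ! i) 14 ?t (?h (gadgets D ty ! i))" using i by (simp add: bit_sym_True)
  qed
  moreover have "map (\<lambda>i. ?h (gadgets D ty ! i)) [0..<length ?ps] = map ?h (gadgets D ty)"
    by (rule nth_equalityI) auto
  ultimately have "App (seqs ?ps) 14 s (concat (map ?h (gadgets D ty)))" by (simp only:)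
  moreover have "concat (map ?h (gadgets D ty)) = enc_gads D sel (N * D) (p * D + d) (p' * D + d') ty"
    by (simp add: enc_gads_def map_concat comp_def)
  ultimately show ?thesis by (simp add: gadP_def)
qed

definition rd_ty :: "(nat \<Rightarrow> nat \<Rightarrow> bool) \<Rightarrow> (nat \<Rightarrow> nat \<Rightarrow> nat \<Rightarrow> nat \<Rightarrow> nat \<Rightarrow> bool) \<Rightarrow> nat \<Rightarrow> nat \<Rightarrow> (nat \<Rightarrow> nat)
    \<Rightarrow> gtype" where
  "rd_ty gd bd d d' f = (if f 8 = 0 \<and> f 9 = 1 \<and> d = d' then if gd (f 5) d then Good else Bad
     else if (f 8 = 0 \<and> f 9 = 1 \<and> d < d') \<or> (f 8 = 0 \<and> f 9 \<noteq> 1 \<and> bd (f 9) (f 5) d (f 6) d') then Edge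
         else Other)"

definition lab_ty :: "nat \<Rightarrow> nat \<Rightarrow> (nat \<Rightarrow> nat \<Rightarrow> bool) \<Rightarrow> (nat \<Rightarrow> nat \<Rightarrow> nat \<Rightarrow> nat \<Rightarrow> nat \<Rightarrow> bool) \<Rightarrow> nat list \<Rightarrow>
    nat \<Rightarrow> nat \<Rightarrow> gtype" where
  "lab_ty D W gd bd lb = csp_ty D (\<lambda>p d. gd (lb ! p) d) (\<lambda>p p' d d'. bd (rel W (p' - p)) (lb ! p) d (lb !
      p') d')"

text \<open>A blank under the head of register 8 says that the location of \<open>i\<close> is not
  behind that of \<open>j\<close>, so the difference looked up in register 9 is meaningful. The code
  1 occurs in \<open>relpos W\<close> only at position 0, hence reading it means that the locations
  coincide.\<close>

lemma rd_ty:
  assumes "ptr 8 9 p (relpos W) p' t" "t 5 = (lb, p)" "t 6 = (lb, p')" "p < length lb" "p' < length lb"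
      "d < D" "d' < D" "W \<ge> 4"
  shows "rd_ty gd bd d d' (rd t) = lab_ty D W gd bd lb (p * D + d) (p' * D + d')"
proof -
  have r5: "rd t 5 = lb ! p" "rd t 6 = lb ! p'" using assms by (simp_all add: rd_def rdw_def)
  have r8: "rd t 8 = 0 \<longleftrightarrow> p \<le> p'" using ptr_rd(1)[OF assms(1)] .
  have r9: "rd t 9 = rel W (p' - p)" if "p \<le> p'" using ptr_rd(2)[OF assms(1) that] by (simp add: rel_def)
  have r1: "rel W (p' - p) = 1 \<longleftrightarrow> p' - p = 0"
  proof (cases "p' - p")
    case 0
    then show ?thesis by (simp add: rel_def relpos_def)
  next
    case (Suc n)
    have "relpos W = 1 # [2] @ replicate (W - 3) 6 @ [3, 4, 5]" by (simp add: relpos_def)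
    moreover have "\<forall>v \<in> set ([2] @ replicate (W - 3) 6 @ [3, 4, 5 :: nat]). v \<noteq> 1" by auto
    ultimately have "relpos W ! Suc n \<noteq> 1" if "Suc n < length (relpos W)" using that
      by (metis Suc_less_eq length_Cons nth_Cons_Suc nth_mem)
    then show ?thesis using Suc by (simp add: rel_def)
  qed
  have dm: "(q * D + y) div D = q \<and> (q * D + y) mod D = y" if "y < D" for q y
    using div_mod_mult_add[OF that] .
  show ?thesis
  proof (cases "p \<le> p'")
    case False
    then show ?thesis using r8 dm[OF assms(6), of p] dm[OF assms(7), of p'] by (simp add: rd_ty_def
        lab_ty_def csp_ty_def)
  next
    case True
    then show ?thesis using r8 r9 r1 dm[OF assms(6), of p] dm[OF assms(7), of p'] r5
      by (auto simp: rd_ty_def lab_ty_def csp_ty_def)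
  qed
qed

text \<open>Registers 5, 6 and 7 contain the labels of all locations; they drive the loops over the locations of
  \<open>i\<close>, of \<open>j\<close> and of the coordinates of the vectors. The loops over the tiles are unrolled. The pairs of
  registers 8 and 9, 10 and 11, 12 and 13 locate \<open>j\<close> relatively to \<open>i\<close>, and a coordinate relatively to \<open>i\<close>
  and to \<open>j\<close>. The output is written to register 14.\<close>

locale series_writer =
  fixes D :: nat and sel :: "gadget \<Rightarrow> rat \<times> rat" and gd :: "nat \<Rightarrow> nat \<Rightarrow> bool"
    and bd :: "nat \<Rightarrow> nat \<Rightarrow> nat \<Rightarrow> nat \<Rightarrow> nat \<Rightarrow> bool"
begin

definition pairP :: "nat \<Rightarrow> nat \<Rightarrow> prog" where
  "pairP d d' = IfR (\<lambda>rd. rd_ty gd bd d d' rd = Edge) (gadP D sel d d' Edge)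
     (IfR (\<lambda>rd. rd_ty gd bd d d' rd = Other) (gadP D sel d d' Other)
     (IfR (\<lambda>rd. rd_ty gd bd d d' rd = Good) (gadP D sel d d' Good) (gadP D sel d d' Bad)))"

definition rowsP :: "nat \<Rightarrow> prog" where
  "rowsP d = Rewind 8 ;; Rewind 9 ;; Clear 12 ;;
     loop 6 (seqs (map (pairP d) [0..<D]) ;; stepP 8 9 ;; End 12 ;; Put 12 7)"

text \<open>Registers 8 and 10 hold the location of \<open>i\<close> in unary and get one more
  symbol per round, as register 12 does for \<open>j\<close>. None of them controls a loop, so the
  program is static despite its nested loops.\<close>

definition seriesP :: prog where
  "seriesP = Clear 8 ;; Clear 10 ;;
     loop 5 (seqs (map rowsP [0..<D]) ;; End 8 ;; Put 8 7 ;; End 10 ;; Put 10 7) ;; emit 14 [1]"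

lemma sets_pairP: "touch (pairP d d') \<subseteq> {7, 10, 11, 12, 13, 14}" "mods (pairP d d') \<subseteq> {14}"
  "loops (pairP d d') \<subseteq> {7}" "grown (pairP d d') \<subseteq> {14}" "okp (pairP d d')"
  unfolding pairP_def using sets_gadP[of D sel d d' Edge] sets_gadP[of D sel d d' Other]
    sets_gadP[of D sel d d' Good] sets_gadP[of D sel d d' Bad] by simp_all

lemma sets_rowsP: "touch (rowsP d) \<subseteq> {6, 7, 8, 9, 10, 11, 12, 13, 14}" "mods (rowsP d) \<subseteq> {12, 14}"
  "loops (rowsP d) \<subseteq> {6, 7}" "grown (rowsP d) \<subseteq> {12, 14}" "okp (rowsP d)"
  unfolding rowsP_def by (auto simp: sets_pairP(5) dest: subsetD[OF sets_pairP(1)] subsetD[OF sets_pairP(2)]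
      subsetD[OF sets_pairP(3)] subsetD[OF sets_pairP(4)])

lemma sets_seriesP: "touch seriesP \<subseteq> {5, 6, 7, 8, 9, 10, 11, 12, 13, 14}" "mods seriesP \<subseteq> {8, 10, 12, 14}"
  "loops seriesP \<subseteq> {5, 6, 7}" "grown seriesP \<subseteq> {8, 10, 12, 14}" "okp seriesP"
  unfolding seriesP_def by (auto simp: sets_rowsP(5) dest: subsetD[OF sets_rowsP(1)] subsetD[OF sets_rowsP(2)]
      subsetD[OF sets_rowsP(3)] subsetD[OF sets_rowsP(4)])

lemma App_pairP:
  assumes "lregs N p p' s" "d < D" "d' < D" "rd_ty gd bd d d' (rd s) = ty"
  shows "App (pairP d d') 14 s (enc_gads D sel (N * D) (p * D + d) (p' * D + d') ty)"
proof -
  have "App (pairP d d') 14 s (enc_gads D sel (N * D) (p * D + d) (p' * D + d') ty) \<longleftrightarrow>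
      App (gadP D sel d d' ty) 14 s (enc_gads D sel (N * D) (p * D + d) (p' * D + d') ty)"
    using assms(4) by (cases ty) (simp_all add: pairP_def App_def)
  with App_gadP[OF assms(1-3)] show ?thesis by simp
qed

lemma App_rowsP:
  assumes s: "fst (s 6) = lb" "s 5 = (lb, p)" "p < length lb" "length (fst (s 7)) = length lb" "fst (s 8)
      = replicate p 7"
    "fst (s 9) = relpos W" "fst (s 10) = replicate p 7" "fst (s 11) = [2]" "fst (s 13) = [2]" "d < D" "W \<ge> 4"
  shows "App (rowsP d) 14 s (concat (map (\<lambda>j. enc_gads D sel (length lb * D) (p * D + d) j
     (lab_ty D W gd bd lb (p * D + d) j)) [0..<length lb * D]))"
proof -
  let ?G = "\<lambda>j. enc_gads D sel (length lb * D) (p * D + d) j (lab_ty D W gd bd lb (p * D + d) j)"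
  let ?e = "seqs (map (pairP d) [0..<D])"
  let ?b = "?e ;; stepP 8 9 ;; End 12 ;; Put 12 7"
  let ?s = "den (Rewind 8 ;; Rewind 9 ;; Clear 12) s"
  define I where "I m t \<longleftrightarrow> ptr 8 9 p (relpos W) m t \<and> fst (t 12) = replicate m 7" for m t
  have te: "touch ?e \<subseteq> {7, 10, 11, 12, 13, 14}" "mods ?e \<subseteq> {14}"
    by (auto dest: subsetD[OF sets_pairP(1)] subsetD[OF sets_pairP(2)])
  have E: "App ?e 14 t (concat (map (\<lambda>x. ?G (m * D + x)) [0..<D]))"
    if I: "I m t" and m: "m < length lb" and t: "t 6 = (lb, m)" "t 5 = (lb, p)" "lregs (length lb) p m t"
        for m t
  proof -
    let ?ps = "map (pairP d) [0..<D]"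
    have "App (seqs ?ps) 14 t (concat (map (\<lambda>x. ?G (m * D + x)) [0..<length ?ps]))"
    proof (rule App_seqs)
      fix x assume x: "x < length ?ps"
      let ?t = "den (seqs (take x ?ps)) t"
      have tt: "touch (seqs (take x ?ps)) \<subseteq> {7, 10, 11, 12, 13, 14}" "mods (seqs (take x ?ps)) \<subseteq> {14}"
        by (auto dest!: in_set_takeD dest: subsetD[OF sets_pairP(1)] subsetD[OF sets_pairP(2)])
      have u: "?t r = t r" if "r \<in> {5, 6, 8, 9}" for r using tt(1) that by (intro den_untouched) auto
      have "ptr 8 9 p (relpos W) m ?t" using I by (auto simp: I_def ptr_def u)
      then have "rd_ty gd bd d x (rd ?t) = lab_ty D W gd bd lb (p * D + d) (m * D + x)"
        by (rule rd_ty) (use x m s t u in auto)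
      moreover have "lregs (length lb) p m ?t" by (rule lregs_den[OF t(3) tt(2)])
      ultimately show "App (?ps ! x) 14 ?t (?G (m * D + x))"
        using App_pairP[of "length lb" p m ?t d x] x s(10) by simp
    qed
    then show ?thesis by simp
  qed
  have "App (loop 6 ?b) 14 ?s (concat (map (\<lambda>m. concat (map (\<lambda>x. ?G (m * D + x)) [0..<D])) [0..<length
      (fst (?s 6))]))"
  proof (rule App_loop[where I = I])
    show "6 \<notin> touch ?b" using te by auto
    show "I 0 (?s(6 := (fst (?s 6), 0)))" using s by (simp add: I_def ptr_def)
    fix m t assume m: "m < length (fst (?s 6))" and I: "I m t" and t6: "t 6 = (fst (?s 6), m)" and fr:
        "frame ?b 6 ?s t"
    have nt: "5 \<notin> touch ?b" using te by auto
    have nm: "r \<notin> mods ?b" if "r \<in> {7, 10, 11, 13}" for r using te that by auto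
    have t: "t 5 = (lb, p)" "t 6 = (lb, m)" "m < length lb" "lregs (length lb) p m t"
      using fr nt nm m t6 s I by (simp_all add: frame_def lregs_def I_def)
    let ?t = "den ?e t"
    have u: "?t r = t r" if "r \<in> {5, 6, 8, 9}" for r using te(1) that by (intro den_untouched) auto
    have "fst (?t 12) = fst (t 12)" using te(2) by (intro fst_unmod) auto
    then have f12: "fst (?t 12) = replicate m 7" using I by (simp add: I_def)
    have 1: "ptr 8 9 p (relpos W) m ?t" using I by (simp add: I_def ptr_def u)
    have 2: "ptr 8 9 p (relpos W) (Suc m) (den (stepP 8 9) ?t)" by (rule ptr_step[OF 1]) simp
    have 3: "den (stepP 8 9) ?t 12 = ?t 12" by (simp add: den_untouched)
    have "App ?b 14 t (concat (map (\<lambda>x. ?G (m * D + x)) [0..<D]) @ [] @ [] @ [])"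
      by (intro App_Then E[OF I t(3,2,1,4)] App_none) simp_all
    moreover have "I (Suc m) ((den ?b t)(6 := (fst (?s 6), Suc m)))"
      using 2 f12 by (auto simp: I_def ptr_def 3 put_def replicate_append_same)
    ultimately show "App ?b 14 t (concat (map (\<lambda>x. ?G (m * D + x)) [0..<D])) \<and> I (Suc m) ((den ?b t)(6 :=
        (fst (?s 6), Suc m)))"
      by simp
  qed simp
  moreover have "length (fst (?s 6)) = length lb" using s by simp
  ultimately have L: "App (loop 6 ?b) 14 ?s (concat (map ?G [0..<length lb * D]))" by (simp only:
      concat_upt_mult)
  have "App (rowsP d) 14 s ([] @ [] @ [] @ concat (map ?G [0..<length lb * D]))"
    unfolding rowsP_def by (intro App_Then App_none) (use L in simp_all)
  then show ?thesis by simp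
qed

lemma App_seriesP:
  assumes s: "fst (s 5) = lb" "fst (s 6) = lb" "length (fst (s 7)) = length lb"
    "fst (s 9) = relpos W" "fst (s 11) = [2]" "fst (s 13) = [2]" "W \<ge> 4"
  shows "App seriesP 14 s (map bit_sym (enc_series (map (\<lambda>(i, j, g). gvec (length lb * D) i j (sel g))
     (all_gadgets D (length lb * D) (lab_ty D W gd bd lb)))))"
proof -
  let ?k = "length lb * D" and ?ty = "lab_ty D W gd bd lb"
  let ?G = "\<lambda>i. concat (map (\<lambda>j. enc_gads D sel ?k i j (?ty i j)) [0..<?k])"
  let ?e = "seqs (map rowsP [0..<D])"
  let ?b = "?e ;; End 8 ;; Put 8 7 ;; End 10 ;; Put 10 7"
  let ?s = "den (Clear 8 ;; Clear 10) s"
  define I where "I m t \<longleftrightarrow> fst (t 8) = replicate m 7 \<and> fst (t 10) = replicate m 7" for m and t :: regs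
  have te: "touch ?e \<subseteq> {6, 7, 8, 9, 10, 11, 12, 13, 14}" "mods ?e \<subseteq> {12, 14}"
    by (auto dest: subsetD[OF sets_rowsP(1)] subsetD[OF sets_rowsP(2)])
  have E: "App ?e 14 t (concat (map (\<lambda>x. ?G (m * D + x)) [0..<D]))"
    if I: "I m t" and m: "m < length lb" and t: "t 5 = (lb, m)" "fst (t 6) = lb" "length (fst (t 7)) =
        length lb"
      "fst (t 9) = relpos W" "fst (t 11) = [2]" "fst (t 13) = [2]" for m t
  proof -
    let ?ps = "map rowsP [0..<D]"
    have "App (seqs ?ps) 14 t (concat (map (\<lambda>x. ?G (m * D + x)) [0..<length ?ps]))"
    proof (rule App_seqs)
      fix x assume x: "x < length ?ps"
      let ?t = "den (seqs (take x ?ps)) t"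
      have tt: "touch (seqs (take x ?ps)) \<subseteq> {6, 7, 8, 9, 10, 11, 12, 13, 14}" "mods (seqs (take x ?ps)) \<subseteq>
          {12, 14}"
        by (auto dest!: in_set_takeD dest: subsetD[OF sets_rowsP(1)] subsetD[OF sets_rowsP(2)])
      have u5: "?t 5 = t 5" using tt(1) by (intro den_untouched) auto
      have u: "fst (?t r) = fst (t r)" if "r \<noteq> 12" "r \<noteq> 14" for r using tt(2) that by (intro fst_unmod) auto
      have "App (rowsP x) 14 ?t (?G (m * D + x))"
        by (rule App_rowsP) (use x m s t u5 u I in \<open>auto simp: I_def\<close>)
      then show "App (?ps ! x) 14 ?t (?G (m * D + x))" using x by simp
    qed
    then show ?thesis by simp
  qed
  have "App (loop 5 ?b) 14 ?s (concat (map (\<lambda>m. concat (map (\<lambda>x. ?G (m * D + x)) [0..<D])) [0..<length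
      (fst (?s 5))]))"
  proof (rule App_loop[where I = I])
    show "5 \<notin> touch ?b" using te by auto
    show "I 0 (?s(5 := (fst (?s 5), 0)))" by (simp add: I_def)
    fix m t assume m: "m < length (fst (?s 5))" and I: "I m t" and t5: "t 5 = (fst (?s 5), m)" and fr:
        "frame ?b 5 ?s t"
    have nm: "r \<notin> mods ?b" if "r \<in> {6, 7, 9, 11, 13}" for r using te that by auto
    have t: "t 5 = (lb, m)" "m < length lb" "fst (t 6) = lb" "length (fst (t 7)) = length lb"
      "fst (t 9) = relpos W" "fst (t 11) = [2]" "fst (t 13) = [2]"
      using fr nm m t5 s by (simp_all add: frame_def)
    let ?t = "den ?e t"
    have u: "fst (?t r) = fst (t r)" if "r \<noteq> 12" "r \<noteq> 14" for r using te(2) that by (intro fst_unmod) auto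
    have "App ?b 14 t (concat (map (\<lambda>x. ?G (m * D + x)) [0..<D]) @ [] @ [] @ [] @ [])"
      by (intro App_Then E[OF I t(2,1,3,4,5,6,7)] App_none) simp_all
    moreover have "I (Suc m) ((den ?b t)(5 := (fst (?s 5), Suc m)))"
      using I u[of 8] u[of 10] by (simp add: I_def put_def replicate_append_same)
    ultimately show "App ?b 14 t (concat (map (\<lambda>x. ?G (m * D + x)) [0..<D])) \<and> I (Suc m) ((den ?b t)(5 :=
        (fst (?s 5), Suc m)))"
      by simp
  qed simp
  moreover have "length (fst (?s 5)) = length lb" using s by simp
  ultimately have L: "App (loop 5 ?b) 14 ?s (concat (map ?G [0..<?k]))" by (simp only: concat_upt_mult)
  have "App seriesP 14 s ([] @ [] @ concat (map ?G [0..<?k]) @ [1])"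
    unfolding seriesP_def by (intro App_Then App_none App_emit) (use L in simp_all)
  moreover have "concat (map ?G [0..<?k]) @ [1] = map bit_sym (enc_series (map (\<lambda>(i, j, g). gvec ?k i j
      (sel g))
     (all_gadgets D ?k ?ty)))"
    by (simp add: enc_series_def enc_list_concat all_gadgets_def enc_gads_def map_concat comp_def
        bit_sym_True concat_concat)
  ultimately show ?thesis by simp
qed

lemma polyprog_seriesP: "polyprog seriesP"
  by (rule polyprog_static) (auto dest!: subsetD[OF sets_seriesP(3)] subsetD[OF sets_seriesP(4)])

end

section \<open>Writing the dimension and the threshold\<close>

fun inc :: "nat list \<Rightarrow> nat list" where
  "inc [] = [2]"
| "inc (v # w) = (if v = 2 then 1 # inc w else 2 # w)"

lemma bits_0 [simp]: "bits 0 = []"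
  by (simp add: bits.simps)

lemma bits_Suc: "map bit_sym (bits (Suc m)) = inc (map bit_sym (bits m))"
proof (induction m rule: less_induct)
  case (less m)
  show ?case
  proof (cases "m = 0")
    case True
    then show ?thesis by (simp add: bits.simps[of "Suc 0"] bit_sym_def)
  next
    case False
    show ?thesis
    proof (cases "even m")
      case True
      then show ?thesis using False bits.simps[of m] bits.simps[of "Suc m"] by (simp add: bit_sym_def)
    next
      case odd: False
      have "map bit_sym (bits (Suc (m div 2))) = inc (map bit_sym (bits (m div 2)))"
        using False by (intro less.IH) simp
      moreover have "Suc m div 2 = Suc (m div 2)" using odd by presburger
      ultimately show ?thesis using False odd bits.simps[of m] bits.simps[of "Suc m"] by (simp add:
          bit_sym_True)
    qed
  qed
qed

lemma length_bits: "length (bits m) \<le> m"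
proof (induction m rule: less_induct)
  case (less m)
  show ?case
  proof (cases "m = 0")
    case False
    then have "length (bits (m div 2)) \<le> m div 2" by (intro less.IH) simp
    then show ?thesis using False bits.simps[of m] by simp
  qed simp
qed

lemma inc_replicate: "inc (replicate i 2 @ v) = replicate i 1 @ inc v"
  by (induction i) simp_all

text \<open>The binary word in register 17 grows and may not control a loop, so register 16 supplies
  the rounds. Register 18 holds \<open>[2]\<close> and serves as the carry flag: its head reads 2
  while the carry is pending and a blank once it has been absorbed.\<close>

definition incP :: prog where
  "incP = Rewind 17 ;; Rewind 18 ;; loop 16 (IfR (\<lambda>rd. rd 18 = 2)
     (IfR (\<lambda>rd. rd 17 = 2) (Put 17 1) (Put 17 2 ;; Adv 18)) Skip)"

definition bitsP :: prog where
  "bitsP = emit 18 [2] ;; loop 15 incP"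

lemma den_incP:
  assumes "fst (s 17) = w" "fst (s 18) = [2]" "length w < length (fst (s 16))"
  shows "fst (den incP s 17) = inc w"
proof -
  let ?b = "IfR (\<lambda>rd. rd 18 = 2) (IfR (\<lambda>rd. rd 17 = 2) (Put 17 1) (Put 17 2 ;; Adv 18)) Skip"
  let ?s = "den (Rewind 17 ;; Rewind 18) s"
  \<comment> \<open>Either the carry is pending and the first \<open>i\<close> bits, all ones, have
    been turned into zeros, or register 17 already holds the result.\<close>
  define J where "J i t \<longleftrightarrow> (t 18 = ([2], 0) \<and> (\<exists>v. w = replicate i 2 @ v \<and> t 17 = (replicate i 1 @ v, i))) \<or>
     (t 18 = ([2], 1) \<and> fst (t 17) = inc w)" for i and t :: regs
  have "J (length (fst (?s 16))) (den (loop 16 ?b) ?s)"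
  proof (rule loop_inv)
    show "J 0 (?s(16 := (fst (?s 16), 0)))" using assms by (simp add: J_def)
    fix i t assume "J i t"
    then consider v where "t 18 = ([2], 0)" "w = replicate i 2 @ v" "t 17 = (replicate i 1 @ v, i)" |
      "t 18 = ([2], 1)" "fst (t 17) = inc w" unfolding J_def by blast
    then show "J (Suc i) ((den ?b t)(16 := (fst (?s 16), Suc i)))"
    proof cases
      case 1
      show ?thesis
      proof (cases v)
        case Nil
        then show ?thesis using 1 inc_replicate[of i v] by (simp add: J_def rd_def rdw_def put_def
            adv_def nth_append)
      next
        case (Cons a v')
        show ?thesis
        proof (cases "a = 2")
          case True
          have "w = replicate (Suc i) 2 @ v'" using 1 Cons True by (simp add: replicate_app_Cons_same)
          moreover have "((den ?b t)(16 := (fst (?s 16), Suc i))) 17 = (replicate (Suc i) 1 @ v', Suc i)"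
            using 1 Cons True by (simp add: rd_def rdw_def put_def nth_append replicate_app_Cons_same)
          moreover have "((den ?b t)(16 := (fst (?s 16), Suc i))) 18 = ([2], 0)"
            using 1 Cons True by (simp add: rd_def rdw_def nth_append)
          ultimately show ?thesis unfolding J_def by blast
        next
          case False
          then show ?thesis using 1 Cons inc_replicate[of i v] by (simp add: J_def rd_def rdw_def put_def
              adv_def nth_append)
        qed
      qed
    next
      case 2
      then show ?thesis by (simp add: J_def rd_def rdw_def)
    qed
  qed simp
  \<comment> \<open>The carry cannot survive all rounds, since there are more rounds than
    bits.\<close>
  moreover have "\<not> (\<exists>v. w = replicate (length (fst (s 16))) 2 @ v)"
    using assms(3) by auto
  ultimately have "fst (den (loop 16 ?b) ?s 17) = inc w" by (auto simp: J_def)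
  then show ?thesis by (simp add: incP_def)
qed

lemma sets_incP: "touch incP = {16, 17, 18}" "mods incP = {17}" "loops incP = {16}" "grown incP = {17}"
    "okp incP"
  by (auto simp: incP_def)

lemma sets_bitsP: "touch bitsP = {15, 16, 17, 18}" "mods bitsP = {17, 18}" "okp bitsP" "polyprog bitsP"
  by (auto simp: bitsP_def sets_incP intro!: polyprog_static)

text \<open>Counts from 0 to \<open>n\<close> in binary. Before each increment the number
  \<open>i\<close> is below \<open>n\<close> and has at most \<open>i\<close> bits, so the rounds
  supplied by register 16 always suffice.\<close>

lemma den_bitsP:
  assumes "length (fst (s 15)) = n" "length (fst (s 16)) = n" "s 17 = ([], 0)" "s 18 = ([], 0)"
  shows "fst (den bitsP s 17) = map bit_sym (bits n)"
proof -
  let ?s = "den (emit 18 [2]) s"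
  have s18: "fst (?s 18) = [2]" using App_den[OF App_emit[of 18 "[2]" s]] assms(4) by (simp add: at_end_def)
  have s: "?s 15 = s 15" "?s 16 = s 16" "?s 17 = s 17" by (simp_all add: den_untouched)
  define I where "I i t \<longleftrightarrow> fst (t 17) = map bit_sym (bits i)" for i and t :: regs
  have "I (length (fst (?s 15))) (den (loop 15 incP) ?s)"
  proof (rule loop_inv)
    show "I 0 (?s(15 := (fst (?s 15), 0)))" using assms s by (simp add: I_def)
    fix i t assume i: "i < length (fst (?s 15))" and I: "I i t" and fr: "frame incP 15 ?s t"
    have "fst (t 18) = [2]" "fst (t 16) = fst (s 16)" using fr s s18 by (simp_all add: frame_def sets_incP)
    then have "fst (den incP t 17) = inc (map bit_sym (bits i))"
      using I i s assms(1,2) length_bits[of i] by (intro den_incP) (simp_all add: I_def)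
    then show "I (Suc i) ((den incP t)(15 := (fst (?s 15), Suc i)))" by (simp add: I_def bits_Suc)
  qed (simp add: sets_incP)
  then show ?thesis using s assms(1) by (simp add: I_def bitsP_def)
qed

text \<open>The bounds on the length of a certificate and on the running time are computed in unary in the
  registers 19 and 2.\<close>

definition setupP :: "nat poly \<Rightarrow> nat poly \<Rightarrow> prog" where
  "setupP p q = horner (coeffs p) 19 ;; horner (coeffs q) 2 ;; rowP ;; labsP 5 ;; labsP 6 ;; labsP 7 ;; relP"

lemma touch_setupP: "touch (setupP p q) \<subseteq> {0, 2, 3, 4, 5, 6, 7, 9, 19}"
  using sets_horner(1)[of "coeffs p" 19] sets_horner(1)[of "coeffs q" 2]
  by (auto simp: setupP_def rowP_def labsP_def relP_def)

lemma okp_setupP: "okp (setupP p q)"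
  using sets_horner(3)[of 19 "coeffs p"] sets_horner(3)[of 2 "coeffs q"]
  by (simp add: setupP_def rowP_def labsP_def relP_def)

lemma polyprog_setupP: "polyprog (setupP p q)"
proof -
  have "polyprog rowP" "polyprog relP" by (rule polyprog_static; simp add: rowP_def relP_def)+
  moreover have "polyprog (labsP r)" if "r \<noteq> 2" "r \<noteq> 4" for r
    by (rule polyprog_static) (use that in \<open>simp add: labsP_def\<close>)
  ultimately show ?thesis unfolding setupP_def by (intro polyprog_Then sets_horner(4)) simp_all
qed

lemma row0_symbols: "\<forall>v \<in> set (row0 x P T). 0 < v \<and> v < 12"
  by (auto simp: row0_def)

lemma den_setupP:
  assumes "s = den (setupP p q) (init_regs x)" "P = poly p (length x)" "T = poly q (length x)"
  shows "fst (s 5) = labs T (row0 x P T)" "fst (s 6) = labs T (row0 x P T)" "fst (s 7) = labs T (row0 x P T)"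
    "fst (s 9) = relpos (length (row0 x P T))" "r \<notin> {0, 2, 3, 4, 5, 6, 7, 9, 19} \<Longrightarrow> s r = ([], 0)"
proof -
  define s1 where "s1 = den (horner (coeffs p) 19) (init_regs x)"
  define s2 where "s2 = den (horner (coeffs q) 2) s1"
  have h: "r \<notin> mods (horner as u)" if "r \<noteq> 3" "r \<noteq> u" for r as u using sets_horner(2)[of as u] that by auto
  have h': "r \<notin> touch (horner as u)" if "r \<noteq> 3" "r \<noteq> u" "r \<noteq> 0" for r as u using sets_horner(1)[of as u]
      that by auto
  have f: "fst (s2 0) = map bit_sym x" "fst (s2 19) = replicate P 2" "fst (s2 2) = replicate T 2"
    using den_horner[of 19 "coeffs p" "init_regs x"] den_horner[of 2 "coeffs q" s1] assms(2,3)
    by (simp_all add: s2_def s1_def fst_unmod h)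
  have e: "s2 r = ([], 0)" if "r \<notin> {0, 2, 3, 19}" for r
    using that by (simp add: s2_def s1_def den_untouched h')
  define s3 where "s3 = den rowP s2"
  have tr: "touch rowP = {0, 2, 4, 19}" "mods rowP = {4}" by (auto simp: rowP_def)
  have f3: "fst (s3 4) = row0 x P T" "fst (s3 0) = map bit_sym x" "fst (s3 19) = replicate P 2" "fst (s3
      2) = replicate T 2"
    using App_den[OF App_rowP[OF f]] e[of 4] f by (simp_all add: s3_def at_end_def fst_unmod tr)
  have e3: "s3 r = ([], 0)" if "r \<notin> {0, 2, 3, 4, 19}" for r using that e by (simp add: s3_def
      den_untouched tr)
  define s4 where "s4 = den (labsP 5) s3"
  define s5 where "s5 = den (labsP 6) s4"
  define s6 where "s6 = den (labsP 7) s5"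
  have tl: "touch (labsP r) = {2, 4, r}" "mods (labsP r) = {r}" for r by (auto simp: labsP_def)
  have L: "fst (den (labsP r) t r) = labs T (row0 x P T)"
    if "fst (t 4) = row0 x P T" "fst (t 2) = replicate T 2" "t r = ([], 0)" "r \<noteq> 2" "r \<noteq> 4" for r t
    using App_den[OF App_labsP[OF that(1) row0_symbols that(2,4,5)]] that(3) by (simp add: at_end_def)
  have s6: "fst (s6 5) = labs T (row0 x P T)" "fst (s6 6) = labs T (row0 x P T)" "fst (s6 7) = labs T
      (row0 x P T)"
    "fst (s6 0) = map bit_sym x" "fst (s6 19) = replicate P 2" "fst (s6 2) = replicate T 2"
    using L[of s3 5] L[of s4 6] L[of s5 7] f3 e3
    by (simp_all add: s6_def s5_def s4_def fst_unmod den_untouched tl)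
  have s69: "s6 9 = ([], 0)" using e3 by (simp add: s6_def s5_def s4_def den_untouched tl)
  have se: "s = den relP s6" using assms(1) by (simp add: setupP_def s6_def s5_def s4_def s3_def s2_def
      s1_def)
  have tR: "mods relP = {9}" by (auto simp: relP_def)
  show "fst (s 5) = labs T (row0 x P T)" "fst (s 6) = labs T (row0 x P T)" "fst (s 7) = labs T (row0 x P T)"
    "fst (s 9) = relpos (length (row0 x P T))"
    using App_den[OF App_relP[OF s6(4,5,6)]] s69 s6 by (simp_all add: se fst_unmod tR at_end_def)
  show "s r = ([], 0)" if "r \<notin> {0, 2, 3, 4, 5, 6, 7, 9, 19}"
    using that touch_setupP[of p q] unfolding assms(1) by (subst den_untouched) auto
qed

definition dimP :: "nat \<Rightarrow> prog" where
  "dimP D = (loop 5 (emit 15 (replicate D 2)) ;; loop 5 (emit 16 (replicate D 2))) ;; bitsP ;; encP 17"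

text \<open>The factor 188 is \<open>2 * 94\<close>. The single symbol 1 is the sign of the
  numerator, \<open>enc_int 1\<close> the denominator and \<open>enc_unary 0\<close> the precision
  of the query. Two copies of the dimension in unary, in registers 21 and 22, give its square by
  nested loops.\<close>

definition thresholdP :: "nat \<Rightarrow> prog" where
  "thresholdP D = (loop 5 (emit 21 (replicate D 2)) ;; loop 5 (emit 22 (replicate D 2))) ;;
     (loop 21 (loop 22 (emit 15 (replicate 188 2))) ;; loop 21 (loop 22 (emit 16 (replicate 188 2)))) ;;
     bitsP ;; emit 14 [1] ;; encP 17 ;; emit 14 (map bit_sym (enc_int 1 @ enc_unary 0))"

lemma polyprog_encP: "polyprog (encP 17)"
  by (rule polyprog_static) (simp add: encP_def)

lemma dimP_ok: "okp (dimP D)" "polyprog (dimP D)"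
proof -
  show "okp (dimP D)" by (simp add: dimP_def sets_bitsP encP_def)
  have "polyprog (loop 5 (emit 15 (replicate D 2)) ;; loop 5 (emit 16 (replicate D 2)))"
    by (rule polyprog_static) simp
  then show "polyprog (dimP D)" unfolding dimP_def by (intro polyprog_Then[OF _ polyprog_Then] sets_bitsP
      polyprog_encP)
qed

lemma thresholdP_ok: "okp (thresholdP D)" "polyprog (thresholdP D)"
proof -
  show "okp (thresholdP D)" by (auto simp: thresholdP_def sets_bitsP encP_def)
  have "polyprog (loop 5 (emit 21 (replicate D 2)) ;; loop 5 (emit 22 (replicate D 2)))"
    by (rule polyprog_static) simp
  moreover have "polyprog (loop 21 (loop 22 (emit 15 (replicate 188 2))) ;; loop 21 (loop 22 (emit 16
      (replicate 188 2))))"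
    by (rule polyprog_static) simp
  moreover have "polyprog (emit r w)" for r w by (rule polyprog_static) simp
  ultimately show "polyprog (thresholdP D)" unfolding thresholdP_def
    by (intro polyprog_Then[OF _ polyprog_Then] polyprog_Then[of bitsP] polyprog_Then[of "emit 14 [1]"]
       polyprog_Then[of "encP 17"] sets_bitsP polyprog_encP)
qed

lemma fst_loop_const:
  assumes "t r = ([], 0)" "r \<noteq> q"
  shows "fst (den (loop q (emit r (replicate m 2))) t r) = replicate (length (fst (t q)) * m) 2"
  using App_den[OF App_loop_const[where s = t and q = q and us = "replicate m 2", OF refl assms(2) refl]]
      assms(1)
  by (simp add: at_end_def concat_replicate_const)

lemma App_dimP:
  assumes "length (fst (s 5)) * D = k" "\<And>r. r \<in> {14, 15, 16, 17, 18} \<Longrightarrow> s r = ([], 0)"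
  shows "App (dimP D) 14 s (map bit_sym (enc_nat k))"
proof -
  let ?a = "loop 5 (emit 15 (replicate D 2))" and ?b = "loop 5 (emit 16 (replicate D 2))"
  let ?s = "den (?a ;; ?b) s"
  have "fst (?s 15) = replicate k 2" "fst (?s 16) = replicate k 2"
    using fst_loop_const[of s 15 5 D] fst_loop_const[of "den ?a s" 16 5 D] assms
    by (simp_all add: fst_unmod den_untouched)
  then have "fst (den bitsP ?s 17) = map bit_sym (bits k)"
    using assms(2) by (intro den_bitsP) (simp_all add: den_untouched)
  then have "App (encP 17) 14 (den bitsP ?s) (map bit_sym (enc_word (bits k)))" by (intro App_encP) simp_all
  then have "App (dimP D) 14 s ([] @ [] @ map bit_sym (enc_word (bits k)))"
    unfolding dimP_def by (intro App_Then App_none) (simp_all add: sets_bitsP)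
  then show ?thesis by (simp add: enc_nat_def)
qed

lemma App_thresholdP:
  assumes "length (fst (s 5)) * D = k" "\<And>r. r \<in> {14, 15, 16, 17, 18, 21, 22} \<Longrightarrow> s r = ([], 0)"
  shows "App (thresholdP D) 14 s (map bit_sym (enc_rat (of_nat (188 * k\<^sup>2)) @ enc_unary 0))"
proof -
  let ?a = "loop 5 (emit 21 (replicate D 2))" and ?b = "loop 5 (emit 22 (replicate D 2))"
  let ?c = "\<lambda>r. loop 21 (loop 22 (emit r (replicate 188 2)))"
  let ?s = "den (?a ;; ?b) s"
  let ?t = "den (?c 15 ;; ?c 16) ?s"
  have s: "fst (?s 21) = replicate k 2" "fst (?s 22) = replicate k 2"
    using fst_loop_const[of s 21 5 D] fst_loop_const[of "den ?a s" 22 5 D] assms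
    by (simp_all add: fst_unmod den_untouched)
  have C: "fst (den (?c r) u r) = replicate (188 * k\<^sup>2) 2"
    if u: "fst (u 21) = replicate k 2" "fst (u 22) = replicate k 2" "u r = ([], 0)" "r \<noteq> 21" "r \<noteq> 22" for u r
  proof -
    have "App (?c r) r u (concat (map (\<lambda>_. replicate (k * 188) 2) (replicate k (2 :: nat))))"
    proof (rule App_loop_word[where s = u and q = 21, OF u(1)])
      fix v assume "frame (loop 22 (emit r (replicate 188 2))) 21 u v"
      then have "fst (v 22) = replicate k 2" using u by (simp add: frame_def)
      then show "App (loop 22 (emit r (replicate 188 2))) r v (replicate (k * 188) 2)"
        using u by (intro App_loop_const[where n = k]) (simp_all add: concat_replicate_const)
    qed (use u in simp_all)
    from App_den[OF this] show ?thesis using u(3)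
      by (simp add: at_end_def map_replicate_const concat_replicate_const power2_eq_square algebra_simps)
  qed
  have "fst (?t 15) = replicate (188 * k\<^sup>2) 2" "fst (?t 16) = replicate (188 * k\<^sup>2) 2"
    using C[of ?s 15] C[of "den (?c 15) ?s" 16] s assms(2) by (simp_all add: fst_unmod den_untouched)
  then have "fst (den bitsP ?t 17) = map bit_sym (bits (188 * k\<^sup>2))"
    using assms(2) by (intro den_bitsP) (simp_all add: den_untouched)
  then have "fst (den (emit 14 [1]) (den bitsP ?t) 17) = map bit_sym (bits (188 * k\<^sup>2))" by (simp add:
      fst_unmod)
  then have "App (encP 17) 14 (den (emit 14 [1]) (den bitsP ?t)) (map bit_sym (enc_word (bits (188 * k\<^sup>2))))"
    by (intro App_encP) simp_all
  then have A: "App (thresholdP D) 14 s ([] @ [] @ [] @ [1] @ map bit_sym (enc_word (bits (188 * k\<^sup>2))) @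
      map bit_sym (enc_int 1 @ enc_unary 0))"
    unfolding thresholdP_def by (intro App_Then App_none App_emit) (simp_all add: sets_bitsP)
  have "enc_rat (of_nat n) = False # enc_word (bits n) @ enc_int 1" for n
  proof -
    have "quotient_of (of_nat n) = (int n, 1)"
      using quotient_of_int[of "int n"] by (simp only: Rat.of_int_def of_int_of_nat_eq)
    then show ?thesis by (simp add: enc_rat_def enc_prod_def enc_int_def enc_nat_def)
  qed
  from this[of "188 * k\<^sup>2"] have e: "enc_rat (of_nat (188 * k\<^sup>2)) = False # enc_word (bits (188 * k\<^sup>2)) @
      enc_int 1" .
  show ?thesis unfolding e using A by (simp add: bit_sym_True)
qed

section \<open>The reduction\<close>

text \<open>Choosing for every instance a correct answer that the machine gives turns a relational
  problem into a function on codes, well defined since \<open>en\<close> is injective. Such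
  functions can be composed.\<close>

lemma solves_fp_on:
  assumes "polytime_solves en A R" "inj en"
  obtains f where "fp_on (en ` A) f" "\<And>a. a \<in> A \<Longrightarrow> R a (f (en a))"
proof -
  obtain M and p :: "nat poly" where M: "wf_tm M"
    "\<And>a. a \<in> A \<Longrightarrow> \<exists>y. outputs_within M (en a) (poly p (length (en a))) y \<and> R a y"
    using assms(1) unfolding polytime_solves_def by blast
  then obtain g where g: "\<And>a. a \<in> A \<Longrightarrow> outputs_within M (en a) (poly p (length (en a))) (g a) \<and> R a (g a)"
    by metis
  define f where "f w = g (the_inv en w)" for w
  have f: "f (en a) = g a" for a using assms(2) by (simp add: f_def the_inv_f_f)
  have "fp_on (en ` A) f" unfolding fp_on_def polytime_solves_def
    using M(1) g f by (intro exI[of _ M] exI[of _ p]) auto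
  moreover have "R a (f (en a))" if "a \<in> A" for a using g[OF that] f by simp
  ultimately show ?thesis using that by blast
qed

lemma outputs_within_mono: "outputs_within M x n y \<Longrightarrow> n \<le> n' \<Longrightarrow> outputs_within M x n' y"
  unfolding outputs_within_def by (meson order_trans)

locale reduction =
  fixes M :: tm and p q :: "nat poly"
  assumes wf: "wf_tm M"
begin

abbreviation D :: nat where
  "D \<equiv> length (tile_list M)"

definition Px :: "bool list \<Rightarrow> nat" where
  "Px x = poly p (length x)"

definition Tx :: "bool list \<Rightarrow> nat" where
  "Tx x = poly q (length x)"

definition rowx :: "bool list \<Rightarrow> nat list" where
  "rowx x = row0 x (Px x) (Tx x)"

definition labx :: "bool list \<Rightarrow> nat list" where
  "labx x = labs (Tx x) (rowx x)"

definition kx :: "bool list \<Rightarrow> nat" where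
  "kx x = (Tx x + 2) * length (rowx x) * D"

definition tyx :: "bool list \<Rightarrow> nat \<Rightarrow> nat \<Rightarrow> gtype" where
  "tyx x = csp_ty D (tile_good M (labx x)) (tile_bad M (length (rowx x)) (labx x))"

definition instx :: "bool list \<Rightarrow> series_pair" where
  "instx x = (kx x, gad_S D (kx x) (tyx x), gad_T D (kx x) (tyx x))"

abbreviation dist :: "bool list \<Rightarrow> real" where
  "dist x \<equiv> congruence_distance (kx x) (real_series (gad_S D (kx x) (tyx x))) (real_series (gad_T D (kx
      x) (tyx x)))"

lemma D_pos: "D > 0"
proof -
  have "num_syms M \<ge> 3" using wf by (simp add: wf_tm_def)
  then have "(0, replicate (num_tapes M) 0, replicate (num_tapes M) 0, replicate (num_tapes M) False) \<in>
      tiles M"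
    by (auto simp: tiles_def set_replicate_conv_if)
  then have "tile_list M \<noteq> []" using set_tile_list[of M] by force
  then show ?thesis by simp
qed

lemma instx_in: "instx x \<in> series_pairs"
proof -
  have "gvec k i j c \<in> carrier_vec k" for k i j c by (cases c) (simp add: gvec_def)
  then show ?thesis by (auto simp: series_pairs_def instx_def time_series_def gad_S_def gad_T_def)
qed

lemma length_labx: "length (labx x) * D = kx x"
  by (simp add: labx_def kx_def length_labs)

text \<open>Each component of the output recomputes the labels from \<open>x\<close>, so that
  \<open>fp_on_append\<close> can join the components.\<close>

lemma fp_phase:
  assumes "okp b" "polyprog b"
    "\<And>x. App b 14 (den (setupP p q) (init_regs x)) (map bit_sym (f x))"
  shows "fp_on UNIV f"
proof (rule fp_on_out)
  show "okp (setupP p q ;; b)" using assms(1) okp_setupP by simp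
  show "polyprog (setupP p q ;; b)" using assms(2) polyprog_setupP by (rule polyprog_Then[rotated])
  have "14 \<notin> touch (setupP p q)" using touch_setupP[of p q] by auto
  then show "App (setupP p q ;; b) 14 (init_regs x) (map bit_sym (f x))" for x
    using App_Then[OF App_none assms(3)] by simp
qed

lemma setup_regs:
  assumes "s = den (setupP p q) (init_regs x)"
  shows "fst (s 5) = labx x" "fst (s 6) = labx x" "fst (s 7) = labx x" "fst (s 9) = relpos (length (rowx x))"
    "r \<in> {11, 13, 14, 15, 16, 17, 18, 21, 22} \<Longrightarrow> s r = ([], 0)"
  using den_setupP(1-4)[OF assms Px_def Tx_def] den_setupP(5)[OF assms refl refl, of r]
  by (auto simp: labx_def rowx_def)

lemma fp_dim: "fp_on UNIV (\<lambda>x. enc_nat (kx x))"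
proof (rule fp_phase[OF dimP_ok])
  fix x
  show "App (dimP D) 14 (den (setupP p q) (init_regs x)) (map bit_sym (enc_nat (kx x)))"
    by (rule App_dimP) (use setup_regs[where x = x, OF refl] length_labx in auto)
qed

lemma fp_threshold: "fp_on UNIV (\<lambda>x. enc_rat (of_nat (188 * (kx x)\<^sup>2)) @ enc_unary 0)"
proof (rule fp_phase[OF thresholdP_ok])
  fix x
  show "App (thresholdP D) 14 (den (setupP p q) (init_regs x)) (map bit_sym (enc_rat (of_nat (188 * (kx
      x)\<^sup>2)) @ enc_unary 0))"
    by (rule App_thresholdP) (use setup_regs[where x = x, OF refl] length_labx in auto)
qed

lemma fp_series: "fp_on UNIV (\<lambda>x. enc_series (map (\<lambda>(i, j, g). gvec (kx x) i j (sel g)) (all_gadgets D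
    (kx x) (tyx x))))"
proof -
  interpret series_writer D sel "\<lambda>v d. okl M v (tile_list M ! d)"
    "\<lambda>rel va d vb d'. \<not> cross M rel va (tile_list M ! d) vb (tile_list M ! d')" .
  have ty: "lab_ty D (length (rowx x)) (\<lambda>v d. okl M v (tile_list M ! d))
    (\<lambda>rel va d vb d'. \<not> cross M rel va (tile_list M ! d) vb (tile_list M ! d')) (labx x) = tyx x" for x
    unfolding lab_ty_def tyx_def tile_good_def[abs_def] tile_bad_def[abs_def] ..
  let ?b = "emit 11 [2] ;; emit 13 [2] ;; seriesP"
  show ?thesis
  proof (rule fp_phase)
    show "okp ?b" using sets_seriesP(5) by simp
    have "polyprog (emit r [2])" for r by (rule polyprog_static) simp
    then show "polyprog ?b" by (intro polyprog_Then polyprog_seriesP)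
    fix x
    define s where "s = den (setupP p q) (init_regs x)"
    let ?t = "den (emit 13 [2]) (den (emit 11 [2]) s)"
    note s = setup_regs[OF s_def]
    have "fst (?t 13) = [2]" using App_den[OF App_emit[of 13 "[2]" "den (emit 11 [2]) s"]] s(5)[of 13]
      by (simp add: at_end_def den_untouched)
    moreover have "fst (?t 11) = [2]" using App_den[OF App_emit[of 11 "[2]" s]] s(5)[of 11]
      by (simp add: at_end_def fst_unmod)
    moreover have "length (rowx x) \<ge> 4" by (simp add: rowx_def length_row0)
    ultimately have "App seriesP 14 ?t (map bit_sym (enc_series (map (\<lambda>(i, j, g). gvec (kx x) i j (sel g))
        (all_gadgets D (kx x) (tyx x)))))"
      using App_seriesP[of ?t "labx x" "length (rowx x)"] s(1-4) unfolding length_labx ty by (simp add: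
          fst_unmod)
    then have "App ?b 14 s ([] @ [] @ map bit_sym (enc_series (map (\<lambda>(i, j, g). gvec (kx x) i j (sel g))
        (all_gadgets D (kx x) (tyx x)))))" by (intro App_Then App_none) simp_all
    then show "App ?b 14 (den (setupP p q) (init_regs x)) (map bit_sym (enc_series (map (\<lambda>(i, j, g). gvec
        (kx x) i j (sel g))
        (all_gadgets D (kx x) (tyx x)))))" by (simp add: s_def)
  qed
qed

lemma fp_instx: "fp_on UNIV (\<lambda>x. enc_series_pair (instx x))"
proof -
  have "enc_series_pair (instx x) = enc_nat (kx x) @
     enc_series (map (\<lambda>(i, j, g). gvec (kx x) i j (fst g)) (all_gadgets D (kx x) (tyx x))) @
     enc_series (map (\<lambda>(i, j, g). gvec (kx x) i j (snd g)) (all_gadgets D (kx x) (tyx x)))" for x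
    by (simp add: enc_series_pair_def enc_prod_def instx_def gad_S_def gad_T_def)
  then show ?thesis using fp_on_append[OF fp_dim fp_on_append[OF fp_series[of fst] fp_series[of snd]]] by simp
qed

text \<open>The gap of 16 is weakened to \<open>1 = 1 / 2 ^ 0\<close>, which a query of precision 0
  resolves.\<close>

lemma dist_gap:
  assumes "\<And>y. length y \<le> Px x \<Longrightarrow> outputs_within M (enc_word x @ enc_word y) (Tx x) [enc_word x @ enc_word
      y \<in> V]"
  shows "(\<exists>y. length y \<le> Px x \<and> enc_word x @ enc_word y \<in> V) \<Longrightarrow> dist x \<le> real (188 * (kx x)\<^sup>2)"
    "\<not> (\<exists>y. length y \<le> Px x \<and> enc_word x @ enc_word y \<in> V) \<Longrightarrow> dist x \<ge> real (188 * (kx x)\<^sup>2) + 1"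
proof -
  have t: "(\<exists>f. csp_sol ((Tx x + 2) * length (rowx x)) D (tile_good M (labx x))
        (tile_bad M (length (rowx x)) (labx x)) f) \<longleftrightarrow> (\<exists>y. length y \<le> Px x \<and> enc_word x @ enc_word y \<in> V)"
    unfolding labx_def rowx_def by (rule tiling_correct[OF wf assms])
  show "dist x \<le> real (188 * (kx x)\<^sup>2)" if "\<exists>y. length y \<le> Px x \<and> enc_word x @ enc_word y \<in> V"
  proof -
    from iffD2[OF t that] obtain f where "csp_sol ((Tx x + 2) * length (rowx x)) D (tile_good M (labx x))
        (tile_bad M (length (rowx x)) (labx x)) f" by blast
    from csp_sat[OF this D_pos] show ?thesis by (simp only: kx_def tyx_def of_nat_mult of_nat_power
        of_nat_numeral)
  qed
  show "dist x \<ge> real (188 * (kx x)\<^sup>2) + 1" if "\<not> (\<exists>y. length y \<le> Px x \<and> enc_word x @ enc_word y \<in> V)"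
  proof -
    from that have "\<nexists>f. csp_sol ((Tx x + 2) * length (rowx x)) D (tile_good M (labx x))
        (tile_bad M (length (rowx x)) (labx x)) f" by (simp only: t not_False_eq_True)
    from csp_unsat[OF this D_pos]
    have "188 * real (kx x) ^ 2 + 16 \<le> dist x" by (simp only: kx_def tyx_def)
    then show ?thesis by simp
  qed
qed

end

text \<open>The decision procedure is a composition: from \<open>x\<close> to the instance, to a
  name of its distance, to the query against \<open>188 * k^2\<close>, to the answer. The second and
  the last map come from the hypotheses. Queries may be answered arbitrarily strictly inside the
  gap, where no distance lies.\<close>

lemma NP_subset_P:
  assumes rep: "suitable_representation \<rho>" and comp: "d1C_computable_in_polytime \<rho>"
  shows "class_NP \<subseteq> class_P"
proof
  fix L assume "L \<in> class_NP"
  then obtain V and p :: "nat poly" where V: "V \<in> class_P"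
    and L: "\<And>x. x \<in> L \<longleftrightarrow> (\<exists>y. length y \<le> poly p (length x) \<and> enc_prod enc_word enc_word (x, y) \<in> V)"
    unfolding class_NP_def by blast
  have "fp_on UNIV (\<lambda>z. [z \<in> V])" using V by (simp add: class_P_def fp_on_def)
  then obtain M r where M: "wf_tm M" "\<And>z. outputs_within M z (poly r (length z)) [z \<in> V]"
    by (rule fp_on_machine) blast
  \<comment> \<open>The pair of an input of length \<open>n\<close> and a certificate has a code of
    length at most \<open>2 + 2 * n + 2 * poly p n\<close>; \<open>q\<close> is the time of the
    verifier on such words.\<close>
  define q where "q = pcompose r ([:2, 2:] + [:2:] * p)"
  interpret reduction M p q by unfold_locales (rule M(1))
  have run: "outputs_within M (enc_word x @ enc_word y) (Tx x) [enc_word x @ enc_word y \<in> V]" if "length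
      y \<le> Px x" for x y
  proof (rule outputs_within_mono[OF M(2)])
    have "length (enc_word x @ enc_word y) \<le> 2 + 2 * length x + 2 * poly p (length x)"
      using that by (simp add: length_enc_word Px_def)
    then show "poly r (length (enc_word x @ enc_word y)) \<le> Tx x"
      unfolding Tx_def unfolding q_def poly_pcompose by (intro poly_nat_mono) (simp add: mult.commute)
  qed
  have L': "x \<in> L \<longleftrightarrow> (\<exists>y. length y \<le> Px x \<and> enc_word x @ enc_word y \<in> V)" for x
    using L[of x] by (simp add: Px_def enc_prod_def)
  have gap: "dist x \<le> real (188 * (kx x)\<^sup>2)" if "x \<in> L" for x
    using that unfolding L' by (rule dist_gap(1)[rotated]) (rule run)
  have gap': "dist x \<ge> real (188 * (kx x)\<^sup>2) + 1" if "x \<notin> L" for x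
    using that unfolding L' by (rule dist_gap(2)[rotated]) (rule run)
  obtain f where f: "fp_on (enc_series_pair ` series_pairs) f"
    and f2: "\<And>a. a \<in> series_pairs \<Longrightarrow> (case a of (k, S, T) \<Rightarrow>
      \<lambda>y. \<rho> y = Some (congruence_distance k (real_series S) (real_series T))) (f (enc_series_pair a))"
    by (rule solves_fp_on[OF comp[unfolded d1C_computable_in_polytime_def] inj_enc_series_pair]) (rule that)
  define w where "w x = f (enc_series_pair (instx x))" for x
  have fw: "fp_on UNIV w" unfolding w_def
    by (rule fp_on_compose[OF fp_instx f]) (simp add: instx_in)
  have w: "\<rho> (w x) = Some (dist x)" for x
    using f2[OF instx_in[of x]] by (simp add: w_def instx_def)
  let ?Q = "\<lambda>x. (w x, of_nat (188 * (kx x)\<^sup>2) :: rat, 0 :: nat)"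
  obtain g where g: "fp_on (enc_query ` {(w, q, m). w \<in> dom \<rho>}) g"
    and g2: "\<And>a. a \<in> {(w, q, m). w \<in> dom \<rho>} \<Longrightarrow> (case a of (w, q, m) \<Rightarrow> \<lambda>y.
      (the (\<rho> w) \<le> real_of_rat q \<longrightarrow> y = [True]) \<and>
      (the (\<rho> w) \<ge> real_of_rat q + 1 / 2 ^ m \<longrightarrow> y = [False])) (g (enc_query a))"
    by (rule solves_fp_on[OF rep[unfolded suitable_representation_def] inj_enc_query]) (rule that)
  have "fp_on UNIV (\<lambda>x. enc_word (w x) @ enc_rat (of_nat (188 * (kx x)\<^sup>2)) @ enc_unary 0)"
    by (intro fp_on_append fp_on_compose[OF fw fp_enc_word] fp_threshold) simp
  then have "fp_on UNIV (\<lambda>x. enc_query (?Q x))" by (simp add: enc_query_def enc_prod_def)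
  from fp_on_compose[OF this g] have "fp_on UNIV (\<lambda>x. g (enc_query (?Q x)))"
    using w by auto
  moreover have "g (enc_query (?Q x)) = [x \<in> L]" for x
  proof -
    have "?Q x \<in> {(w, q, m). w \<in> dom \<rho>}" using w[of x] by auto
    from g2[OF this] w[of x]
    have "(dist x \<le> real (188 * (kx x)\<^sup>2) \<longrightarrow> g (enc_query (?Q x)) = [True]) \<and>
        (dist x \<ge> real (188 * (kx x)\<^sup>2) + 1 \<longrightarrow> g (enc_query (?Q x)) = [False])"
      by (simp only: prod.case option.sel of_rat_of_nat_eq power_0 div_by_1)
    then show ?thesis using gap[of x] gap'[of x] by (cases "x \<in> L") simp_all
  qed
  ultimately have "fp_on UNIV (\<lambda>x. [x \<in> L])" by simp
  then show "L \<in> class_P" by (simp add: class_P_def fp_on_def)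
qed

theorem theorem1:
  fixes \<rho> :: "bool list \<rightharpoonup> real"
  assumes "class_P \<noteq> class_NP"
    and "suitable_representation \<rho>"
  shows "\<not> d1C_computable_in_polytime \<rho>"
  using assms P_subset_NP NP_subset_P by blast

end
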